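(* Let $V$ be a valuation ring, possibly with zero divisors. The following conditions are equivalent. (1) $V$ is a Gröbner ring. (2) The ring $V$ is coherent and archimedean. (3) For every $n\geq 1$, every rational monomial order $\prec$ on $V[X_1,\ldots,X_n]$, and every finitely generated ideal $I\subseteq V[X_1,\ldots,X_n]$, the ideal $\operatorname{LT}_\prec(I)$ is finitely generated.
   Context: A valuation ring is a commutative ring with identity in which any two elements are comparable under divisibility (zero divisors are allowed). A ring is coherent if every finitely generated ideal is finitely presented. A valuation ring $V$ is archimedean if for all nonzero $a,b\in\operatorname{Rad}(V)$ there exists $k\geq1$ such that $a$ divides $b^k$; here $\operatorname{Rad}(V)$ is the Jacobson radical of $V$. $\mathbb N=\{0,1,2,\ldots\}$, $X^\alpha=X_1^{\alpha_1}\cdots X_n^{\alpha_n}$ for $\alpha\in\mathbb N^n$. Monomial order: a total order $\prec$ on the monomials $X^\alpha$ such that $1\preceq X^\alpha$ for all $\alpha$; $X^\alpha\prec X^\beta$ implies $X^{\alpha+\gamma}\prec X^{\beta+\gamma}$ for all $\gamma\in\mathbb N^n$; and every nonempty set of monomials has a least element. For $u,v\in\mathbb R^m$, $u<_{\mathrm{lex}}v$ means that the first nonzero coordinate of $v-u$ exists and is positive. A monomial order is rational if there are a finite $m$ and $Q\in\mathbb Q^{m\times n}$ with $X^\alpha\prec X^\beta\Longleftrightarrow Q\alpha<_{\mathrm{lex}}Q\beta$ for all $\alpha,\beta\in\mathbb N^n$. Leading terms include the coefficient: $\operatorname{LT}_\prec(f)=c_{\alpha_0}X^{\alpha_0}$,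 where $X^{\alpha_0}$ is the $\prec$-largest monomial in the support of $f=\sum_\alpha c_\alpha X^\alpha\ne0$. For an ideal $I$, $\operatorname{LT}_\prec(I)=\langle\operatorname{LT}_\prec(f)\mid 0\neq f\in I\rangle$. Gröbner ring: a commutative ring $R$ such that for every $n\ge1$ and every finitely generated ideal $I\subseteq R[X_1,\ldots,X_n]$, the ideal $\operatorname{LT}_{\prec_{\mathrm{lex}}}(I)$ is finitely generated, where $\prec_{\mathrm{lex}}$ is the lexicographic order with $X_1\succ\cdots\succ X_n$ ($X^a\prec_{\mathrm{lex}}X^b$ if and only if, at the first index $i$ with $a_i\neq b_i$, one has $a_i<b_i$). *)

theory Defs
  imports Complex_Main "HOL-Library.Poly_Mapping"
begin

(* The sort {comm_ring, comm_monoid_mult} is that of commutative rings with identity; unlike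
   comm_ring_1 it does not exclude the zero ring. Properties of a ring are predicates on the type
   of its elements. *)

section \<open>Ideals\<close>

(* The ring is given by a carrier A inside a type, so that the same notions apply to V
   (A = UNIV) and to V[X_1,...,X_n], a subring of the polynomials in countably many variables.
   Closure under negatives follows from absorption, as A contains -1. *)
definition is_ideal :: "'a::comm_ring set \<Rightarrow> 'a set \<Rightarrow> bool" where
  "is_ideal A I \<longleftrightarrow> I \<subseteq> A \<and> 0 \<in> I \<and> (\<forall>x\<in>I. \<forall>y\<in>I. x + y \<in> I) \<and> (\<forall>r\<in>A. \<forall>x\<in>I. r * x \<in> I)"

definition ideal_generated :: "'a::comm_ring set \<Rightarrow> 'a set \<Rightarrow> 'a set" where
  "ideal_generated A S = \<Inter>{J. is_ideal A J \<and> S \<subseteq> J}"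

definition finitely_generated_ideal :: "'a::comm_ring set \<Rightarrow> 'a set \<Rightarrow> bool" where
  "finitely_generated_ideal A I \<longleftrightarrow> (\<exists>S. finite S \<and> S \<subseteq> A \<and> I = ideal_generated A S)"

definition maximal_ideal :: "'a::comm_ring set \<Rightarrow> bool" where
  "maximal_ideal M \<longleftrightarrow> is_ideal UNIV M \<and> M \<noteq> UNIV \<and>
     (\<forall>J. is_ideal UNIV J \<and> M \<subseteq> J \<longrightarrow> J = M \<or> J = UNIV)"

definition jacobson_radical :: "'a::comm_ring set" where
  "jacobson_radical = \<Inter>{M. maximal_ideal M}"

section \<open>Valuation rings, coherence, the archimedean property\<close>

definition valuation_ring :: "'a::{comm_ring, comm_monoid_mult} itself \<Rightarrow> bool" where
  "valuation_ring _ \<longleftrightarrow> (\<forall>a b :: 'a. a dvd b \<or> b dvd a)"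

definition archimedean :: "'a::{comm_ring, comm_monoid_mult} itself \<Rightarrow> bool" where
  "archimedean _ \<longleftrightarrow>
     (\<forall>a\<in>jacobson_radical. \<forall>b\<in>jacobson_radical. a \<noteq> (0::'a) \<and> b \<noteq> 0 \<longrightarrow> (\<exists>k\<ge>1. a dvd b ^ k))"

(* The kernel of R^k -> R, c |-> c_0 g_0 + ... + c_{k-1} g_{k-1}; the elements of R^k are the
   functions on nat that vanish from k on. *)
definition syzygies :: "nat \<Rightarrow> (nat \<Rightarrow> 'a::comm_ring) \<Rightarrow> (nat \<Rightarrow> 'a) set" where
  "syzygies k g = {c. (\<forall>i\<ge>k. c i = 0) \<and> (\<Sum>i<k. c i * g i) = 0}"

(* There is a surjection from some R^k onto I whose kernel is generated by finitely many
   vectors s_0,...,s_{m-1}. *)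
definition finitely_presented_ideal :: "'a::{comm_ring, comm_monoid_mult} set \<Rightarrow> bool" where
  "finitely_presented_ideal I \<longleftrightarrow>
     (\<exists>k g. I = ideal_generated UNIV (g ` {..<k}) \<and>
        (\<exists>m s. syzygies k g = {\<lambda>i. \<Sum>j<m. d j * s j i | d :: nat \<Rightarrow> 'a. True}))"

definition coherent_ring :: "'a::{comm_ring, comm_monoid_mult} itself \<Rightarrow> bool" where
  "coherent_ring _ \<longleftrightarrow>
     (\<forall>I :: 'a set. finitely_generated_ideal UNIV I \<longrightarrow> finitely_presented_ideal I)"

section \<open>Polynomials and monomial orders\<close>

(* Exponent vectors: the variable X_{i+1} has index i. *)
type_synonym monom = "nat \<Rightarrow>\<^sub>0 nat"
type_synonym 'a mpoly = "monom \<Rightarrow>\<^sub>0 'a"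

definition monoms :: "nat \<Rightarrow> monom set" where
  "monoms n = {\<alpha>. Poly_Mapping.keys \<alpha> \<subseteq> {..<n}}"

definition poly_ring :: "nat \<Rightarrow> 'a::comm_ring mpoly set" where
  "poly_ring n = {f. Poly_Mapping.keys f \<subseteq> monoms n}"

definition monomial_order :: "nat \<Rightarrow> (monom \<Rightarrow> monom \<Rightarrow> bool) \<Rightarrow> bool" where
  "monomial_order n lt \<longleftrightarrow>
     irreflp_on (monoms n) lt \<and> transp_on (monoms n) lt \<and> totalp_on (monoms n) lt \<and>
     (\<forall>\<alpha>\<in>monoms n. \<alpha> = 0 \<or> lt 0 \<alpha>) \<and>
     (\<forall>\<alpha>\<in>monoms n. \<forall>\<beta>\<in>monoms n. \<forall>\<gamma>\<in>monoms n. lt \<alpha> \<beta> \<longrightarrow> lt (\<alpha> + \<gamma>) (\<beta> + \<gamma>)) \<and>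
     (\<forall>S. S \<subseteq> monoms n \<and> S \<noteq> {} \<longrightarrow> (\<exists>\<alpha>\<in>S. \<forall>\<beta>\<in>S. \<alpha> = \<beta> \<or> lt \<alpha> \<beta>))"

(* Vectors of R^m are represented by the first m values of a function. *)
definition lex_less :: "nat \<Rightarrow> (nat \<Rightarrow> real) \<Rightarrow> (nat \<Rightarrow> real) \<Rightarrow> bool" where
  "lex_less m u v \<longleftrightarrow> (\<exists>i<m. (\<forall>j<i. v j - u j = 0) \<and> v i - u i > 0)"

definition rational_monomial_order :: "nat \<Rightarrow> (monom \<Rightarrow> monom \<Rightarrow> bool) \<Rightarrow> bool" where
  "rational_monomial_order n lt \<longleftrightarrow> monomial_order n lt \<and>
     (\<exists>m. \<exists>Q :: nat \<Rightarrow> nat \<Rightarrow> rat. \<forall>\<alpha>\<in>monoms n. \<forall>\<beta>\<in>monoms n.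
        lt \<alpha> \<beta> \<longleftrightarrow>
        lex_less m (\<lambda>i. \<Sum>j<n. of_rat (Q i j) * of_nat (Poly_Mapping.lookup \<alpha> j))
                   (\<lambda>i. \<Sum>j<n. of_rat (Q i j) * of_nat (Poly_Mapping.lookup \<beta> j)))"

definition lex_order :: "nat \<Rightarrow> monom \<Rightarrow> monom \<Rightarrow> bool" where
  "lex_order n \<alpha> \<beta> \<longleftrightarrow>
     (\<exists>i<n. (\<forall>j<i. Poly_Mapping.lookup \<alpha> j = Poly_Mapping.lookup \<beta> j) \<and>
        Poly_Mapping.lookup \<alpha> i < Poly_Mapping.lookup \<beta> i)"

definition leading_monom :: "(monom \<Rightarrow> monom \<Rightarrow> bool) \<Rightarrow> 'a::zero mpoly \<Rightarrow> monom" where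
  "leading_monom lt f =
     (THE \<alpha>. \<alpha> \<in> Poly_Mapping.keys f \<and> (\<forall>\<beta>\<in>Poly_Mapping.keys f. \<beta> = \<alpha> \<or> lt \<beta> \<alpha>))"

definition leading_term :: "(monom \<Rightarrow> monom \<Rightarrow> bool) \<Rightarrow> 'a::zero mpoly \<Rightarrow> 'a mpoly" where
  "leading_term lt f =
     Poly_Mapping.single (leading_monom lt f) (Poly_Mapping.lookup f (leading_monom lt f))"

definition leading_ideal ::
  "nat \<Rightarrow> (monom \<Rightarrow> monom \<Rightarrow> bool) \<Rightarrow> 'a::comm_ring mpoly set \<Rightarrow> 'a mpoly set" where
  "leading_ideal n lt I =
     ideal_generated (poly_ring n) {leading_term lt f | f. f \<in> I \<and> f \<noteq> 0}"

definition groebner_ring :: "'a::{comm_ring, comm_monoid_mult} itself \<Rightarrow> bool" where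
  "groebner_ring _ \<longleftrightarrow>
     (\<forall>n\<ge>1. \<forall>I :: 'a mpoly set. finitely_generated_ideal (poly_ring n) I \<longrightarrow>
        finitely_generated_ideal (poly_ring n) (leading_ideal n (lex_order n) I))"

end

theory Submission
  imports Defs "HOL-Library.Function_Algebras"
begin

text \<open>
  Let \<open>V\<close> be coherent and archimedean. Homogenizing with an additional variable reduces the claim on
  leading ideals to homogeneous ideals. There a rational order is the successive comparison of finitely
  many weights with natural coefficients, and the leading terms are obtained by taking leading forms with
  respect to these weights one after the other. The leading forms with respect to one weight arise by
  homogenizing with respect to the weight, saturating with respect to the homogenizing variable \<open>T\<close>, and
  setting \<open>T\<close> to zero. So everything reduces to one statement (\<open>sat_fg\<close>): if \<open>J\<close> is a finitely generated
  ideal, homogeneous for a grading with components of finite rank, then the saturation \<open>(J : T\<^sup>\<infinity>)\<close> is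
  finitely generated. This needs coherence of the polynomial ring, in the form that syzygies of homogeneous
  ideals are finitely generated (\<open>syz_fg_homog\<close>), and a bound on the exponent, \<open>(J : T\<^sup>\<infinity>) = (J : T\<^sup>n)\<close>
  (\<open>sat_bounded\<close>).

  Both are proved by induction on the set of leading monomials of \<open>J\<close> over the residue field, which
  satisfies the ascending chain condition by Dickson's lemma. Choose finitely many elements of \<open>J\<close> whose
  images form a Groebner basis over the residue field, and reduce their S-polynomials and the generators of
  \<open>J\<close>. The remainders have coefficients in the maximal ideal; as \<open>V\<close> is a valuation ring, they have a
  greatest common divisor \<open>c\<close>, which occurs as one of their coefficients unless they all vanish. Modulo
  \<open>c\<close> the chosen elements form a Groebner basis with flat quotient. The quotient \<open>(J : c)\<close> is again finitely generated, because
  the annihilator of \<open>c\<close> is principal, and if \<open>c\<close> is not zero it has more leading monomials, because the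
  remainders divided by \<open>c\<close> have unit coefficients (\<open>content_basis_exists\<close>, \<open>content_induct\<close>). So it remains
  to pass from \<open>(J : c)\<close> to \<open>J\<close>. For syzygies this is the classical lifting of S-pairs, except that the
  termination of the division algorithm is replaced by a form of Nakayama's lemma (\<open>triangular_nakayama\<close>).

  For the bound on the exponent of \<open>T\<close> the archimedean property enters: modulo \<open>c\<close> every element of the
  maximal ideal is nilpotent, unless \<open>V\<close> is a domain and \<open>c = 0\<close>. In the nilpotent case one divides by the
  Groebner basis with its powers of \<open>T\<close> removed; this gains a factor from the maximal ideal at the price of
  a fixed power of \<open>T\<close>, and can be iterated until the factor vanishes. In the other case the quotient by
  \<open>J\<close> has no constant torsion and the bound comes from the fraction field.

  Conversely, the leading ideals of the ideals generated by \<open>a X + Y\<close> and by \<open>1 + b X\<close> and \<open>a\<close> show that a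
  valuation ring that is a Groebner ring has principal annihilators and is archimedean
  (\<open>groebner_annihilator\<close>, \<open>groebner_archimedean\<close>).
\<close>

section \<open>Valuation rings\<close>

definition nonunit :: "'a::{comm_ring, comm_monoid_mult} \<Rightarrow> bool" where
  "nonunit x \<longleftrightarrow> \<not> x dvd 1"

lemma dvd_add_ring: "c dvd a \<Longrightarrow> c dvd b \<Longrightarrow> c dvd a + (b::'a::{comm_ring, comm_monoid_mult})"
  unfolding dvd_def by (metis distrib_left)

lemma dvd_zero_ring: "c dvd (0::'a::{comm_ring, comm_monoid_mult})"
  unfolding dvd_def by (metis mult_zero_right)

lemma dvd_uminus_ring: "c dvd a \<Longrightarrow> c dvd - (a::'a::{comm_ring, comm_monoid_mult})"
  unfolding dvd_def by (metis mult_minus_right)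

lemma dvd_sum_ring: "(\<And>i. i \<in> A \<Longrightarrow> c dvd f i) \<Longrightarrow> c dvd (\<Sum>i\<in>A. f i :: 'a::{comm_ring, comm_monoid_mult})"
  by (induction A rule: infinite_finite_induct) (auto simp: dvd_zero_ring dvd_add_ring)

lemma nonunit_mult: "nonunit x \<Longrightarrow> nonunit (x * y)"
  unfolding nonunit_def using dvd_mult_left by blast

lemma nonunit_mult2: "nonunit x \<Longrightarrow> nonunit (y * x)"
  by (metis mult.commute nonunit_mult)

lemma nonunit_dvd: "nonunit x \<Longrightarrow> x dvd y \<Longrightarrow> nonunit y"
  unfolding nonunit_def using dvd_trans by blast

lemma nonunit_uminus: "nonunit x \<Longrightarrow> nonunit (- x)"
  unfolding nonunit_def dvd_def by (metis minus_mult_commute)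

lemma unit_inverse: "\<not> nonunit x \<Longrightarrow> \<exists>y. x * y = 1 \<and> \<not> nonunit y"
  unfolding nonunit_def dvd_def by (metis mult.commute)

locale valuation_ring_nontrivial =
  fixes V :: "'a::{comm_ring, comm_monoid_mult} itself"
  assumes val: "valuation_ring V" and nontriv: "(1::'a) \<noteq> 0"
begin

lemma dvd_total: "(a::'a) dvd b \<or> b dvd a"
  using val by (auto simp: valuation_ring_def)

lemma nonunit_0: "nonunit (0::'a)"
  unfolding nonunit_def dvd_def using nontriv by auto

lemma unit_1: "\<not> nonunit (1::'a)"
  unfolding nonunit_def by simp

lemma nonunit_add: "nonunit x \<Longrightarrow> nonunit y \<Longrightarrow> nonunit (x + y :: 'a)"
  using dvd_total[of x y] dvd_add_ring[of x x y] dvd_add_ring[of y x y] nonunit_dvd[of x "x + y"]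
    nonunit_dvd[of y "x + y"] by auto

lemma nonunit_diff: "nonunit x \<Longrightarrow> nonunit y \<Longrightarrow> nonunit (x - y :: 'a)"
  using nonunit_add[of x "- y"] nonunit_uminus[of y] by simp

lemma nonunit_sum: "(\<And>i. i \<in> A \<Longrightarrow> nonunit (f i)) \<Longrightarrow> nonunit (\<Sum>i\<in>A. f i :: 'a)"
  by (induction A rule: infinite_finite_induct) (auto simp: nonunit_0 nonunit_add)

lemma unit_add_nonunit: "\<not> nonunit x \<Longrightarrow> nonunit y \<Longrightarrow> \<not> nonunit (x + y :: 'a)"
  using nonunit_diff[of "x + y" y] by auto

text \<open>If \<open>c = c u\<close> for a nonunit \<open>u\<close>, then the unit \<open>1 - u\<close> annihilates \<open>c\<close>.\<close>

lemma mult_nonunit_self: "c * u = (c::'a) \<Longrightarrow> nonunit u \<Longrightarrow> c = 0"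
proof -
  assume a: "c * u = c" "nonunit u"
  then have "\<not> nonunit (1 - u)"
    using unit_add_nonunit[OF unit_1, of "- u"] by (simp add: nonunit_uminus)
  then obtain i where "(1 - u) * i = 1" using unit_inverse by blast
  then have "c = c * (1 - u) * i" by (simp add: mult.assoc)
  also have "\<dots> = 0" using a by (simp add: right_diff_distrib)
  finally show "c = 0" .
qed

lemma finite_dvd_min: "finite S \<Longrightarrow> S \<noteq> {} \<Longrightarrow> \<exists>c\<in>S. \<forall>x\<in>S. c dvd (x::'a)"
proof (induction S rule: finite_ne_induct)
  case (insert x F)
  then show ?case by (metis dvd_refl dvd_total dvd_trans insertE insertI1 insertI2)
qed auto

lemma finite_content: "finite S \<Longrightarrow> \<exists>c\<in>insert 0 S. \<forall>x\<in>S. c dvd (x::'a)"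
  using finite_dvd_min[of S] by (cases "S = {}") auto

lemma cancel_common_summand: "q + p = y \<Longrightarrow> y = w + (p + r) \<Longrightarrow> q = w + (r :: 'b::ab_group_add)"
  by (simp add: algebra_simps)

text \<open>
  This form of Nakayama's lemma replaces the termination of division algorithms below, where reducing a
  term produces smaller monomials with arbitrary coefficients, but also larger ones with coefficients in
  the maximal ideal. In the equation of a minimal index all coefficients are nonunits, so it can be solved
  for its own unknown; eliminating this unknown from the other equations changes their coefficients by
  nonunits only and therefore keeps the triangular form.
\<close>

lemma triangular_nakayama:
  fixes y :: "'k \<Rightarrow> 'b::ab_group_add" and sc :: "'a \<Rightarrow> 'b \<Rightarrow> 'b"
  assumes sc_add: "\<And>c x y. sc c (x + y) = sc c x + sc c y"
    and sc_ladd: "\<And>a b x. sc (a + b) x = sc a x + sc b x"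
    and sc_mul: "\<And>a b x. sc a (sc b x) = sc (a * b) x"
    and sc_one: "\<And>x. sc 1 x = x"
    and W: "\<And>x y. x \<in> W \<Longrightarrow> y \<in> W \<Longrightarrow> x + y \<in> W" "\<And>c x. x \<in> W \<Longrightarrow> sc c x \<in> W"
    and "finite A" and r: "transp r" "irreflp r"
    and y: "\<And>a. a \<in> A \<Longrightarrow> \<exists>w u. w \<in> W \<and> y a = w + (\<Sum>b\<in>A. sc (u b) (y b)) \<and>
      (\<forall>b\<in>A. nonunit (u b) \<or> r b a)"
  shows "\<forall>a\<in>A. y a \<in> W"
  using \<open>finite A\<close> y
proof (induction A rule: finite_psubset_induct)
  case (psubset A)
  show ?case
  proof (cases "A = {}")
    case False
    have sc0: "sc c 0 = 0" for c using sc_add[of c 0 0] by simp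
    have sc_sum: "sc c (\<Sum>b\<in>B. f b) = (\<Sum>b\<in>B. sc c (f b))" for c f and B :: "'k set"
      by (induction B rule: infinite_finite_induct) (auto simp: sc0 sc_add)
    have asy: "asymp_on A r" "transp_on A r"
      using r by (auto simp: asymp_on_def irreflp_def transp_def transp_on_def)
    obtain a0 where a0: "a0 \<in> A" "\<forall>b\<in>A. b \<noteq> a0 \<longrightarrow> \<not> r b a0"
      using Finite_Set.bex_min_element[OF psubset.hyps asy(1)] asy False by metis
    let ?B = "A - {a0}"
    have split: "(\<Sum>b\<in>A. f b) = f a0 + (\<Sum>b\<in>?B. f b)" for f :: "'k \<Rightarrow> 'b"
      using sum.remove[OF psubset.hyps a0(1)] .
    obtain w u where w: "w \<in> W" "y a0 = w + (\<Sum>b\<in>A. sc (u b) (y b))"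
      and u: "\<forall>b\<in>A. nonunit (u b) \<or> r b a0" using psubset.prems[OF a0(1)] by blast
    have u': "nonunit (u b)" if "b \<in> A" for b using u a0 r(2) that by (metis irreflpD)
    have "\<not> nonunit (1 + - u a0)"
      using unit_add_nonunit[OF unit_1] nonunit_uminus u'[OF a0(1)] by blast
    then obtain i where i: "(1 + - u a0) * i = 1" using unit_inverse by blast
    have "sc (1 + - u a0) (y a0) + sc (u a0) (y a0) = y a0"
      by (simp flip: sc_ladd add: sc_one)
    then have "sc (1 + - u a0) (y a0) = w + (\<Sum>b\<in>?B. sc (u b) (y b))"
      using w(2) unfolding split[of "\<lambda>b. sc (u b) (y b)"]
      by (rule cancel_common_summand)
    then have "sc i (sc (1 + - u a0) (y a0)) = sc i w + (\<Sum>b\<in>?B. sc (i * u b) (y b))"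
      by (simp add: sc_add sc_sum sc_mul)
    moreover have "sc i (sc (1 + - u a0) (y a0)) = y a0"
      by (metis i mult.commute sc_mul sc_one)
    ultimately have ya0: "y a0 = sc i w + (\<Sum>b\<in>?B. sc (i * u b) (y b))" by simp
    have "\<forall>a\<in>?B. y a \<in> W"
    proof (rule psubset.IH)
      show "?B \<subset> A" using a0 by auto
      fix a assume a: "a \<in> ?B"
      then obtain w1 u1 where w1: "w1 \<in> W" "y a = w1 + (\<Sum>b\<in>A. sc (u1 b) (y b))"
        and u1: "\<forall>b\<in>A. nonunit (u1 b) \<or> r b a" using psubset.prems[of a] by blast
      have "y a = w1 + (sc (u1 a0) (sc i w + (\<Sum>b\<in>?B. sc (i * u b) (y b)))
          + (\<Sum>b\<in>?B. sc (u1 b) (y b)))"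
        using w1(2) unfolding split[of "\<lambda>b. sc (u1 b) (y b)"] using ya0 by simp
      also have "\<dots> = (w1 + sc (u1 a0) (sc i w)) +
          (\<Sum>b\<in>?B. sc (u1 a0 * (i * u b) + u1 b) (y b))"
        by (simp add: sc_add sc_sum sc_ladd sc_mul sum.distrib add.assoc)
      finally have "y a = (w1 + sc (u1 a0) (sc i w)) +
          (\<Sum>b\<in>?B. sc (u1 a0 * (i * u b) + u1 b) (y b))" .
      moreover have "w1 + sc (u1 a0) (sc i w) \<in> W"
        by (intro W w1(1) w(1))
      moreover have "\<forall>b\<in>?B. nonunit (u1 a0 * (i * u b) + u1 b) \<or> r b a"
      proof
        fix b assume "b \<in> ?B"
        then have b: "b \<in> A" by simp
        show "nonunit (u1 a0 * (i * u b) + u1 b) \<or> r b a"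
          using nonunit_add[OF nonunit_mult2[OF nonunit_mult2[OF u'[OF b]]]] u1 b by blast
      qed
      ultimately show "\<exists>w u. w \<in> W \<and> y a = w + (\<Sum>b\<in>?B. sc (u b) (y b)) \<and>
          (\<forall>b\<in>?B. nonunit (u b) \<or> r b a)"
        by (intro exI[of _ "w1 + sc (u1 a0) (sc i w)"] exI[of _ "\<lambda>b. u1 a0 * (i * u b) + u1 b"]) blast
    qed
    moreover have "y a0 \<in> W"
    proof -
      have "(\<Sum>b\<in>B. sc (i * u b) (y b)) + sc i w \<in> W" if "finite B" "\<forall>b\<in>B. y b \<in> W" for B
        using that by (induction B rule: finite_induct) (auto simp: W w add.assoc)
      then show ?thesis using ya0 calculation psubset.hyps by (metis add.commute finite_Diff)
    qed
    ultimately show ?thesis by auto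
  qed auto
qed

end

section \<open>Dickson's lemma\<close>

definition monom_dvd :: "monom \<Rightarrow> monom \<Rightarrow> bool" where
  "monom_dvd \<beta> \<alpha> \<longleftrightarrow> (\<forall>i. Poly_Mapping.lookup \<beta> i \<le> Poly_Mapping.lookup \<alpha> i)"

lemma monom_dvd_diff: "monom_dvd \<beta> \<alpha> \<Longrightarrow> \<beta> + (\<alpha> - \<beta>) = \<alpha>"
  by (rule poly_mapping_eqI) (simp add: lookup_add lookup_minus monom_dvd_def)

lemma monom_dvd_add [simp]: "monom_dvd \<beta> (\<beta> + \<delta>)" "monom_dvd \<beta> (\<delta> + \<beta>)"
  by (simp_all add: monom_dvd_def lookup_add)

lemma monom_dvd_refl [simp]: "monom_dvd \<beta> \<beta>" by (simp add: monom_dvd_def)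

lemma monom_dvd_trans: "monom_dvd \<alpha> \<beta> \<Longrightarrow> monom_dvd \<beta> \<gamma> \<Longrightarrow> monom_dvd \<alpha> \<gamma>"
  unfolding monom_dvd_def by (meson le_trans)

lemma monom_dvd_iff: "monom_dvd \<beta> \<alpha> \<longleftrightarrow> (\<exists>\<delta>. \<alpha> = \<beta> + \<delta>)"
  by (metis monom_dvd_add(1) monom_dvd_diff)

lemma monoms_iff: "\<alpha> \<in> monoms n \<longleftrightarrow> (\<forall>i\<ge>n. Poly_Mapping.lookup \<alpha> i = 0)"
  unfolding monoms_def by (auto simp: in_keys_iff subset_iff not_less[symmetric])

lemma monoms_0 [simp]: "0 \<in> monoms n" by (simp add: monoms_iff)

lemma monoms_add [simp]: "\<alpha> + \<beta> \<in> monoms n \<longleftrightarrow> \<alpha> \<in> monoms n \<and> \<beta> \<in> monoms n"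
  by (auto simp: monoms_iff lookup_add)

lemma monoms_diff [simp]: "\<alpha> \<in> monoms n \<Longrightarrow> \<alpha> - \<beta> \<in> monoms n"
  by (auto simp: monoms_iff lookup_minus)

lemma monoms_mono: "n \<le> m \<Longrightarrow> \<alpha> \<in> monoms n \<Longrightarrow> \<alpha> \<in> monoms m"
  by (auto simp: monoms_iff)

lemma finite_bounded_monoms: "finite {\<alpha>\<in>monoms n. \<forall>i<n. Poly_Mapping.lookup \<alpha> i \<le> M}"
proof -
  have "inj_on Poly_Mapping.lookup UNIV"
    by (intro injI poly_mapping_eqI) simp
  moreover have "Poly_Mapping.lookup ` {\<alpha>\<in>monoms n. \<forall>i<n. Poly_Mapping.lookup \<alpha> i \<le> M}
      \<subseteq> {f. \<forall>i. (i \<in> {..<n} \<longrightarrow> f i \<in> {..M}) \<and> (i \<notin> {..<n} \<longrightarrow> f i = 0)}"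
    by (auto simp: monoms_iff)
  moreover have "finite {f :: nat \<Rightarrow> nat. \<forall>i. (i \<in> {..<n} \<longrightarrow> f i \<in> {..M}) \<and> (i \<notin> {..<n} \<longrightarrow> f i = 0)}"
    by (rule finite_set_of_finite_funs) auto
  ultimately show ?thesis by (meson finite_imageD finite_subset inj_on_subset subset_UNIV)
qed

text \<open>
  Induction on the number of variables: let \<open>M\<close> bound the last exponent in a finite basis of the
  projection that forgets the last variable. Monomials whose last exponent is at least \<open>M\<close> are covered by
  this basis, and for each smaller exponent the projection of the corresponding slice has a finite basis.
\<close>

lemma dickson:
  assumes "S \<subseteq> monoms n"
  shows "\<exists>B. finite B \<and> B \<subseteq> S \<and> (\<forall>\<alpha>\<in>S. \<exists>\<beta>\<in>B. monom_dvd \<beta> \<alpha>)"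
  using assms
proof (induction n arbitrary: S)
  case 0
  have "S \<subseteq> {0}"
  proof
    fix x assume "x \<in> S"
    then show "x \<in> {0}" using 0 by (auto simp: monoms_def)
  qed
  then show ?case by (intro exI[of _ S]) (auto intro: finite_subset monom_dvd_refl)
next
  case (Suc n)
  let ?p = "\<lambda>\<alpha>::monom. Poly_Mapping.update n 0 \<alpha>"
  have p: "?p ` T \<subseteq> monoms n" if "T \<subseteq> S" for T
    using Suc.prems that by (auto simp: monoms_iff lookup_update)
  have ex: "\<exists>B. finite B \<and> B \<subseteq> T \<and> (\<forall>\<alpha>\<in>T. \<exists>\<beta>\<in>B. monom_dvd (?p \<beta>) (?p \<alpha>))" if TS: "T \<subseteq> S" for T
  proof -
    obtain B where B: "finite B" "B \<subseteq> ?p ` T" "\<forall>\<alpha>\<in>?p ` T. \<exists>\<beta>\<in>B. monom_dvd \<beta> \<alpha>"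
      using Suc.IH[OF p[OF TS]] by blast
    obtain B' where "B' \<subseteq> T" "finite B'" "B = ?p ` B'" using finite_subset_image[OF B(1,2)] by metis
    with B(3) show ?thesis by (intro exI[of _ B']) auto
  qed
  obtain B where B: "finite B" "B \<subseteq> S" "\<forall>\<alpha>\<in>S. \<exists>\<beta>\<in>B. monom_dvd (?p \<beta>) (?p \<alpha>)"
    using ex[of S] by blast
  define M where "M = Max (insert 0 ((\<lambda>\<alpha>. Poly_Mapping.lookup \<alpha> n) ` B))"
  have M: "Poly_Mapping.lookup \<beta> n \<le> M" if "\<beta> \<in> B" for \<beta>
    unfolding M_def using B that by (intro Max_ge) auto
  let ?S = "\<lambda>j. {\<alpha>\<in>S. Poly_Mapping.lookup \<alpha> n = j}"
  have "\<forall>j. \<exists>B. finite B \<and> B \<subseteq> ?S j \<and> (\<forall>\<alpha>\<in>?S j. \<exists>\<beta>\<in>B. monom_dvd (?p \<beta>) (?p \<alpha>))"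
    by (intro allI ex) auto
  from choice[OF this] obtain C where
    C: "\<And>j. finite (C j) \<and> C j \<subseteq> ?S j \<and> (\<forall>\<alpha>\<in>?S j. \<exists>\<beta>\<in>C j. monom_dvd (?p \<beta>) (?p \<alpha>))"
    by blast
  have lift: "monom_dvd \<beta> \<alpha>" if "monom_dvd (?p \<beta>) (?p \<alpha>)" "Poly_Mapping.lookup \<beta> n \<le> Poly_Mapping.lookup \<alpha> n" for \<alpha> \<beta>
    unfolding monom_dvd_def
  proof
    fix i show "Poly_Mapping.lookup \<beta> i \<le> Poly_Mapping.lookup \<alpha> i"
      using that(1)[unfolded monom_dvd_def, rule_format, of i] that(2)
      by (cases "i = n") (auto simp: lookup_update)
  qed
  show ?case
  proof (intro exI[of _ "B \<union> (\<Union>j<M. C j)"] conjI ballI)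
    show "finite (B \<union> (\<Union>j<M. C j))" using B C by auto
    show "B \<union> (\<Union>j<M. C j) \<subseteq> S" using B C by blast
    fix \<alpha> assume a: "\<alpha> \<in> S"
    show "\<exists>\<beta>\<in>B \<union> (\<Union>j<M. C j). monom_dvd \<beta> \<alpha>"
    proof (cases "M \<le> Poly_Mapping.lookup \<alpha> n")
      case True
      obtain \<beta> where "\<beta> \<in> B" "monom_dvd (?p \<beta>) (?p \<alpha>)" using B(3) a by blast
      then show ?thesis using lift M True le_trans by blast
    next
      case False
      let ?j = "Poly_Mapping.lookup \<alpha> n"
      obtain \<beta> where b: "\<beta> \<in> C ?j" "monom_dvd (?p \<beta>) (?p \<alpha>)" using C[of ?j] a by blast
      then have "Poly_Mapping.lookup \<beta> n = ?j" using C[of ?j] by blast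
      then show ?thesis using b lift[of \<beta> \<alpha>] False by auto
    qed
  qed
qed

definition monom_upset :: "nat \<Rightarrow> monom set \<Rightarrow> bool" where
  "monom_upset n L \<longleftrightarrow> L \<subseteq> monoms n \<and> (\<forall>\<alpha>\<in>L. \<forall>\<beta>\<in>monoms n. monom_dvd \<alpha> \<beta> \<longrightarrow> \<beta> \<in> L)"

text \<open>The ascending chain condition for monomial ideals, which drives all inductions on ideals below.\<close>

lemma wf_monom_upsets: "wf {(L', L). monom_upset n L \<and> monom_upset n L' \<and> L \<subset> L'}"
  unfolding wf_iff_no_infinite_down_chain
proof
  assume "\<exists>f. \<forall>i. (f (Suc i), f i) \<in> {(L', L). monom_upset n L \<and> monom_upset n L' \<and> L \<subset> L'}"
  then obtain f where f: "\<And>i. monom_upset n (f i)" "\<And>i. f i \<subset> f (Suc i)" by blast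
  have mono: "f i \<subseteq> f j" if "i \<le> j" for i j
    using lift_Suc_mono_le[of f] f(2) that by (metis psubset_imp_subset)
  obtain B where B: "finite B" "B \<subseteq> (\<Union>i. f i)" "\<forall>\<alpha>\<in>(\<Union>i. f i). \<exists>\<beta>\<in>B. monom_dvd \<beta> \<alpha>"
    using dickson[of "\<Union>i. f i" n] f(1) unfolding monom_upset_def by blast
  have "\<exists>k. B \<subseteq> f k"
    using B(1,2)
  proof (induction B rule: finite_induct)
    case (insert x F)
    then obtain k j where "F \<subseteq> f k" "x \<in> f j" by auto
    then show ?case using mono[of k "max k j"] mono[of j "max k j"]
      by (intro exI[of _ "max k j"]) auto
  qed auto
  then obtain k where k: "B \<subseteq> f k" ..
  have "f (Suc k) \<subseteq> f k"
  proof
    fix \<alpha> assume a: "\<alpha> \<in> f (Suc k)"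
    then obtain \<beta> where "\<beta> \<in> B" "monom_dvd \<beta> \<alpha>" using B(3) by blast
    then show "\<alpha> \<in> f k" using k f(1) a unfolding monom_upset_def by blast
  qed
  then show False using f(2) by blast
qed

section \<open>Ideals of subrings\<close>

text \<open>
  The unit is required only as an element that acts as the identity, so that the notion also covers the
  zero ring and its polynomials.
\<close>

definition unital_subring :: "'a::comm_ring set \<Rightarrow> bool" where
  "unital_subring A \<longleftrightarrow> 0 \<in> A \<and> (\<forall>x\<in>A. \<forall>y\<in>A. x + y \<in> A \<and> x * y \<in> A) \<and> (\<forall>x\<in>A. - x \<in> A) \<and>
     (\<exists>e\<in>A. \<forall>x\<in>A. e * x = x)"

lemma is_idealD:
  assumes "is_ideal A I"
  shows "I \<subseteq> A" "0 \<in> I" "\<And>x y. x \<in> I \<Longrightarrow> y \<in> I \<Longrightarrow> x + y \<in> I" "\<And>r x. r \<in> A \<Longrightarrow> x \<in> I \<Longrightarrow> r * x \<in> I"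
  using assms by (auto simp: is_ideal_def)

lemma is_ideal_sum: "is_ideal A I \<Longrightarrow> (\<And>i. i \<in> K \<Longrightarrow> f i \<in> I) \<Longrightarrow> (\<Sum>i\<in>K. f i) \<in> I"
  by (induction K rule: infinite_finite_induct) (auto simp: is_idealD)

lemma is_ideal_uminus:
  assumes "unital_subring A" "is_ideal A I" "x \<in> I"
  shows "- x \<in> I"
proof -
  obtain e where e: "e \<in> A" "\<forall>x\<in>A. e * x = x" using assms by (auto simp: unital_subring_def)
  have "- e \<in> A" using e assms(1) by (auto simp: unital_subring_def)
  then have "(- e) * x \<in> I" using is_idealD(4)[OF assms(2)] assms(3) by blast
  moreover have "x \<in> A" using assms is_idealD by blast
  ultimately show ?thesis using e by simp
qed

lemma is_ideal_diff:
  "unital_subring A \<Longrightarrow> is_ideal A I \<Longrightarrow> x \<in> I \<Longrightarrow> y \<in> I \<Longrightarrow> x - y \<in> I"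
  using is_idealD(3)[of A I x "- y"] is_ideal_uminus[of A I y] by simp

lemma ideal_generated_superset: "S \<subseteq> ideal_generated A S"
  by (auto simp: ideal_generated_def)

lemma ideal_generated_least: "is_ideal A J \<Longrightarrow> S \<subseteq> J \<Longrightarrow> ideal_generated A S \<subseteq> J"
  by (auto simp: ideal_generated_def)

lemma ideal_generated_is_ideal:
  assumes "unital_subring A" "S \<subseteq> A"
  shows "is_ideal A (ideal_generated A S)"
proof -
  have "is_ideal A A" using assms(1) by (auto simp: is_ideal_def unital_subring_def)
  then have "ideal_generated A S \<subseteq> A" using assms(2) by (rule ideal_generated_least)
  then show ?thesis unfolding is_ideal_def ideal_generated_def by blast
qed

lemma ideal_generated_eqI:
  assumes "unital_subring A" "S \<subseteq> A" "T \<subseteq> A" "S \<subseteq> ideal_generated A T" "T \<subseteq> ideal_generated A S"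
  shows "ideal_generated A S = ideal_generated A T"
  using ideal_generated_least[OF ideal_generated_is_ideal[OF assms(1,2)], of T]
    ideal_generated_least[OF ideal_generated_is_ideal[OF assms(1,3)], of S] assms(4,5) by auto

lemma ideal_generated_mono: "S \<subseteq> T \<Longrightarrow> ideal_generated A S \<subseteq> ideal_generated A T"
  by (auto simp: ideal_generated_def)

lemma ideal_generated_family:
  assumes A: "unital_subring A" and K: "finite K" "h ` K \<subseteq> A"
  shows "x \<in> ideal_generated A (h ` K) \<longleftrightarrow> (\<exists>p. (\<forall>k\<in>K. p k \<in> A) \<and> x = (\<Sum>k\<in>K. p k * h k))"
proof
  let ?J = "{x. \<exists>p. (\<forall>k\<in>K. p k \<in> A) \<and> x = (\<Sum>k\<in>K. p k * h k)}"
  obtain e where e: "e \<in> A" "\<forall>x\<in>A. e * x = x" using A by (auto simp: unital_subring_def)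
  have sumA: "(\<Sum>k\<in>K. f k) \<in> A" if "\<And>k. k \<in> K \<Longrightarrow> f k \<in> A" for f
    using that A by (induction K rule: infinite_finite_induct) (auto simp: unital_subring_def)
  have "is_ideal A ?J"
    unfolding is_ideal_def
  proof (intro conjI ballI)
    show "?J \<subseteq> A"
    proof
      fix x assume "x \<in> ?J"
      then obtain p where p: "\<forall>k\<in>K. p k \<in> A" "x = (\<Sum>k\<in>K. p k * h k)" by blast
      then show "x \<in> A" using K A by (auto intro!: sumA simp: unital_subring_def)
    qed
    show "0 \<in> ?J" using A by (auto intro!: exI[of _ "\<lambda>_. 0"] simp: unital_subring_def)
    fix x assume "x \<in> ?J"
    then obtain p where p: "\<forall>k\<in>K. p k \<in> A" "x = (\<Sum>k\<in>K. p k * h k)" by blast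
    { fix y assume "y \<in> ?J"
      then obtain q where q: "\<forall>k\<in>K. q k \<in> A" "y = (\<Sum>k\<in>K. q k * h k)" by blast
      show "x + y \<in> ?J" using p q A
        by (auto intro!: exI[of _ "\<lambda>k. p k + q k"] simp: unital_subring_def distrib_right sum.distrib) }
    { fix r assume "r \<in> A"
      then show "r * x \<in> ?J" using p A
        by (auto intro!: exI[of _ "\<lambda>k. r * p k"] simp: unital_subring_def sum_distrib_left mult.assoc) }
  qed
  moreover have "h ` K \<subseteq> ?J"
  proof safe
    fix k assume k: "k \<in> K"
    have "(\<Sum>i\<in>K. (if i = k then e else 0) * h i) = (\<Sum>i\<in>K. if i = k then e * h i else 0)"
      by (rule sum.cong) auto
    also have "\<dots> = h k" using k K e by (auto simp: sum.delta)
    finally show "\<exists>p. (\<forall>k\<in>K. p k \<in> A) \<and> h k = (\<Sum>i\<in>K. p i * h i)"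
      using e A by (intro exI[of _ "\<lambda>i. if i = k then e else 0"]) (auto simp: unital_subring_def)
  qed
  ultimately have "ideal_generated A (h ` K) \<subseteq> ?J" by (rule ideal_generated_least)
  then show "x \<in> ideal_generated A (h ` K) \<Longrightarrow> \<exists>p. (\<forall>k\<in>K. p k \<in> A) \<and> x = (\<Sum>k\<in>K. p k * h k)"
    by auto
  note I = ideal_generated_is_ideal[OF A K(2)]
  have "p k * h k \<in> ideal_generated A (h ` K)" if "k \<in> K" "p k \<in> A" for p k
    using is_idealD(4)[OF I that(2)] that(1) ideal_generated_superset[of "h ` K" A] by auto
  then show "\<exists>p. (\<forall>k\<in>K. p k \<in> A) \<and> x = (\<Sum>k\<in>K. p k * h k) \<Longrightarrow> x \<in> ideal_generated A (h ` K)"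
    by (elim exE conjE, hypsubst) (rule is_ideal_sum[OF I], simp)
qed

lemma fg_ideal_finite_subset:
  assumes A: "unital_subring A" and S: "S \<subseteq> A" and fg: "finitely_generated_ideal A (ideal_generated A S)"
  shows "\<exists>S0. finite S0 \<and> S0 \<subseteq> S \<and> ideal_generated A S0 = ideal_generated A S"
proof -
  let ?J = "{x. \<exists>S0. finite S0 \<and> S0 \<subseteq> S \<and> x \<in> ideal_generated A S0}"
  have id: "is_ideal A (ideal_generated A T)" if "T \<subseteq> S" for T
    using ideal_generated_is_ideal[OF A] S that by blast
  have "is_ideal A ?J"
    unfolding is_ideal_def
  proof (intro conjI ballI)
    show "?J \<subseteq> A" using is_idealD(1)[OF id] by blast
    show "0 \<in> ?J" using is_idealD(2)[OF id[of "{}"]] by blast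
    fix x assume "x \<in> ?J"
    then obtain X where X: "finite X" "X \<subseteq> S" "x \<in> ideal_generated A X" by blast
    { fix y assume "y \<in> ?J"
      then obtain Y where Y: "finite Y" "Y \<subseteq> S" "y \<in> ideal_generated A Y" by blast
      have "x \<in> ideal_generated A (X \<union> Y)" "y \<in> ideal_generated A (X \<union> Y)"
        using X Y ideal_generated_mono[of X "X \<union> Y" A] ideal_generated_mono[of Y "X \<union> Y" A] by auto
      then have "x + y \<in> ideal_generated A (X \<union> Y)"
        using is_idealD(3)[OF id[of "X \<union> Y"]] X Y by blast
      then show "x + y \<in> ?J" using X Y by (intro CollectI exI[of _ "X \<union> Y"]) auto }
    { fix r assume "r \<in> A"
      then have "r * x \<in> ideal_generated A X" using is_idealD(4)[OF id[OF X(2)]] X(3) by blast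
      then show "r * x \<in> ?J" using X by blast }
  qed
  moreover have "S \<subseteq> ?J"
  proof
    fix x assume "x \<in> S"
    then show "x \<in> ?J"
      by (intro CollectI exI[of _ "{x}"]) (use ideal_generated_superset[of "{x}" A] in auto)
  qed
  ultimately have J: "ideal_generated A S \<subseteq> ?J" by (rule ideal_generated_least)
  obtain F where F: "finite F" "F \<subseteq> A" "ideal_generated A S = ideal_generated A F"
    using fg by (auto simp: finitely_generated_ideal_def)
  have FJ: "F \<subseteq> ?J" using J F(3) ideal_generated_superset[of F A] by auto
  have "\<exists>S0. finite S0 \<and> S0 \<subseteq> S \<and> F \<subseteq> ideal_generated A S0"
    using F(1) FJ
  proof (induction F rule: finite_induct)
    case (insert x F)
    obtain X where X: "finite X" "X \<subseteq> S" "x \<in> ideal_generated A X" using insert.prems by auto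
    obtain Y where Y: "finite Y" "Y \<subseteq> S" "F \<subseteq> ideal_generated A Y" using insert by auto
    from X Y show ?case using ideal_generated_mono[of X "X \<union> Y" A] ideal_generated_mono[of Y "X \<union> Y" A]
      by (intro exI[of _ "X \<union> Y"]) auto
  qed auto
  then obtain S0 where S0: "finite S0" "S0 \<subseteq> S" "F \<subseteq> ideal_generated A S0" by blast
  then have "ideal_generated A F \<subseteq> ideal_generated A S0"
    using ideal_generated_least[OF id[OF S0(2)]] by auto
  then have "ideal_generated A S0 = ideal_generated A S"
    using F(3) ideal_generated_mono[OF S0(2), of A] by auto
  then show ?thesis using S0 by auto
qed

lemma image_ideal_generated:
  assumes A: "unital_subring A" and B: "unital_subring B" and S: "S \<subseteq> A" and onto: "\<psi> ` A = B"
    and add: "\<And>x y. x \<in> A \<Longrightarrow> y \<in> A \<Longrightarrow> \<psi> (x + y) = \<psi> x + \<psi> y"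
    and mult: "\<And>x y. x \<in> A \<Longrightarrow> y \<in> A \<Longrightarrow> \<psi> (x * y) = \<psi> x * \<psi> y"
  shows "\<psi> ` ideal_generated A S = ideal_generated B (\<psi> ` S)"
proof
  have SB: "\<psi> ` S \<subseteq> B" using S onto by blast
  have zero: "\<psi> 0 = 0" using add[of 0 0] A by (auto simp: unital_subring_def)
  note IB = ideal_generated_is_ideal[OF B SB] and IA = ideal_generated_is_ideal[OF A S]
  have "is_ideal A {x\<in>A. \<psi> x \<in> ideal_generated B (\<psi> ` S)}"
    using A onto is_idealD[OF IB] unfolding is_ideal_def unital_subring_def
    by (auto simp: add mult zero)
  moreover have "S \<subseteq> {x\<in>A. \<psi> x \<in> ideal_generated B (\<psi> ` S)}"
    using S ideal_generated_superset[of "\<psi> ` S" B] by auto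
  ultimately show "\<psi> ` ideal_generated A S \<subseteq> ideal_generated B (\<psi> ` S)"
    using ideal_generated_least[of A "{x\<in>A. \<psi> x \<in> ideal_generated B (\<psi> ` S)}" S] by auto
  have "is_ideal B (\<psi> ` ideal_generated A S)"
    unfolding is_ideal_def
  proof (intro conjI ballI)
    show "\<psi> ` ideal_generated A S \<subseteq> B" using onto is_idealD(1)[OF IA] by blast
    show "0 \<in> \<psi> ` ideal_generated A S" using zero is_idealD(2)[OF IA] by (metis imageI)
    fix x assume "x \<in> \<psi> ` ideal_generated A S"
    then obtain x' where x': "x' \<in> ideal_generated A S" "x = \<psi> x'" by blast
    then have xA: "x' \<in> A" using is_idealD(1)[OF IA] by blast
    { fix y assume "y \<in> \<psi> ` ideal_generated A S"
      then obtain y' where y': "y' \<in> ideal_generated A S" "y = \<psi> y'" by blast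
      then have "x + y = \<psi> (x' + y')" using xA add is_idealD(1)[OF IA] x' by auto
      then show "x + y \<in> \<psi> ` ideal_generated A S" using x' y' is_idealD(3)[OF IA] by blast }
    { fix r assume "r \<in> B"
      then obtain r' where r': "r' \<in> A" "r = \<psi> r'" using onto by blast
      then have "r * x = \<psi> (r' * x')" using xA mult x' by auto
      then show "r * x \<in> \<psi> ` ideal_generated A S" using x' r' is_idealD(4)[OF IA] by blast }
  qed
  then show "ideal_generated B (\<psi> ` S) \<subseteq> \<psi> ` ideal_generated A S"
    using ideal_generated_superset[of S A] by (intro ideal_generated_least) auto
qed

section \<open>Polynomials\<close>

abbreviation "lookup \<equiv> Poly_Mapping.lookup"
abbreviation "keys \<equiv> Poly_Mapping.keys"
abbreviation "single \<equiv> Poly_Mapping.single"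

lemma lookup_single_mult:
  fixes f :: "'a::{comm_ring, comm_monoid_mult} mpoly"
  shows "lookup (single \<beta> c * f) (\<beta> + \<alpha>) = c * lookup f \<alpha>"
proof -
  have "lookup (single \<beta> c * f) (\<beta> + \<alpha>) =
      (\<Sum>l. lookup (single \<beta> c) l * (\<Sum>q. lookup f q when \<beta> + \<alpha> = l + q))" by (rule lookup_mult)
  also have "\<dots> = (\<Sum>l. (c * (\<Sum>q. lookup f q when \<beta> + \<alpha> = l + q)) when l = \<beta>)"
    by (rule Sum_any.cong) (auto simp: lookup_single when_def)
  also have "\<dots> = c * (\<Sum>q. lookup f q when \<alpha> = q)" by simp
  also have "(\<Sum>q. lookup f q when \<alpha> = q) = lookup f \<alpha>"
    by simp
  finally show ?thesis .
qed

lemma keys_single_mult: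
  fixes f :: "'a::{comm_ring, comm_monoid_mult} mpoly"
  shows "keys (single \<beta> c * f) \<subseteq> (\<lambda>\<alpha>. \<beta> + \<alpha>) ` keys f"
  using keys_mult[of "single \<beta> c" f] by (auto split: if_splits)

lemma lookup_single_mult_ndvd:
  fixes f :: "'a::{comm_ring, comm_monoid_mult} mpoly"
  shows "\<not> monom_dvd \<beta> \<alpha> \<Longrightarrow> lookup (single \<beta> c * f) \<alpha> = 0"
  using keys_single_mult[of \<beta> c f] by (auto simp: monom_dvd_iff in_keys_iff)

lemma lookup_single_mult':
  fixes f :: "'a::{comm_ring, comm_monoid_mult} mpoly"
  shows "lookup (single \<beta> c * f) \<alpha> = (if monom_dvd \<beta> \<alpha> then c * lookup f (\<alpha> - \<beta>) else 0)"
  using lookup_single_mult[of \<beta> c f "\<alpha> - \<beta>"] lookup_single_mult_ndvd[of \<beta> \<alpha> c f]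
  by (auto simp: monom_dvd_diff)

lemma lookup_const_mult [simp]:
  fixes f :: "'a::{comm_ring, comm_monoid_mult} mpoly"
  shows "lookup (single 0 c * f) \<alpha> = c * lookup f \<alpha>"
  using lookup_single_mult[of 0 c f \<alpha>] by simp

lemma keys_const_mult:
  fixes f :: "'a::{comm_ring, comm_monoid_mult} mpoly"
  shows "keys (single 0 c * f) \<subseteq> keys f"
  using keys_single_mult[of 0 c f] by auto

lemma const_one_mult [simp]:
  fixes f :: "'a::{comm_ring, comm_monoid_mult} mpoly"
  shows "single 0 1 * f = f"
  by (rule poly_mapping_eqI) simp

lemma poly_sum_singles: "f = (\<Sum>\<alpha>\<in>keys f. single \<alpha> (lookup f \<alpha>))"
  by (rule poly_mapping_eqI) (auto simp: lookup_sum lookup_single when_def in_keys_iff)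

lemma poly_sum_singles_superset:
  "finite A \<Longrightarrow> keys f \<subseteq> A \<Longrightarrow> f = (\<Sum>\<alpha>\<in>A. single \<alpha> (lookup f \<alpha>))"
  by (rule poly_mapping_eqI) (auto simp: lookup_sum lookup_single when_def in_keys_iff)

lemma poly_ringD: "f \<in> poly_ring n \<Longrightarrow> \<alpha> \<in> keys f \<Longrightarrow> \<alpha> \<in> monoms n"
  by (auto simp: poly_ring_def)

lemma poly_ring_0 [simp]: "0 \<in> poly_ring n" by (simp add: poly_ring_def)

lemma poly_ring_add: "f \<in> poly_ring n \<Longrightarrow> g \<in> poly_ring n \<Longrightarrow> f + g \<in> poly_ring n"
  using Poly_Mapping.keys_add[of f g] by (auto simp: poly_ring_def)

lemma keys_uminus [simp]: "keys (- f :: 'a::comm_ring mpoly) = keys f"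
  by (auto simp: in_keys_iff)

lemma poly_ring_uminus: "f \<in> poly_ring n \<Longrightarrow> - f \<in> poly_ring n"
  by (auto simp: poly_ring_def)

lemma poly_ring_diff: "f \<in> poly_ring n \<Longrightarrow> g \<in> poly_ring n \<Longrightarrow> f - g \<in> poly_ring n"
  using poly_ring_add[of f n "- g"] poly_ring_uminus[of g n] by simp

lemma poly_ring_mult: "f \<in> poly_ring n \<Longrightarrow> g \<in> poly_ring n \<Longrightarrow> f * g \<in> poly_ring n"
  using keys_mult[of f g] by (auto simp: poly_ring_def subset_iff)

lemma poly_ring_single: "\<alpha> \<in> monoms n \<Longrightarrow> single \<alpha> c \<in> poly_ring n"
  by (auto simp: poly_ring_def)

lemma poly_ring_const [simp]: "single 0 c \<in> poly_ring n"
  by (simp add: poly_ring_single)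

lemma poly_ring_sum: "(\<And>i. i \<in> A \<Longrightarrow> f i \<in> poly_ring n) \<Longrightarrow> (\<Sum>i\<in>A. f i) \<in> poly_ring n"
  by (induction A rule: infinite_finite_induct) (auto simp: poly_ring_add)

lemma unital_poly_ring: "unital_subring (poly_ring n :: 'a::{comm_ring, comm_monoid_mult} mpoly set)"
  unfolding unital_subring_def
  by (auto simp: poly_ring_add poly_ring_mult poly_ring_uminus intro!: bexI[of _ "single 0 1"])

lemma unital_UNIV: "unital_subring (UNIV :: 'a::{comm_ring, comm_monoid_mult} set)"
  unfolding unital_subring_def by (auto intro!: exI[of _ 1])

lemma keys_sum_subset: "keys (\<Sum>i\<in>A. f i) \<subseteq> (\<Union>i\<in>A. keys (f i))"
  for f :: "'i \<Rightarrow> 'b \<Rightarrow>\<^sub>0 'c::comm_monoid_add"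
proof (induction A rule: infinite_finite_induct)
  case (insert x F)
  then show ?case using Poly_Mapping.keys_add[of "f x" "sum f F"] by auto
qed auto

lemma const_add: "single 0 (a + b) * f = single 0 a * f + single 0 b * f"
  for f :: "'a::comm_ring mpoly" by (simp add: single_add distrib_right)

lemma const_const: "single 0 a * (single 0 b * f) = single 0 (a * b) * f"
  for f :: "'a::comm_ring mpoly" by (simp add: mult_single flip: mult.assoc)

text \<open>An ideal of the polynomial ring is spanned additively by the monomial multiples of its generators.\<close>

lemma ideal_generated_induct [consumes 2, case_names zero add single]:
  fixes x :: "'a::{comm_ring, comm_monoid_mult} mpoly"
  assumes "x \<in> ideal_generated (poly_ring n) S" "S \<subseteq> poly_ring n"
    and zero: "Q 0" and add: "\<And>x y. Q x \<Longrightarrow> Q y \<Longrightarrow> Q (x + y)"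
    and single: "\<And>\<beta> c s. \<beta> \<in> monoms n \<Longrightarrow> s \<in> S \<Longrightarrow> Q (single \<beta> c * s)"
  shows "Q x"
proof -
  let ?J = "{x\<in>poly_ring n. \<forall>r\<in>poly_ring n. Q (r * x)}"
  have "is_ideal (poly_ring n) ?J"
    unfolding is_ideal_def
    by (auto simp: poly_ring_add poly_ring_mult zero distrib_left add mult.assoc[symmetric])
  moreover have "S \<subseteq> ?J"
  proof
    fix s assume s: "s \<in> S"
    have "Q (r * s)" if r: "r \<in> poly_ring n" for r
    proof -
      have "Q (\<Sum>\<alpha>\<in>A. single \<alpha> (lookup r \<alpha>) * s)" if "A \<subseteq> monoms n" for A
        using that by (induction A rule: infinite_finite_induct) (auto simp: zero add single s)
      then have "Q (\<Sum>\<alpha>\<in>keys r. single \<alpha> (lookup r \<alpha>) * s)" using r by (auto simp: poly_ring_def)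
      then show ?thesis using poly_sum_singles[of r] by (simp flip: sum_distrib_right)
    qed
    then show "s \<in> ?J" using s assms(2) by auto
  qed
  ultimately have "ideal_generated (poly_ring n) S \<subseteq> ?J" by (rule ideal_generated_least)
  then have "Q (single 0 1 * x)" using assms(1) poly_ring_const by blast
  then show ?thesis by simp
qed

lemma poly_induct_single [consumes 1, case_names zero add single]:
  fixes f :: "'a::{comm_ring, comm_monoid_mult} mpoly"
  assumes "f \<in> poly_ring n" and "Q 0" "\<And>x y. Q x \<Longrightarrow> Q y \<Longrightarrow> Q (x + y)"
    and "\<And>\<beta> c. \<beta> \<in> monoms n \<Longrightarrow> Q (single \<beta> c)"
  shows "Q f"
proof -
  have "Q (\<Sum>\<alpha>\<in>A. single \<alpha> (lookup f \<alpha>))" if "A \<subseteq> monoms n" for A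
    using that by (induction A rule: infinite_finite_induct) (auto simp: assms)
  then have "Q (\<Sum>\<alpha>\<in>keys f. single \<alpha> (lookup f \<alpha>))" using assms(1) by (simp add: poly_ring_def)
  then show ?thesis using poly_sum_singles[of f] by simp
qed

lemma const_dvdE:
  fixes f :: "'a::{comm_ring, comm_monoid_mult} mpoly"
  assumes "\<And>\<alpha>. c dvd lookup f \<alpha>"
  obtains g where "f = single 0 c * g" "keys g \<subseteq> keys f"
proof -
  have "\<forall>\<alpha>. \<exists>x. lookup f \<alpha> = c * x" using assms by (auto simp: dvd_def)
  then obtain x where x: "\<And>\<alpha>. lookup f \<alpha> = c * x \<alpha>" by metis
  let ?g = "\<Sum>\<alpha>\<in>keys f. single \<alpha> (x \<alpha>)"
  have "lookup (single 0 c * ?g) \<alpha> = lookup f \<alpha>" for \<alpha>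
    using x[of \<alpha>] by (cases "\<alpha> \<in> keys f")
      (auto simp: lookup_sum lookup_single when_def in_keys_iff)
  then have "f = single 0 c * ?g" by (metis poly_mapping_eqI)
  moreover have "keys ?g \<subseteq> keys f"
    using keys_sum_subset[of "\<lambda>\<alpha>. single \<alpha> (x \<alpha>)" "keys f"] by (auto split: if_splits)
  ultimately show ?thesis using that by blast
qed

definition restrict :: "monom set \<Rightarrow> 'a::comm_ring mpoly \<Rightarrow> 'a mpoly" where
  "restrict S f = (\<Sum>\<alpha>\<in>keys f \<inter> S. single \<alpha> (lookup f \<alpha>))"

lemma lookup_restrict [simp]: "lookup (restrict S f) \<alpha> = (if \<alpha> \<in> S then lookup f \<alpha> else 0)"
  by (auto simp: restrict_def lookup_sum lookup_single when_def in_keys_iff)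

lemma keys_restrict [simp]: "keys (restrict S f) = keys f \<inter> S"
  by (auto simp: in_keys_iff split: if_splits)

lemma restrict_add: "restrict S (f + g) = restrict S f + restrict S g"
  by (rule poly_mapping_eqI) (auto simp: lookup_add)

lemma restrict_0 [simp]: "restrict S 0 = 0"
  by (rule poly_mapping_eqI) auto

lemma restrict_id: "keys f \<subseteq> S \<Longrightarrow> restrict S f = f"
  by (rule poly_mapping_eqI) (auto simp: in_keys_iff)

lemma restrict_empty: "keys f \<inter> S = {} \<Longrightarrow> restrict S f = 0"
  by (rule poly_mapping_eqI) (auto simp: in_keys_iff)

lemma sum_components: "z = (\<Sum>g\<in>\<gamma> ` keys z. restrict {\<alpha>. \<gamma> \<alpha> = g} z)"
proof (rule poly_mapping_eqI)
  fix \<alpha>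
  have "lookup (\<Sum>g\<in>\<gamma> ` keys z. restrict {\<alpha>. \<gamma> \<alpha> = g} z) \<alpha> =
      (\<Sum>g\<in>\<gamma> ` keys z. if g = \<gamma> \<alpha> then lookup z \<alpha> else 0)"
    unfolding lookup_sum by (intro sum.cong) auto
  also have "\<dots> = lookup z \<alpha>" by (auto simp: in_keys_iff)
  finally show "lookup z \<alpha> = lookup (\<Sum>g\<in>\<gamma> ` keys z. restrict {\<alpha>. \<gamma> \<alpha> = g} z) \<alpha>" by simp
qed

lemma restrict_poly_ring: "f \<in> poly_ring n \<Longrightarrow> restrict S f \<in> poly_ring n"
  by (auto simp: poly_ring_def)

text \<open>The linear map that sends the monomial \<open>\<alpha>\<close> to \<open>F \<alpha>\<close>.\<close>

definition lin :: "(monom \<Rightarrow> 'a::comm_ring mpoly) \<Rightarrow> 'a mpoly \<Rightarrow> 'a mpoly" where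
  "lin F u = (\<Sum>\<alpha>\<in>keys u. single 0 (lookup u \<alpha>) * F \<alpha>)"

lemma lin_superset:
  "finite A \<Longrightarrow> keys u \<subseteq> A \<Longrightarrow> lin F u = (\<Sum>\<alpha>\<in>A. single 0 (lookup u \<alpha>) * F \<alpha>)"
  unfolding lin_def by (rule sum.mono_neutral_left) (auto simp: in_keys_iff)

lemma lin_0 [simp]: "lin F 0 = 0" by (simp add: lin_def)

lemma lin_add: "lin F (u + v) = lin F u + lin F v"
proof -
  have k: "finite (keys u \<union> keys v)" "keys (u + v) \<subseteq> keys u \<union> keys v"
    using Poly_Mapping.keys_add[of u v] by auto
  show ?thesis
    by (simp add: lin_superset[OF k] lin_superset[OF k(1), of u] lin_superset[OF k(1), of v]
        lookup_add const_add sum.distrib)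
qed

lemma lin_const: "lin F (single 0 c * u) = single 0 c * lin F u"
  for u :: "'a::{comm_ring, comm_monoid_mult} mpoly"
proof -
  have "lin F (single 0 c * u) = (\<Sum>\<alpha>\<in>keys u. single 0 (lookup (single 0 c * u) \<alpha>) * F \<alpha>)"
    by (rule lin_superset) (auto simp: keys_const_mult)
  then show ?thesis by (simp add: lin_def sum_distrib_left const_const)
qed

lemma lin_single [simp]: "lin F (single \<alpha> c) = single 0 c * F \<alpha>"
  by (cases "c = 0") (auto simp: lin_def)

lemma lin_uminus: "lin F (- u) = - lin F u"
  using lin_add[of F u "- u"] by (simp add: eq_neg_iff_add_eq_0 add.commute)

lemma lin_diff: "lin F (u - v) = lin F u - lin F v"
  using lin_add[of F u "- v"] by (simp add: lin_uminus)

lemma lin_poly_ring: "(\<And>\<alpha>. \<alpha> \<in> keys u \<Longrightarrow> F \<alpha> \<in> poly_ring n) \<Longrightarrow> lin F u \<in> poly_ring n"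
  unfolding lin_def by (intro poly_ring_sum poly_ring_mult) auto

lemma lookup_lin: "lookup (lin F u) \<alpha> = (\<Sum>\<beta>\<in>keys u. lookup u \<beta> * lookup (F \<beta>) \<alpha>)"
  for u :: "'a::{comm_ring, comm_monoid_mult} mpoly"
  by (simp add: lin_def lookup_sum)

lemma sum_fun_apply [simp]: "(\<Sum>i\<in>A. f i) x = (\<Sum>i\<in>A. f i x)"
  for f :: "'i \<Rightarrow> 'x \<Rightarrow> 'y::comm_monoid_add"
  by (induction A rule: infinite_finite_induct) auto

section \<open>Graded ideals and leading monomials modulo the maximal ideal\<close>

definition mlcm :: "monom \<Rightarrow> monom \<Rightarrow> monom" where
  "mlcm b b' = b + (b' - b)"

lemma mlcm_dvd: "monom_dvd b (mlcm b b')" "monom_dvd b' (mlcm b b')"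
  by (auto simp: mlcm_def monom_dvd_def lookup_add lookup_minus)

lemma mlcm_least: "monom_dvd b \<alpha> \<Longrightarrow> monom_dvd b' \<alpha> \<Longrightarrow> monom_dvd (mlcm b b') \<alpha>"
  unfolding monom_dvd_def
proof
  fix i assume "\<forall>i. lookup b i \<le> lookup \<alpha> i" "\<forall>i. lookup b' i \<le> lookup \<alpha> i"
  then have "lookup b i \<le> lookup \<alpha> i" "lookup b' i \<le> lookup \<alpha> i" by auto
  then show "lookup (mlcm b b') i \<le> lookup \<alpha> i" by (simp add: mlcm_def lookup_add lookup_minus)
qed

lemma mlcm_monoms: "b \<in> monoms n \<Longrightarrow> b' \<in> monoms n \<Longrightarrow> mlcm b b' \<in> monoms n"
  by (simp add: mlcm_def)

text \<open>
  The grading \<open>gam\<close> need only distinguish finitely many monomials at a time: its finite fibers reduce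
  questions on homogeneous polynomials to linear algebra over \<open>V\<close> in finite rank, and they make up for
  the order \<open>less\<close>, which is total and compatible with multiplication but may have infinite descending
  chains across degrees. The last assumption is the coherence of \<open>V\<close>.
\<close>

locale graded_polynomials = valuation_ring_nontrivial V
  for V :: "'a::{comm_ring, comm_monoid_mult} itself" +
  fixes N :: nat and gam :: "monom \<Rightarrow> 'g" and less :: "monom \<Rightarrow> monom \<Rightarrow> bool"
  assumes less_irrefl: "\<not> less \<alpha> \<alpha>"
    and less_trans: "less \<alpha> \<beta> \<Longrightarrow> less \<beta> \<gamma> \<Longrightarrow> less \<alpha> \<gamma>"
    and less_total: "\<alpha> \<noteq> \<beta> \<Longrightarrow> less \<alpha> \<beta> \<or> less \<beta> \<alpha>"
    and less_add: "less \<alpha> \<beta> \<Longrightarrow> less (\<gamma> + \<alpha>) (\<gamma> + \<beta>)"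
    and gam_add: "gam (\<gamma> + \<alpha>) = gam (\<gamma> + \<beta>) \<longleftrightarrow> gam \<alpha> = gam \<beta>"
    and gam_finite: "finite {\<alpha>\<in>monoms N. gam \<alpha> = g}"
    and ann_principal: "\<exists>e. \<forall>x. (c::'a) * x = 0 \<longleftrightarrow> e dvd x"
begin

abbreviation "P \<equiv> poly_ring N :: 'a mpoly set"
abbreviation "gen \<equiv> ideal_generated (poly_ring N :: 'a mpoly set)"

lemma less_cancel: "less (\<gamma> + \<alpha>) (\<gamma> + \<beta>) \<longleftrightarrow> less \<alpha> \<beta>"
  using less_add[of \<alpha> \<beta> \<gamma>] less_add[of \<beta> \<alpha> \<gamma>] less_total[of \<alpha> \<beta>] less_irrefl
    less_trans[of "\<gamma> + \<alpha>" "\<gamma> + \<beta>" "\<gamma> + \<alpha>"] by metis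

definition fiber :: "'g \<Rightarrow> monom set" where
  "fiber g = {\<alpha>\<in>monoms N. gam \<alpha> = g}"

definition hom :: "'g \<Rightarrow> 'a mpoly \<Rightarrow> bool" where
  "hom g f \<longleftrightarrow> keys f \<subseteq> fiber g"

definition homog :: "'a mpoly \<Rightarrow> bool" where
  "homog f \<longleftrightarrow> (\<exists>g. hom g f)"

lemma finite_fiber: "finite (fiber g)" unfolding fiber_def by (rule gam_finite)

lemma hom_P: "hom g f \<Longrightarrow> f \<in> P" by (auto simp: hom_def fiber_def poly_ring_def)

lemma homog_P: "homog f \<Longrightarrow> f \<in> P" by (auto simp: homog_def hom_P)

lemma hom_add: "hom g f \<Longrightarrow> hom g h \<Longrightarrow> hom g (f + h)"
  using Poly_Mapping.keys_add[of f h] by (auto simp: hom_def)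

lemma hom_uminus: "hom g f \<Longrightarrow> hom g (- f)" by (simp add: hom_def)

lemma hom_diff: "hom g f \<Longrightarrow> hom g h \<Longrightarrow> hom g (f - h)"
  using hom_add[of g f "- h"] hom_uminus[of g h] by simp

lemma hom_0: "hom g 0" by (simp add: hom_def)

lemma hom_const: "hom g f \<Longrightarrow> hom g (single 0 c * f)"
  using keys_const_mult[of c f] by (auto simp: hom_def)

lemma hom_single: "\<alpha> \<in> monoms N \<Longrightarrow> hom (gam \<alpha>) (single \<alpha> c)"
  by (auto simp: hom_def fiber_def)

lemma hom_single_mult: "hom (gam \<alpha>) f \<Longrightarrow> \<gamma> \<in> monoms N \<Longrightarrow> hom (gam (\<gamma> + \<alpha>)) (single \<gamma> c * f)"
proof -
  assume f: "hom (gam \<alpha>) f" "\<gamma> \<in> monoms N"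
  have "x \<in> fiber (gam (\<gamma> + \<alpha>))" if x: "x \<in> keys (single \<gamma> c * f)" for x
  proof -
    obtain \<kappa> where "\<kappa> \<in> keys f" "x = \<gamma> + \<kappa>" using x keys_single_mult[of \<gamma> c f] by blast
    then show ?thesis using f gam_add[of \<gamma> \<kappa> \<alpha>] by (auto simp: hom_def fiber_def)
  qed
  then show ?thesis by (auto simp: hom_def)
qed

lemma homog_single_mult: "homog f \<Longrightarrow> \<gamma> \<in> monoms N \<Longrightarrow> homog (single \<gamma> c * f)"
proof (cases "f = 0")
  case False
  assume f: "homog f" "\<gamma> \<in> monoms N"
  then obtain g where "hom g f" by (auto simp: homog_def)
  moreover obtain \<alpha> where "\<alpha> \<in> keys f"
    using False keys_eq_empty[of f] by blast
  ultimately have "hom (gam \<alpha>) f" by (auto simp: hom_def fiber_def)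
  then show ?thesis using hom_single_mult f unfolding homog_def by blast
qed (auto simp: homog_def hom_0)

text \<open>Monomial multiples of homogeneous generators are homogeneous, so taking a component keeps or kills them.\<close>

lemma component_mem:
  assumes H: "\<And>h. h \<in> H \<Longrightarrow> homog h" and f: "f \<in> gen H"
  shows "restrict {\<alpha>. gam \<alpha> = g} f \<in> gen H"
proof -
  have HP: "H \<subseteq> P" using H homog_P by blast
  note I = ideal_generated_is_ideal[OF unital_poly_ring HP]
  show ?thesis using f HP
  proof (induction rule: ideal_generated_induct)
    case zero
    then show ?case using is_idealD(2)[OF I] by simp
  next
    case (add x y)
    then show ?case using is_idealD(3)[OF I] by (simp add: restrict_add)
  next
    case (single \<beta> c s)
    let ?x = "Poly_Mapping.single \<beta> c * s"
    have x: "?x \<in> gen H"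
      using is_idealD(4)[OF I poly_ring_single[OF single(1)]] single(2) ideal_generated_superset[of H P] by blast
    obtain g' where g': "hom g' ?x"
      using homog_single_mult[OF H[OF single(2)] single(1)] unfolding homog_def by blast
    show ?case
    proof (cases "g' = g")
      case True
      then have "restrict {\<alpha>. gam \<alpha> = g} ?x = ?x"
        using g' by (intro restrict_id) (auto simp: hom_def fiber_def)
      then show ?thesis using x by simp
    next
      case False
      then have "restrict {\<alpha>. gam \<alpha> = g} ?x = 0"
        using g' by (intro restrict_empty) (auto simp: hom_def fiber_def)
      then show ?thesis using is_idealD(2)[OF I] by simp
    qed
  qed
qed

text \<open>
  The monomial \<open>\<alpha>\<close> is the leading monomial of the image of \<open>f\<close> over the residue field; \<open>lms J\<close> consists of
  the leading monomials of the image of a graded ideal \<open>J\<close>.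
\<close>

definition plm :: "'a mpoly \<Rightarrow> monom \<Rightarrow> bool" where
  "plm f \<alpha> \<longleftrightarrow> \<not> nonunit (lookup f \<alpha>) \<and> (\<forall>\<beta>. less \<alpha> \<beta> \<longrightarrow> nonunit (lookup f \<beta>))"

lemma unit_keys: "\<not> nonunit (lookup (f :: 'a mpoly) \<alpha>) \<Longrightarrow> \<alpha> \<in> keys f"
  using nonunit_0 by (auto simp: in_keys_iff)

lemma plm_keys: "plm f \<alpha> \<Longrightarrow> \<alpha> \<in> keys f"
  by (simp add: plm_def unit_keys)

lemma finite_has_max: "finite A \<Longrightarrow> A \<noteq> {} \<Longrightarrow> \<exists>m\<in>A. \<forall>x\<in>A. x = m \<or> less x m"
proof (induction A rule: finite_ne_induct)
  case (insert x F)
  then obtain m where "m \<in> F" "\<forall>x\<in>F. x = m \<or> less x m" by blast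
  then show ?case using less_total[of x m] less_trans
    by (cases "x = m \<or> less x m") (auto intro: less_trans)
qed auto

lemma plm_exists:
  assumes "\<not> nonunit (lookup (f :: 'a mpoly) \<alpha>)"
  shows "\<exists>\<beta>. plm f \<beta>"
proof -
  let ?A = "{\<beta>\<in>keys f. \<not> nonunit (lookup f \<beta>)}"
  have "\<alpha> \<in> ?A" using assms unit_keys by blast
  then obtain m where m: "m \<in> ?A" "\<forall>x\<in>?A. x = m \<or> less x m" using finite_has_max[of ?A] by auto
  have "nonunit (lookup f \<beta>)" if "less m \<beta>" for \<beta>
    using m(2) that less_trans[of m \<beta> m] less_irrefl unit_keys[of f \<beta>] by auto
  with m(1) have "plm f m" unfolding plm_def by blast
  then show ?thesis ..
qed

lemma shift_coeff:
  assumes "\<And>\<beta>. less \<alpha> \<beta> \<Longrightarrow> nonunit (lookup (f :: 'a mpoly) \<beta>)" "less (\<gamma> + \<alpha>) \<beta>"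
  shows "nonunit (lookup (single \<gamma> c * f) \<beta>)"
proof (cases "monom_dvd \<gamma> \<beta>")
  case True
  then have "less \<alpha> (\<beta> - \<gamma>)" using assms(2) less_cancel[of \<gamma> \<alpha> "\<beta> - \<gamma>"] by (simp add: monom_dvd_diff)
  then show ?thesis using True assms(1) by (simp add: lookup_single_mult' nonunit_mult2)
qed (simp add: lookup_single_mult' nonunit_0)

lemma plm_shift: "plm f \<alpha> \<Longrightarrow> plm (single \<gamma> 1 * f) (\<gamma> + \<alpha>)"
  unfolding plm_def using shift_coeff[of \<alpha> f \<gamma> _ 1] by (simp add: lookup_single_mult)

definition lms :: "'a mpoly set \<Rightarrow> monom set" where
  "lms J = {\<alpha>. \<exists>f\<in>J. homog f \<and> plm f \<alpha>}"

lemma lms_upset: "is_ideal P J \<Longrightarrow> monom_upset N (lms J)"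
  unfolding monom_upset_def
proof (intro conjI ballI subsetI impI)
  fix \<alpha> assume "\<alpha> \<in> lms J"
  then obtain f where f: "f \<in> J" "homog f" "plm f \<alpha>" by (auto simp: lms_def)
  then show "\<alpha> \<in> monoms N" using homog_P plm_keys poly_ringD by blast
  assume J: "is_ideal P J"
  fix \<beta> assume b: "\<beta> \<in> monoms N" "monom_dvd \<alpha> \<beta>"
  then have eq: "(\<beta> - \<alpha>) + \<alpha> = \<beta>" by (metis add.commute monom_dvd_diff)
  have "single (\<beta> - \<alpha>) 1 * f \<in> J" using is_idealD(4)[OF J] f(1) b by (simp add: poly_ring_single)
  moreover have "homog (single (\<beta> - \<alpha>) 1 * f)" using homog_single_mult f b by simp
  moreover have "plm (single (\<beta> - \<alpha>) 1 * f) \<beta>" using plm_shift[OF f(3), of "\<beta> - \<alpha>"] eq by simp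
  ultimately show "\<beta> \<in> lms J" unfolding lms_def by blast
qed

end

section \<open>Normal forms\<close>

text \<open>
  A finite family of polynomials whose images over the residue field have the leading monomials \<open>B\<close>. Each
  monomial \<open>\<alpha>\<close> in the monomial ideal \<open>L\<close> of \<open>B\<close> is assigned one multiple \<open>F \<alpha>\<close> with this leading monomial;
  the polynomial \<open>lin F u + r\<close> is in normal form if \<open>r\<close> avoids \<open>L\<close>.
\<close>

locale lead_basis = graded_polynomials V N gam less
  for V :: "'a::{comm_ring, comm_monoid_mult} itself" and N and gam :: "monom \<Rightarrow> 'g" and less +
  fixes B :: "monom set" and f :: "monom \<Rightarrow> 'a mpoly"
  assumes B: "finite B" "B \<subseteq> monoms N"
    and f_hom: "\<And>b. b \<in> B \<Longrightarrow> hom (gam b) (f b)"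
    and f_one: "\<And>b. b \<in> B \<Longrightarrow> lookup (f b) b = 1"
    and f_less: "\<And>b \<beta>. b \<in> B \<Longrightarrow> less b \<beta> \<Longrightarrow> nonunit (lookup (f b) \<beta>)"
begin

definition L :: "monom set" where
  "L = {\<alpha>\<in>monoms N. \<exists>b\<in>B. monom_dvd b \<alpha>}"

definition iota :: "monom \<Rightarrow> monom" where
  "iota \<alpha> = (SOME b. b \<in> B \<and> monom_dvd b \<alpha>)"

definition F :: "monom \<Rightarrow> 'a mpoly" where
  "F \<alpha> = single (\<alpha> - iota \<alpha>) 1 * f (iota \<alpha>)"

lemma L_monoms: "\<alpha> \<in> L \<Longrightarrow> \<alpha> \<in> monoms N" by (simp add: L_def)

lemma iota: "\<alpha> \<in> L \<Longrightarrow> iota \<alpha> \<in> B" "\<alpha> \<in> L \<Longrightarrow> monom_dvd (iota \<alpha>) \<alpha>"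
proof -
  assume "\<alpha> \<in> L"
  then have "\<exists>b. b \<in> B \<and> monom_dvd b \<alpha>" by (auto simp: L_def)
  from someI_ex[OF this] show "iota \<alpha> \<in> B" "monom_dvd (iota \<alpha>) \<alpha>" by (auto simp: iota_def)
qed

lemma iota_eq: "\<alpha> \<in> L \<Longrightarrow> \<alpha> - iota \<alpha> + iota \<alpha> = \<alpha>"
  using iota monom_dvd_diff by (metis add.commute)

lemma f_P: "b \<in> B \<Longrightarrow> f b \<in> P" using f_hom hom_P by blast

lemma F_hom: "\<alpha> \<in> L \<Longrightarrow> hom (gam \<alpha>) (F \<alpha>)"
  using hom_single_mult[OF f_hom[OF iota(1)], of \<alpha> "\<alpha> - iota \<alpha>" 1] L_monoms[of \<alpha>] iota_eq[of \<alpha>]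
  by (simp add: F_def)

lemma F_P: "\<alpha> \<in> L \<Longrightarrow> F \<alpha> \<in> P" using F_hom hom_P by blast

lemma F_one: "\<alpha> \<in> L \<Longrightarrow> lookup (F \<alpha>) \<alpha> = 1"
  using lookup_single_mult[of "\<alpha> - iota \<alpha>" 1 "f (iota \<alpha>)" "iota \<alpha>"] iota_eq[of \<alpha>]
    f_one[OF iota(1)[of \<alpha>]]
  by (simp add: F_def)

lemma F_less: "\<alpha> \<in> L \<Longrightarrow> less \<alpha> \<beta> \<Longrightarrow> nonunit (lookup (F \<alpha>) \<beta>)"
  using shift_coeff[of "iota \<alpha>" "f (iota \<alpha>)" "\<alpha> - iota \<alpha>" \<beta> 1] f_less[OF iota(1)[of \<alpha>]] iota_eq[of \<alpha>]
  by (simp add: F_def)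

text \<open>
  Modulo the \<open>F \<alpha>\<close>, a monomial of \<open>L\<close> is a combination of smaller monomials and of nonunit multiples of
  larger ones, all in the same finite fiber.
\<close>

lemma normal_form_hom:
  assumes y: "hom g y"
  shows "\<exists>u r. y = lin F u + r \<and> keys u \<subseteq> L \<inter> fiber g \<and> keys r \<subseteq> fiber g - L"
proof -
  let ?W = "{lin F u + r | u r. keys u \<subseteq> L \<inter> fiber g \<and> keys r \<subseteq> fiber g - L}"
  let ?y = "\<lambda>\<alpha>. single \<alpha> (1::'a)"
  have W_add: "x + y \<in> ?W" if xy: "x \<in> ?W" "y \<in> ?W" for x y
  proof -
    obtain u r u' r' where "x = lin F u + r" "keys u \<subseteq> L \<inter> fiber g" "keys r \<subseteq> fiber g - L"
      "y = lin F u' + r'" "keys u' \<subseteq> L \<inter> fiber g" "keys r' \<subseteq> fiber g - L" using xy by blast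
    then show ?thesis using Poly_Mapping.keys_add[of u u'] Poly_Mapping.keys_add[of r r']
      by (intro CollectI exI[of _ "u + u'"] exI[of _ "r + r'"]) (auto simp: lin_add)
  qed
  have W_const: "single 0 c * x \<in> ?W" if x: "x \<in> ?W" for x c
  proof -
    obtain u r where "x = lin F u + r" "keys u \<subseteq> L \<inter> fiber g" "keys r \<subseteq> fiber g - L"
      using x by blast
    then show ?thesis using keys_const_mult[of c u] keys_const_mult[of c r]
      by (intro CollectI exI[of _ "single 0 c * u"] exI[of _ "single 0 c * r"])
        (auto simp: lin_const distrib_left)
  qed
  have yW: "\<forall>\<alpha>\<in>fiber g. ?y \<alpha> \<in> ?W"
  proof (rule triangular_nakayama[where sc = "\<lambda>c f. single 0 c * f" and r = less])
    show "transp less" using less_trans by (auto intro: transpI)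
    show "irreflp less" using less_irrefl by (auto intro: irreflpI)
    fix \<alpha> assume a: "\<alpha> \<in> fiber g"
    show "\<exists>w u. w \<in> ?W \<and> ?y \<alpha> = w + (\<Sum>\<beta>\<in>fiber g. single 0 (u \<beta>) * ?y \<beta>) \<and>
        (\<forall>\<beta>\<in>fiber g. nonunit (u \<beta>) \<or> less \<beta> \<alpha>)"
    proof (cases "\<alpha> \<in> L")
      case False
      have "lin F 0 + ?y \<alpha> \<in> ?W" using a False by (intro CollectI exI[of _ 0] exI[of _ "?y \<alpha>"]) auto
      then show ?thesis using nonunit_0
        by (intro exI[of _ "lin F 0 + ?y \<alpha>"] exI[of _ "\<lambda>_. 0"]) auto
    next
      case True
      let ?u = "\<lambda>\<beta>. if \<beta> = \<alpha> then 0 else - lookup (F \<alpha>) \<beta>"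
      have "lin F (?y \<alpha>) + 0 \<in> ?W" using a True by (intro CollectI exI[of _ "?y \<alpha>"] exI[of _ 0]) auto
      moreover have "?y \<alpha> = (lin F (?y \<alpha>) + 0) + (\<Sum>\<beta>\<in>fiber g. single 0 (?u \<beta>) * ?y \<beta>)"
      proof (rule poly_mapping_eqI)
        fix \<gamma>
        have "\<gamma> \<notin> fiber g \<Longrightarrow> lookup (F \<alpha>) \<gamma> = 0"
          using F_hom[OF True] a by (auto simp: hom_def fiber_def in_keys_iff)
        then show "lookup (?y \<alpha>) \<gamma> =
            lookup ((lin F (?y \<alpha>) + 0) + (\<Sum>\<beta>\<in>fiber g. single 0 (?u \<beta>) * ?y \<beta>)) \<gamma>"
          using F_one[OF True] finite_fiber[of g] a
          by (auto simp: lookup_add lookup_sum mult_single lookup_single when_def)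
      qed
      moreover have "\<forall>\<beta>\<in>fiber g. nonunit (?u \<beta>) \<or> less \<beta> \<alpha>"
        using F_less[OF True] less_total nonunit_0 nonunit_uminus by auto
      ultimately show ?thesis by (intro exI[of _ "lin F (?y \<alpha>) + 0"] exI[of _ ?u]) blast
    qed
  qed (use W_add W_const in \<open>auto simp: distrib_left const_add const_const finite_fiber\<close>)
  have y_sum: "y = (\<Sum>\<alpha>\<in>fiber g. single 0 (lookup y \<alpha>) * ?y \<alpha>)"
    using poly_sum_singles_superset[OF finite_fiber] y by (auto simp: hom_def mult_single)
  have sumW: "(\<Sum>\<alpha>\<in>A. single 0 (lookup y \<alpha>) * ?y \<alpha>) \<in> ?W" if "A \<subseteq> fiber g" for A
    using that
  proof (induction A rule: infinite_finite_induct)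
    case (insert x A)
    then have "?y x \<in> ?W" using yW by blast
    then show ?case using W_add W_const insert by simp
  next
    case empty
    have "lin F 0 + 0 \<in> ?W" by (intro CollectI exI[of _ 0]) auto
    then show ?case by simp
  qed (use finite_fiber finite_subset in blast)
  have "y \<in> ?W" by (subst y_sum) (rule sumW, simp)
  then show ?thesis by blast
qed

lemma normal_form:
  assumes "y \<in> P"
  shows "\<exists>u r. y = lin F u + r \<and> keys u \<subseteq> L \<and> keys r \<subseteq> monoms N - L"
  using assms
proof (induction rule: poly_induct_single)
  case zero
  show ?case by (intro exI[of _ 0]) auto
next
  case (add x y)
  then obtain u r u' r' where "x = lin F u + r" "keys u \<subseteq> L" "keys r \<subseteq> monoms N - L"
    "y = lin F u' + r'" "keys u' \<subseteq> L" "keys r' \<subseteq> monoms N - L" by blast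
  then show ?case using Poly_Mapping.keys_add[of u u'] Poly_Mapping.keys_add[of r r']
    by (intro exI[of _ "u + u'"] exI[of _ "r + r'"]) (auto simp: lin_add)
next
  case (single \<beta> c)
  then show ?case using normal_form_hom[OF hom_single[OF single, of c]] unfolding fiber_def by blast
qed

text \<open>At the largest monomial where \<open>u\<close> has a unit coefficient, all other contributions are nonunits.\<close>

lemma unit_at_max:
  assumes u: "keys u \<subseteq> L" and m: "plm u m" and r: "nonunit (lookup r m)"
  shows "\<not> nonunit (lookup (lin F u + r) m)"
proof -
  have mu: "m \<in> keys u" using plm_keys[OF m] .
  have "lookup (lin F u) m = lookup u m * lookup (F m) m + (\<Sum>\<beta>\<in>keys u - {m}. lookup u \<beta> * lookup (F \<beta>) m)"
    unfolding lookup_lin by (rule sum.remove) (use mu in auto)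
  moreover have "nonunit (\<Sum>\<beta>\<in>keys u - {m}. lookup u \<beta> * lookup (F \<beta>) m)"
  proof (rule nonunit_sum)
    fix \<beta> assume b: "\<beta> \<in> keys u - {m}"
    then consider "less m \<beta>" | "less \<beta> m" using less_total by blast
    then show "nonunit (lookup u \<beta> * lookup (F \<beta>) m)"
    proof cases
      case 1
      then show ?thesis using m by (simp add: plm_def nonunit_mult)
    next
      case 2
      then show ?thesis using F_less[of \<beta> m] b u by (simp add: nonunit_mult2 subset_iff)
    qed
  qed
  moreover have "lookup (F m) m = 1" using F_one mu u by blast
  ultimately show ?thesis
    using m r unit_add_nonunit by (simp add: lookup_add plm_def)
qed

lemma normal_form_unit_coeff:
  assumes u: "keys u \<subseteq> L" and r: "keys r \<inter> L = {}"
    and un: "\<not> nonunit (lookup u \<alpha>) \<or> \<not> nonunit (lookup r \<alpha>)"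
  shows "\<exists>\<beta>. \<not> nonunit (lookup (lin F u + r) \<beta>)"
proof (cases "\<exists>\<alpha>. \<not> nonunit (lookup u \<alpha>)")
  case True
  then obtain m where m: "plm u m" using plm_exists by blast
  then have "m \<notin> keys r" using r u plm_keys[OF m] by blast
  then have "nonunit (lookup r m)" using nonunit_0 by (simp add: in_keys_iff)
  then show ?thesis using unit_at_max[OF u m] by blast
next
  case False
  then have "nonunit (lookup (lin F u) \<alpha>)"
    unfolding lookup_lin by (intro nonunit_sum) (simp add: nonunit_mult)
  then have "\<not> nonunit (lookup (lin F u + r) \<alpha>)"
    using un False unit_add_nonunit by (auto simp: lookup_add add.commute)
  then show ?thesis ..
qed

text \<open>
  After division by the common content of \<open>u\<close> and \<open>r\<close>, some coefficient of the represented polynomial is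
  a unit, so a constant that divides the polynomial divides this content. In particular normal forms are
  unique.
\<close>

lemma normal_form_dvd:
  assumes u: "keys u \<subseteq> L" and r: "keys r \<inter> L = {}"
    and dvd: "\<And>\<alpha>. c dvd lookup (lin F u + r) \<alpha>"
  shows "c dvd lookup u \<alpha>" "c dvd lookup r \<alpha>"
proof -
  let ?S = "lookup u ` keys u \<union> lookup r ` keys r"
  obtain b where b: "b \<in> insert 0 ?S" "\<forall>x\<in>?S. b dvd x" using finite_content[of ?S] by auto
  have bu: "b dvd lookup u \<alpha>" for \<alpha> using b(2) by (cases "\<alpha> \<in> keys u") (auto simp: in_keys_iff dvd_zero_ring)
  have br: "b dvd lookup r \<alpha>" for \<alpha> using b(2) by (cases "\<alpha> \<in> keys r") (auto simp: in_keys_iff dvd_zero_ring)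
  have "c dvd b"
  proof (cases "b = 0")
    case False
    obtain u' where u': "u = single 0 b * u'" "keys u' \<subseteq> keys u" using const_dvdE[OF bu] by metis
    obtain r' where r': "r = single 0 b * r'" "keys r' \<subseteq> keys r" using const_dvdE[OF br] by metis
    from False b(1) obtain \<alpha> where "b = lookup u \<alpha> \<or> b = lookup r \<alpha>" by auto
    then have "b = b * lookup u' \<alpha> \<or> b = b * lookup r' \<alpha>" using u'(1) r'(1) by auto
    then have "\<not> nonunit (lookup u' \<alpha>) \<or> \<not> nonunit (lookup r' \<alpha>)"
      using mult_nonunit_self False by metis
    then obtain \<beta> where be: "\<not> nonunit (lookup (lin F u' + r') \<beta>)"
      using normal_form_unit_coeff[of u' r' \<alpha>] u u'(2) r r'(2) by blast
    then obtain i where i: "lookup (lin F u' + r') \<beta> * i = 1" using unit_inverse by blast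
    have "lin F u + r = single 0 b * (lin F u' + r')"
      by (simp add: u'(1) r'(1) lin_const distrib_left)
    then have "c dvd b * lookup (lin F u' + r') \<beta>" using dvd[of \<beta>] by simp
    then have "c dvd b * lookup (lin F u' + r') \<beta> * i" by (rule dvd_mult2)
    then show ?thesis using i by (simp add: mult.assoc)
  qed (simp add: dvd_zero_ring)
  then show "c dvd lookup u \<alpha>" "c dvd lookup r \<alpha>" using bu br dvd_trans by blast+
qed

end

section \<open>Content bases\<close>

context lead_basis
begin

text \<open>The vector \<open>E _ \<alpha>\<close> consists of the coefficients of \<open>F \<alpha>\<close> as a combination of the \<open>f b\<close>.\<close>

definition E :: "monom \<Rightarrow> monom \<Rightarrow> 'a mpoly" where
  "E x \<alpha> = (if x = iota \<alpha> then single (\<alpha> - x) 1 else 0)"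

lemma E_P: "\<alpha> \<in> monoms N \<Longrightarrow> E x \<alpha> \<in> P"
  by (auto simp: E_def poly_ring_single)

lemma sum_lin_E:
  assumes "keys u \<subseteq> L"
  shows "(\<Sum>b\<in>B. lin (E b) u * f b) = lin F u"
proof -
  have "(\<Sum>b\<in>B. lin (E b) u * f b) = (\<Sum>b\<in>B. \<Sum>\<alpha>\<in>keys u. single 0 (lookup u \<alpha>) * (E b \<alpha> * f b))"
    by (simp add: lin_def sum_distrib_right mult.assoc)
  also have "\<dots> = (\<Sum>\<alpha>\<in>keys u. single 0 (lookup u \<alpha>) * (\<Sum>b\<in>B. E b \<alpha> * f b))"
    by (subst sum.swap) (simp add: sum_distrib_left)
  also have "\<dots> = (\<Sum>\<alpha>\<in>keys u. single 0 (lookup u \<alpha>) * F \<alpha>)"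
  proof (rule sum.cong)
    fix \<alpha> assume "\<alpha> \<in> keys u"
    then have a: "iota \<alpha> \<in> B" using assms iota by blast
    have "(\<Sum>b\<in>B. E b \<alpha> * f b) = (\<Sum>b\<in>B. if b = iota \<alpha> then F \<alpha> else 0)"
      by (rule sum.cong) (auto simp: E_def F_def)
    also have "\<dots> = F \<alpha>" using a B by simp
    finally show "single 0 (lookup u \<alpha>) * (\<Sum>b\<in>B. E b \<alpha> * f b) = single 0 (lookup u \<alpha>) * F \<alpha>" by simp
  qed simp
  finally show ?thesis by (simp add: lin_def)
qed

end

text \<open>
  The polynomials \<open>f b\<close> form a Groebner basis modulo the constant \<open>c\<close>: every S-polynomial reduces to a
  multiple of \<open>c\<close>. The quotients of these remainders by \<open>c\<close> are collected in \<open>G\<close>, together with quotients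
  of remainders of further elements of the ideal.
\<close>

locale content_basis = lead_basis V N gam less B f
  for V :: "'a::{comm_ring, comm_monoid_mult} itself" and N and gam :: "monom \<Rightarrow> 'g" and less
    and B :: "monom set" and f :: "monom \<Rightarrow> 'a mpoly" +
  fixes c :: 'a and G :: "'a mpoly set" and su sg :: "monom \<Rightarrow> monom \<Rightarrow> 'a mpoly"
  assumes G: "finite G" "\<And>g. g \<in> G \<Longrightarrow> homog g"
    and sg: "\<And>b b'. b \<in> B \<Longrightarrow> b' \<in> B \<Longrightarrow> sg b b' \<in> G"
    and su: "\<And>b b'. b \<in> B \<Longrightarrow> b' \<in> B \<Longrightarrow> keys (su b b') \<subseteq> L \<inter> fiber (gam (mlcm b b'))"
    and su_less: "\<And>b b' \<alpha>. b \<in> B \<Longrightarrow> b' \<in> B \<Longrightarrow>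
      nonunit (lookup (su b b') \<alpha>) \<or> less \<alpha> (mlcm b b')"
    and spair: "\<And>b b'. b \<in> B \<Longrightarrow> b' \<in> B \<Longrightarrow>
      single (mlcm b b' - b) 1 * f b - single (mlcm b b' - b') 1 * f b' =
      lin F (su b b') + single 0 c * sg b b'"
begin

text \<open>The coefficient vector of the reduced S-pair of \<open>b\<close> and \<open>b'\<close>, a syzygy of \<open>f\<close> modulo \<open>c\<close>.\<close>

definition \<sigma> :: "monom \<Rightarrow> monom \<Rightarrow> monom \<Rightarrow> 'a mpoly" where
  "\<sigma> b b' x = (if x = b then single (mlcm b b' - b) 1 else 0) -
     (if x = b' then single (mlcm b b' - b') 1 else 0) - lin (E x) (su b b')"

lemma \<sigma>_P: "b \<in> B \<Longrightarrow> b' \<in> B \<Longrightarrow> \<sigma> b b' x \<in> P"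
proof -
  assume b: "b \<in> B" "b' \<in> B"
  have "lin (E x) (su b b') \<in> P" using su[OF b] L_monoms by (intro lin_poly_ring E_P) blast
  moreover have "mlcm b b' \<in> monoms N" using b B mlcm_monoms by blast
  ultimately show ?thesis unfolding \<sigma>_def by (intro poly_ring_diff) (auto intro: poly_ring_single)
qed

lemma sum_\<sigma>: "b \<in> B \<Longrightarrow> b' \<in> B \<Longrightarrow> (\<Sum>x\<in>B. \<sigma> b b' x * f x) = single 0 c * sg b b'"
proof -
  assume b: "b \<in> B" "b' \<in> B"
  have 1: "(\<Sum>x\<in>B. (if x = y then single \<gamma> 1 else 0) * f x) = single \<gamma> 1 * f y" if "y \<in> B" for y \<gamma>
  proof -
    have "(\<Sum>x\<in>B. (if x = y then single \<gamma> 1 else 0) * f x) = (\<Sum>x\<in>B. if x = y then single \<gamma> 1 * f x else 0)"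
      by (rule sum.cong) auto
    then show ?thesis using that B by simp
  qed
  have "(\<Sum>x\<in>B. \<sigma> b b' x * f x) = single (mlcm b b' - b) 1 * f b - single (mlcm b b' - b') 1 * f b' -
      (\<Sum>x\<in>B. lin (E x) (su b b') * f x)"
    by (simp only: \<sigma>_def left_diff_distrib sum_subtractf 1[OF b(1)] 1[OF b(2)])
  also have "\<dots> = single 0 c * sg b b'"
    using sum_lin_E[of "su b b'"] su[OF b] spair[OF b] by simp
  finally show ?thesis .
qed

text \<open>
  Among the monomial multiples \<open>X\<^sup>\<beta> f\<^sub>b\<close> with a given leading monomial, one is chosen as \<open>F\<close>. An S-pair
  replaces any other by this one, at the cost of multiples with smaller leading monomials and of nonunit
  multiples of others in the same fiber; the triangular Nakayama lemma absorbs both. This is carried out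
  for the coefficient vectors and not only for their values, so that it also describes the syzygies.
\<close>

lemma vector_reduction:
  assumes p: "\<And>b. b \<in> B \<Longrightarrow> p b \<in> P"
  shows "\<exists>a u. (\<forall>x\<in>B. \<forall>y\<in>B. a x y \<in> P) \<and> keys u \<subseteq> L \<and>
    (\<forall>b\<in>B. p b = (\<Sum>x\<in>B. \<Sum>y\<in>B. a x y * \<sigma> x y b) + lin (E b) u)"
proof -
  define Z where "Z = (\<lambda>a b. \<Sum>x\<in>B. \<Sum>y\<in>B. a x y * \<sigma> x y b)"
  define W where "W = {\<lambda>b. Z a b + lin (E b) u | a u. (\<forall>x\<in>B. \<forall>y\<in>B. a x y \<in> P) \<and> keys u \<subseteq> L}"
  define Y :: "monom \<times> monom \<Rightarrow> monom \<Rightarrow> 'a mpoly" where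
    "Y = (\<lambda>k x. if x = fst k then single (snd k) 1 else 0)"
  let ?sc = "\<lambda>(c::'a) (p :: monom \<Rightarrow> 'a mpoly) b. single 0 c * p b"
  have W_add: "v + w \<in> W" if vw: "v \<in> W" "w \<in> W" for v w
  proof -
    obtain a u a' u' where 1: "v = (\<lambda>b. Z a b + lin (E b) u)" "\<forall>x\<in>B. \<forall>y\<in>B. a x y \<in> P" "keys u \<subseteq> L"
      and 2: "w = (\<lambda>b. Z a' b + lin (E b) u')" "\<forall>x\<in>B. \<forall>y\<in>B. a' x y \<in> P" "keys u' \<subseteq> L"
      using vw unfolding W_def by blast
    have "v + w = (\<lambda>b. Z (\<lambda>x y. a x y + a' x y) b + lin (E b) (u + u'))"
      by (rule ext) (simp add: 1 2 Z_def lin_add distrib_right sum.distrib)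
    moreover have "keys (u + u') \<subseteq> L" using Poly_Mapping.keys_add[of u u'] 1 2 by auto
    ultimately show ?thesis using 1 2 unfolding W_def
      by (intro CollectI exI[of _ "\<lambda>x y. a x y + a' x y"] exI[of _ "u + u'"]) (auto intro: poly_ring_add)
  qed
  have W_mult: "(\<lambda>b. single 0 d * v b) \<in> W" if v: "v \<in> W" for v d
  proof -
    obtain a u where 1: "v = (\<lambda>b. Z a b + lin (E b) u)" "\<forall>x\<in>B. \<forall>y\<in>B. a x y \<in> P" "keys u \<subseteq> L"
      using v unfolding W_def by blast
    have "(\<lambda>b. single 0 d * v b) = (\<lambda>b. Z (\<lambda>x y. single 0 d * a x y) b + lin (E b) (single 0 d * u))"
      by (rule ext) (simp add: 1 Z_def lin_const distrib_left sum_distrib_left mult.assoc)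
    moreover have "keys (single 0 d * u) \<subseteq> L" using keys_const_mult[of d u] 1 by auto
    ultimately show ?thesis using 1 unfolding W_def
      by (intro CollectI exI[of _ "\<lambda>x y. single 0 d * a x y"] exI[of _ "single 0 d * u"])
        (auto intro: poly_ring_mult)
  qed
  have YW: "\<forall>k\<in>A. Y k \<in> W" if A: "A = {(b, \<beta>). b \<in> B \<and> \<beta> \<in> monoms N \<and> b + \<beta> \<in> fiber g}" for A g
  proof (rule triangular_nakayama[where sc = ?sc and r = "\<lambda>k k'. less (fst k + snd k) (fst k' + snd k')"])
    have "A \<subseteq> B \<times> (\<Union>b\<in>B. (\<lambda>\<alpha>. \<alpha> - b) ` fiber g)"
    proof
      fix k assume "k \<in> A"
      then obtain b \<beta> where k: "k = (b, \<beta>)" "b \<in> B" "b + \<beta> \<in> fiber g" using A by blast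
      then have "\<beta> \<in> (\<lambda>\<alpha>. \<alpha> - b) ` fiber g" by (intro image_eqI[of _ _ "b + \<beta>"]) auto
      then show "k \<in> B \<times> (\<Union>b\<in>B. (\<lambda>\<alpha>. \<alpha> - b) ` fiber g)" using k by blast
    qed
    moreover have "finite (B \<times> (\<Union>b\<in>B. (\<lambda>\<alpha>. \<alpha> - b) ` fiber g))" using B finite_fiber by auto
    ultimately show "finite A" by (rule finite_subset)
    show "transp (\<lambda>k k'. less (fst k + snd k) (fst k' + snd k'))"
      using less_trans by (auto intro: transpI)
    show "irreflp (\<lambda>k k'. less (fst k + snd k) (fst k' + snd k'))"
      using less_irrefl by (auto intro: irreflpI)
    fix k assume kA: "k \<in> A"
    then obtain b \<beta> where k: "k = (b, \<beta>)" "b \<in> B" "\<beta> \<in> monoms N" "b + \<beta> \<in> fiber g" using A by blast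
    define \<alpha> where "\<alpha> = b + \<beta>"
    have a: "\<alpha> \<in> L" "gam \<alpha> = g"
      using k B by (auto simp: \<alpha>_def L_def fiber_def intro!: bexI[of _ b])
    define j where "j = iota \<alpha>"
    have j: "j \<in> B" "monom_dvd j \<alpha>" using iota a by (auto simp: j_def)
    define m where "m = mlcm b j"
    have m: "monom_dvd m \<alpha>" "monom_dvd b m" "monom_dvd j m"
      using mlcm_least[of b \<alpha> j] j mlcm_dvd by (auto simp: m_def \<alpha>_def)
    define \<gamma> where "\<gamma> = \<alpha> - m"
    have \<gamma>: "\<gamma> + m = \<alpha>" using monom_dvd_diff[OF m(1)] by (simp add: \<gamma>_def add.commute)
    have \<gamma>N: "\<gamma> \<in> monoms N" using a L_monoms by (simp add: \<gamma>_def)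
    have e1: "\<gamma> + (m - b) = \<beta>"
    proof -
      have "b + (\<gamma> + (m - b)) = b + \<beta>"
        using \<gamma> monom_dvd_diff[OF m(2)] by (metis \<alpha>_def add.left_commute)
      then show ?thesis by simp
    qed
    have e2: "\<gamma> + (m - j) = \<alpha> - j"
    proof -
      have "j + (\<gamma> + (m - j)) = j + (\<alpha> - j)"
        using \<gamma> monom_dvd_diff[OF m(3)] monom_dvd_diff[OF j(2)] by (metis add.left_commute)
      then show ?thesis by simp
    qed
    define u where "u = su b j"
    have u: "keys u \<subseteq> L \<inter> fiber (gam m)" using su[OF k(2) j(1)] by (simp add: u_def m_def)
    define \<phi> where "\<phi> = (\<lambda>\<alpha>'. (iota \<alpha>', \<gamma> + (\<alpha>' - iota \<alpha>')))"
    have \<phi>: "fst (\<phi> \<alpha>') + snd (\<phi> \<alpha>') = \<gamma> + \<alpha>'" if "\<alpha>' \<in> L" for \<alpha>'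
    proof -
      have "fst (\<phi> \<alpha>') + snd (\<phi> \<alpha>') = \<gamma> + (\<alpha>' - iota \<alpha>' + iota \<alpha>')" by (simp add: \<phi>_def ac_simps)
      then show ?thesis by (simp only: iota_eq[OF that])
    qed
    have inj: "inj_on \<phi> (keys u)"
    proof (rule inj_onI)
      fix x y assume xy: "x \<in> keys u" "y \<in> keys u" "\<phi> x = \<phi> y"
      have "x \<in> L" "y \<in> L" using u xy by auto
      then have "\<gamma> + x = \<gamma> + y" using \<phi>[of x] \<phi>[of y] unfolding xy(3) by metis
      then show "x = y" by simp
    qed
    have \<phi>A: "\<phi> ` keys u \<subseteq> A"
    proof (rule image_subsetI)
      fix \<alpha>' assume a': "\<alpha>' \<in> keys u"
      then have aL: "\<alpha>' \<in> L" "gam \<alpha>' = gam m" using u by (auto simp: fiber_def)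
      have "gam (\<gamma> + \<alpha>') = gam (\<gamma> + m)" using aL(2) gam_add by blast
      then have "gam (\<gamma> + \<alpha>') = g" using \<gamma> a by simp
      then have "fst (\<phi> \<alpha>') + snd (\<phi> \<alpha>') \<in> fiber g"
        using \<phi>[OF aL(1)] \<gamma>N L_monoms[OF aL(1)] by (simp add: fiber_def)
      then show "\<phi> \<alpha>' \<in> A" unfolding A using iota[OF aL(1)] \<gamma>N L_monoms[OF aL(1)]
        by (simp add: \<phi>_def)
    qed
    have finA: "finite A" by fact
    define v where "v = (\<lambda>k. if k \<in> \<phi> ` keys u then lookup u (inv_into (keys u) \<phi> k) else 0)"
    have v\<phi>: "v (\<phi> \<alpha>') = lookup u \<alpha>'" if "\<alpha>' \<in> keys u" for \<alpha>'
      using that inj by (simp add: v_def inv_into_f_f)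
    define w where "w = (\<lambda>x. single \<gamma> 1 * \<sigma> b j x + E x \<alpha>)"
    have "w \<in> W"
    proof -
      let ?a = "\<lambda>x y. if x = b \<and> y = j then single \<gamma> (1::'a) else 0"
      have "Z ?a x = single \<gamma> 1 * \<sigma> b j x" for x
      proof -
        have "Z ?a x = (\<Sum>x'\<in>B. if x' = b then (\<Sum>y\<in>B. if y = j then single \<gamma> 1 * \<sigma> x' y x else 0) else 0)"
          unfolding Z_def by (intro sum.cong refl) (auto intro!: sum.cong)
        then show ?thesis using k j B by simp
      qed
      then have "w = (\<lambda>x. Z ?a x + lin (E x) (single \<alpha> 1))"
        by (intro ext) (simp add: w_def)
      then show ?thesis using a \<gamma>N unfolding W_def
        by (intro CollectI exI[of _ ?a] exI[of _ "single \<alpha> 1"]) (auto intro: poly_ring_single)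
    qed
    moreover have "Y k = w + (\<Sum>k'\<in>A. ?sc (v k') (Y k'))"
    proof
      fix x
      have "(\<Sum>k'\<in>A. single 0 (v k') * Y k' x) = (\<Sum>k'\<in>\<phi> ` keys u. single 0 (v k') * Y k' x)"
        by (rule sum.mono_neutral_right[OF finA \<phi>A]) (auto simp: v_def)
      also have "\<dots> = (\<Sum>\<alpha>'\<in>keys u. single 0 (lookup u \<alpha>') * Y (\<phi> \<alpha>') x)"
        by (simp add: sum.reindex[OF inj] v\<phi>)
      also have "\<dots> = (\<Sum>\<alpha>'\<in>keys u. single 0 (lookup u \<alpha>') * (single \<gamma> 1 * E x \<alpha>'))"
        by (rule sum.cong) (auto simp: Y_def \<phi>_def E_def mult_single)
      also have "\<dots> = single \<gamma> 1 * lin (E x) u"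
        by (simp add: lin_def sum_distrib_left mult.left_commute)
      finally have 1: "(\<Sum>k'\<in>A. single 0 (v k') * Y k' x) = single \<gamma> 1 * lin (E x) u" .
      have 2: "single \<gamma> 1 * (if x = b then single (m - b) 1 else 0) = Y k x"
        using e1 k(1) by (simp add: Y_def mult_single)
      have 3: "single \<gamma> 1 * (if x = j then single (m - j) 1 else 0) = E x \<alpha>"
        using e2 by (auto simp: E_def mult_single j_def)
      have "single \<gamma> 1 * \<sigma> b j x = Y k x - E x \<alpha> - single \<gamma> 1 * lin (E x) u"
        unfolding \<sigma>_def right_diff_distrib m_def[symmetric] u_def[symmetric] 2 3 ..
      then show "Y k x = (w + (\<Sum>k'\<in>A. ?sc (v k') (Y k'))) x"
        by (simp add: w_def 1)
    qed
    moreover have "nonunit (v k') \<or> less (fst k' + snd k') (fst k + snd k)" if k': "k' \<in> A" for k'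
    proof (cases "k' \<in> \<phi> ` keys u")
      case True
      then obtain \<alpha>' where a': "\<alpha>' \<in> keys u" "k' = \<phi> \<alpha>'" by blast
      have "fst k' + snd k' = \<gamma> + \<alpha>'" using \<phi>[of \<alpha>'] a' u by blast
      moreover have "fst k + snd k = \<gamma> + m" using k \<gamma> \<alpha>_def by simp
      moreover have "nonunit (lookup u \<alpha>') \<or> less \<alpha>' m"
        using su_less[OF k(2) j(1)] by (simp add: u_def m_def)
      ultimately show ?thesis using less_add v\<phi>[OF a'(1)] a'(2) by auto
    qed (simp add: v_def nonunit_0)
    ultimately show "\<exists>w u. w \<in> W \<and> Y k = w + (\<Sum>b\<in>A. ?sc (u b) (Y b)) \<and>
        (\<forall>b\<in>A. nonunit (u b) \<or> less (fst b + snd b) (fst k + snd k))"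
      by (intro exI[of _ w] exI[of _ v] conjI ballI)
  qed (use W_add W_mult in \<open>auto simp: distrib_left const_add const_const fun_eq_iff\<close>)
  have W0: "(\<lambda>b. 0) \<in> W"
    unfolding W_def by (intro CollectI exI[of _ "\<lambda>_ _. 0"] exI[of _ 0]) (auto simp: Z_def)
  have one: "(\<lambda>x. if x = b then h else 0) \<in> W" if "b \<in> B" "h \<in> P" for b h
    using that(2)
  proof (induction rule: poly_induct_single)
    case (add h h')
    from W_add[OF this] show ?case
      by (rule back_subst[of "\<lambda>v. v \<in> W"]) auto
  next
    case (single \<beta> d)
    have "Y (b, \<beta>) \<in> W"
      using YW[OF refl, of "gam (b + \<beta>)"] that(1) single B by (auto simp: fiber_def)
    from W_mult[OF this, of d] show ?case
      by (rule back_subst[of "\<lambda>v. v \<in> W"]) (auto simp: Y_def mult_single)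
  qed (use W0 in simp)
  have "(\<lambda>x. if x \<in> B' then p x else 0) \<in> W" if "B' \<subseteq> B" for B'
    using finite_subset[OF that B(1)] that
  proof (induction B' rule: finite_induct)
    case (insert b B')
    have "(\<lambda>x. if x \<in> B' then p x else 0) + (\<lambda>x. if x = b then p b else 0) \<in> W"
      by (intro W_add one insert.IH p) (use insert in auto)
    then show ?case
      by (rule back_subst[of "\<lambda>v. v \<in> W"]) (use insert in auto)
  qed (use W0 in simp)
  then have "(\<lambda>x. if x \<in> B then p x else 0) \<in> W" by blast
  then obtain a u where "(\<lambda>x. if x \<in> B then p x else 0) = (\<lambda>b. Z a b + lin (E b) u)"
    "\<forall>x\<in>B. \<forall>y\<in>B. a x y \<in> P" "keys u \<subseteq> L" unfolding W_def by blast
  then show ?thesis unfolding Z_def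
    by (intro exI[of _ a] exI[of _ u]) (auto dest: fun_cong split: if_splits)
qed

text \<open>Evaluating the vectors of the previous lemma at the basis.\<close>

lemma combination_reduction:
  assumes p: "\<And>b. b \<in> B \<Longrightarrow> p b \<in> P"
  shows "\<exists>u q. keys u \<subseteq> L \<and> q \<in> P \<and> (\<Sum>b\<in>B. p b * f b) = lin F u + single 0 c * q"
proof -
  obtain a u where a: "\<forall>x\<in>B. \<forall>y\<in>B. a x y \<in> P" and u: "keys u \<subseteq> L"
    and eq: "\<forall>b\<in>B. p b = (\<Sum>x\<in>B. \<Sum>y\<in>B. a x y * \<sigma> x y b) + lin (E b) u"
    using vector_reduction[of p, OF p] by blast
  let ?q = "\<Sum>x\<in>B. \<Sum>y\<in>B. a x y * sg x y"
  have "(\<Sum>b\<in>B. p b * f b) = (\<Sum>b\<in>B. (\<Sum>x\<in>B. \<Sum>y\<in>B. a x y * (\<sigma> x y b * f b)) + lin (E b) u * f b)"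
    using eq by (intro sum.cong) (auto simp: distrib_right sum_distrib_right mult.assoc)
  also have "\<dots> = (\<Sum>b\<in>B. \<Sum>x\<in>B. \<Sum>y\<in>B. a x y * (\<sigma> x y b * f b)) + lin F u"
    by (simp add: sum.distrib sum_lin_E[OF u])
  also have "(\<Sum>b\<in>B. \<Sum>x\<in>B. \<Sum>y\<in>B. a x y * (\<sigma> x y b * f b)) =
      (\<Sum>x\<in>B. \<Sum>y\<in>B. a x y * (\<Sum>b\<in>B. \<sigma> x y b * f b))"
    by (subst sum.swap, rule sum.cong[OF refl], subst sum.swap) (simp add: sum_distrib_left)
  also have "\<dots> = single 0 c * ?q"
    by (simp add: sum_\<sigma> sum_distrib_left mult.left_commute)
  finally have "(\<Sum>b\<in>B. p b * f b) = lin F u + single 0 c * ?q" by (simp add: add.commute)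
  moreover have "?q \<in> P" using a sg G homog_P by (intro poly_ring_sum poly_ring_mult) auto
  ultimately show ?thesis using u by blast
qed

definition J :: "'a mpoly set" where
  "J = gen (f ` B \<union> (\<lambda>g. single 0 c * g) ` G)"

lemma gens_homog: "h \<in> f ` B \<union> (\<lambda>g. single 0 c * g) ` G \<Longrightarrow> homog h"
  using f_hom G homog_single_mult[of _ 0] unfolding homog_def by auto

lemma gens_P: "f ` B \<union> (\<lambda>g. single 0 c * g) ` G \<subseteq> P"
  using gens_homog homog_P by blast

lemma J_ideal: "is_ideal P J"
  unfolding J_def by (rule ideal_generated_is_ideal[OF unital_poly_ring gens_P])

lemma f_J: "b \<in> B \<Longrightarrow> f b \<in> J"
  unfolding J_def using ideal_generated_superset[of "f ` B \<union> (\<lambda>g. single 0 c * g) ` G" P] by auto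

lemma G_J: "g \<in> G \<Longrightarrow> single 0 c * g \<in> J"
  unfolding J_def using ideal_generated_superset[of "f ` B \<union> (\<lambda>g. single 0 c * g) ` G" P] by auto

lemma J_cases:
  assumes "x \<in> J"
  shows "\<exists>p q. (\<forall>b\<in>B. p b \<in> P) \<and> (\<forall>g\<in>G. q g \<in> P) \<and>
    x = (\<Sum>b\<in>B. p b * f b) + single 0 c * (\<Sum>g\<in>G. q g * g)"
proof -
  let ?h = "case_sum f (\<lambda>g. single 0 c * g)"
  have im: "?h ` (B <+> G) = f ` B \<union> (\<lambda>g. single 0 c * g) ` G"
    unfolding Plus_def image_Un image_image by simp
  obtain p where p: "\<forall>k\<in>B <+> G. p k \<in> P" "x = (\<Sum>k\<in>B <+> G. p k * ?h k)"
    using assms ideal_generated_family[OF unital_poly_ring, of "B <+> G" ?h N x] gens_P B G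
    unfolding J_def im by auto
  have "x = (\<Sum>b\<in>B. p (Inl b) * f b) + (\<Sum>g\<in>G. p (Inr g) * (single 0 c * g))"
    using p(2) B G by (simp add: sum.Plus o_def)
  then have "x = (\<Sum>b\<in>B. p (Inl b) * f b) + single 0 c * (\<Sum>g\<in>G. p (Inr g) * g)"
    by (simp add: sum_distrib_left mult.left_commute)
  with p(1) show ?thesis
    by (intro exI[of _ "\<lambda>b. p (Inl b)"] exI[of _ "\<lambda>g. p (Inr g)"]) auto
qed

lemma J_reduction:
  assumes "x \<in> J"
  shows "\<exists>u q. keys u \<subseteq> L \<and> q \<in> P \<and> x = lin F u + single 0 c * q"
proof -
  obtain p q where p: "\<forall>b\<in>B. p b \<in> P" and q: "\<forall>g\<in>G. q g \<in> P"
    and x: "x = (\<Sum>b\<in>B. p b * f b) + single 0 c * (\<Sum>g\<in>G. q g * g)"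
    using J_cases[OF assms] by blast
  obtain u q' where "keys u \<subseteq> L" "q' \<in> P" "(\<Sum>b\<in>B. p b * f b) = lin F u + single 0 c * q'"
    using combination_reduction p by blast
  moreover have "(\<Sum>g\<in>G. q g * g) \<in> P" using q G homog_P by (intro poly_ring_sum poly_ring_mult) auto
  ultimately show ?thesis using x
    by (intro exI[of _ u] exI[of _ "q' + (\<Sum>g\<in>G. q g * g)"]) (auto simp: distrib_left poly_ring_add)
qed

end

text \<open>
  Existence: Dickson's lemma gives the leading monomials modulo the maximal ideal, and \<open>c\<close> is the content
  of the normal forms of the S-polynomials and of the given generators. If \<open>c\<close> is not zero, then one of
  the quotients has a unit coefficient outside the known leading monomials.
\<close>

context graded_polynomials
begin

lemma content_basis_exists:
  assumes H: "finite H" "\<And>h. h \<in> H \<Longrightarrow> homog h"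
  obtains B f c G su sg where "content_basis V N gam less B f c G su sg"
    "gen H = gen (f ` B \<union> (\<lambda>g. single 0 c * g) ` G)"
    "c \<noteq> 0 \<Longrightarrow> nonunit c \<and> (\<exists>g\<in>G. \<exists>\<beta>. plm g \<beta> \<and> \<beta> \<notin> lms (gen H))"
proof -
  define J where "J = gen H"
  have HP: "H \<subseteq> P" using H homog_P by blast
  note JI = ideal_generated_is_ideal[OF unital_poly_ring HP, folded J_def]
  obtain B where Bd: "finite B" "B \<subseteq> lms J" "\<forall>\<alpha>\<in>lms J. \<exists>\<beta>\<in>B. monom_dvd \<beta> \<alpha>"
    using dickson[of "lms J" N] lms_upset[OF JI] unfolding monom_upset_def by blast
  have "\<exists>h. h \<in> J \<and> hom (gam b) h \<and> lookup h b = 1 \<and> (\<forall>\<beta>. less b \<beta> \<longrightarrow> nonunit (lookup h \<beta>))"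
    if b: "b \<in> B" for b
  proof -
    obtain h g where h: "h \<in> J" "hom g h" "plm h b" using Bd(2) b by (auto simp: lms_def homog_def)
    then obtain i where "lookup h b * i = 1" using unit_inverse plm_def by blast
    then have i: "i * lookup h b = 1" by (simp add: mult.commute)
    have "hom (gam b) h" using h plm_keys by (auto simp: hom_def fiber_def)
    then show ?thesis using h i is_idealD(4)[OF JI poly_ring_const h(1), of i]
      by (intro exI[of _ "single 0 i * h"]) (auto simp: hom_const plm_def nonunit_mult2)
  qed
  then obtain f where f: "\<And>b. b \<in> B \<Longrightarrow> f b \<in> J" "\<And>b. b \<in> B \<Longrightarrow> hom (gam b) (f b)"
    "\<And>b. b \<in> B \<Longrightarrow> lookup (f b) b = 1" "\<And>b \<beta>. b \<in> B \<Longrightarrow> less b \<beta> \<Longrightarrow> nonunit (lookup (f b) \<beta>)"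
    by metis
  have BN: "B \<subseteq> monoms N" using Bd lms_upset[OF JI] unfolding monom_upset_def by blast
  interpret lead_basis V N gam less B f
    by unfold_locales (use f Bd BN in auto)
  have L: "L = lms J"
    using Bd lms_upset[OF JI] unfolding L_def monom_upset_def by blast
  have FJ: "F \<alpha> \<in> J" if "\<alpha> \<in> L" for \<alpha>
    unfolding F_def using iota(1)[OF that] L_monoms[OF that] f(1)
    by (intro is_idealD(4)[OF JI]) (auto intro: poly_ring_single)
  have linJ: "lin F u \<in> J" if "keys u \<subseteq> L" for u
    unfolding lin_def using FJ that
    by (intro is_ideal_sum[OF JI] is_idealD(4)[OF JI]) auto
  have red: "nonunit (lookup r \<alpha>)" if r: "r \<in> J" "hom g r" "keys r \<inter> L = {}" for r g \<alpha>
  proof (rule ccontr)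
    assume "\<not> nonunit (lookup r \<alpha>)"
    then obtain \<beta> where "plm r \<beta>" using plm_exists by blast
    then have "\<beta> \<in> lms J" "\<beta> \<in> keys r" using r(1,2) plm_keys unfolding lms_def homog_def by blast+
    then show False using r(3) L by blast
  qed
  have nf: "\<exists>u r. y = lin F u + r \<and> keys u \<subseteq> L \<inter> fiber g \<and> keys r \<subseteq> fiber g - L \<and> r \<in> J"
    if y: "y \<in> J" "hom g y" for y g
  proof -
    obtain u r where ur: "y = lin F u + r" "keys u \<subseteq> L \<inter> fiber g" "keys r \<subseteq> fiber g - L"
      using normal_form_hom[OF y(2)] by blast
    then have "r = y - lin F u" by simp
    then have "r \<in> J" using is_ideal_diff[OF unital_poly_ring JI] y(1) linJ ur(2) by blast
    then show ?thesis using ur by blast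
  qed
  let ?S = "\<lambda>b b'. single (mlcm b b' - b) 1 * f b - single (mlcm b b' - b') 1 * f b'"
  have S: "hom (gam (mlcm b b')) (?S b b')" "?S b b' \<in> J" if b: "b \<in> B" "b' \<in> B" for b b'
  proof -
    have m: "mlcm b b' \<in> monoms N" using b BN mlcm_monoms by blast
    have e: "mlcm b b' - b + b = mlcm b b'" "mlcm b b' - b' + b' = mlcm b b'"
      using mlcm_dvd monom_dvd_diff by (metis add.commute)+
    show "hom (gam (mlcm b b')) (?S b b')"
      using hom_single_mult[OF f(2)[OF b(1)], of "mlcm b b' - b" 1]
        hom_single_mult[OF f(2)[OF b(2)], of "mlcm b b' - b'" 1] m e by (intro hom_diff) auto
    show "?S b b' \<in> J"
      by (intro is_ideal_diff[OF unital_poly_ring JI] is_idealD(4)[OF JI] f b poly_ring_single) (use m in auto)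
  qed
  have "\<forall>b b'. \<exists>u r. b \<in> B \<longrightarrow> b' \<in> B \<longrightarrow> ?S b b' = lin F u + r \<and>
      keys u \<subseteq> L \<inter> fiber (gam (mlcm b b')) \<and> keys r \<subseteq> fiber (gam (mlcm b b')) - L \<and> r \<in> J"
  proof (intro allI)
    fix b b'
    show "\<exists>u r. b \<in> B \<longrightarrow> b' \<in> B \<longrightarrow> ?S b b' = lin F u + r \<and>
      keys u \<subseteq> L \<inter> fiber (gam (mlcm b b')) \<and> keys r \<subseteq> fiber (gam (mlcm b b')) - L \<and> r \<in> J"
    proof (cases "b \<in> B \<and> b' \<in> B")
      case True
      then show ?thesis using nf[OF S(2) S(1), of b b'] by simp
    qed auto
  qed
  then obtain su sr where su: "\<And>b b'. b \<in> B \<Longrightarrow> b' \<in> B \<Longrightarrow> ?S b b' = lin F (su b b') + sr b b' \<and>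
      keys (su b b') \<subseteq> L \<inter> fiber (gam (mlcm b b')) \<and> keys (sr b b') \<subseteq> fiber (gam (mlcm b b')) - L \<and> sr b b' \<in> J"
    by metis
  have "\<forall>h. \<exists>u r g. h \<in> H \<longrightarrow> h = lin F u + r \<and>
      keys u \<subseteq> L \<inter> fiber g \<and> keys r \<subseteq> fiber g - L \<and> r \<in> J"
  proof
    fix h
    show "\<exists>u r g. h \<in> H \<longrightarrow> h = lin F u + r \<and>
      keys u \<subseteq> L \<inter> fiber g \<and> keys r \<subseteq> fiber g - L \<and> r \<in> J"
    proof (cases "h \<in> H")
      case True
      then obtain g where "hom g h" using H homog_def by blast
      then show ?thesis using nf[of h g] True ideal_generated_superset[of H P] unfolding J_def by blast
    qed auto
  qed
  then obtain hu hr hg where hu: "\<And>h. h \<in> H \<Longrightarrow> h = lin F (hu h) + hr h \<and>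
      keys (hu h) \<subseteq> L \<inter> fiber (hg h) \<and> keys (hr h) \<subseteq> fiber (hg h) - L \<and> hr h \<in> J"
    by metis
  define R where "R = (\<lambda>(b, b'). sr b b') ` (B \<times> B) \<union> hr ` H"
  have R: "finite R" "\<And>r. r \<in> R \<Longrightarrow> r \<in> J \<and> keys r \<inter> L = {} \<and> (\<exists>g. hom g r)"
  proof -
    show "finite R" using B H by (auto simp: R_def)
    show "r \<in> J \<and> keys r \<inter> L = {} \<and> (\<exists>g. hom g r)" if rR: "r \<in> R" for r
    proof -
      consider b b' where "b \<in> B" "b' \<in> B" "r = sr b b'" | h where "h \<in> H" "r = hr h"
        using rR unfolding R_def by auto
      then show ?thesis
      proof cases
        case 1
        then show ?thesis using su[of b b'] unfolding hom_def by blast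
      next
        case 2
        then show ?thesis using hu[of h] unfolding hom_def by blast
      qed
    qed
  qed
  let ?C = "\<Union>r\<in>R. lookup r ` keys r"
  obtain c where c: "c \<in> insert 0 ?C" "\<forall>x\<in>?C. c dvd x"
    using finite_content[of ?C] R(1) by auto
  have "\<exists>g. r = single 0 c * g \<and> keys g \<subseteq> keys r" if "r \<in> R" for r
  proof -
    have "c dvd lookup r \<alpha>" for \<alpha>
      using c(2) that by (cases "\<alpha> \<in> keys r") (auto simp: in_keys_iff dvd_zero_ring)
    then show ?thesis using const_dvdE by metis
  qed
  then obtain dv where dv: "\<And>r. r \<in> R \<Longrightarrow> r = single 0 c * dv r \<and> keys (dv r) \<subseteq> keys r" by metis
  define G where "G = dv ` R"
  have Ghom: "homog g" if "g \<in> G" for g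
    using that dv R(2) unfolding G_def homog_def hom_def by blast
  have sR: "sr b b' \<in> R" if "b \<in> B" "b' \<in> B" for b b' using that by (auto simp: R_def)
  have su_less: "nonunit (lookup (su b b') \<alpha>) \<or> less \<alpha> (mlcm b b')" if b: "b \<in> B" "b' \<in> B" for b b' \<alpha>
  proof (rule ccontr)
    assume neg: "\<not> ?thesis"
    let ?m = "mlcm b b'"
    obtain m where m: "plm (su b b') m" using plm_exists neg by blast
    have e: "?m - b + b = ?m" "?m - b' + b' = ?m"
      using mlcm_dvd monom_dvd_diff by (metis add.commute)+
    have "nonunit (lookup (?S b b') m)"
    proof (cases "m = ?m")
      case True
      have "lookup (single (?m - b) 1 * f b) ?m = 1"
        using lookup_single_mult[of "?m - b" 1 "f b" b] e f(3)[OF b(1)] by simp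
      moreover have "lookup (single (?m - b') 1 * f b') ?m = 1"
        using lookup_single_mult[of "?m - b'" 1 "f b'" b'] e f(3)[OF b(2)] by simp
      ultimately show ?thesis using True nonunit_0 by (simp add: lookup_minus)
    next
      case False
      have "\<alpha> = m \<or> less \<alpha> m" using m neg less_total[of \<alpha> m] by (auto simp: plm_def)
      then have "less ?m m" using False neg less_total[of m ?m] less_trans[of \<alpha> m ?m] by auto
      then show ?thesis
        using shift_coeff[of b "f b" "?m - b" m 1] shift_coeff[of b' "f b'" "?m - b'" m 1] f(4) b e
        by (auto simp: lookup_minus intro: nonunit_diff)
    qed
    moreover have "lookup (?S b b') m = lookup (lin F (su b b') + sr b b') m" using su b by metis
    moreover have "\<not> nonunit (lookup (lin F (su b b') + sr b b') m)"
    proof (rule unit_at_max[OF _ m])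
      show "keys (su b b') \<subseteq> L" using su[OF b] by blast
      show "nonunit (lookup (sr b b') m)" using red su[OF b] R(2)[OF sR[OF b]] by blast
    qed
    ultimately show False by simp
  qed
  have cb: "content_basis V N gam less B f c G su (\<lambda>b b'. dv (sr b b'))"
  proof
    show "finite G" using R by (simp add: G_def)
    fix b b' \<alpha> assume b: "b \<in> B" "b' \<in> B"
    show "dv (sr b b') \<in> G" using sR[OF b] by (simp add: G_def)
    show "keys (su b b') \<subseteq> L \<inter> fiber (gam (mlcm b b'))" using su[OF b] by blast
    show "nonunit (lookup (su b b') \<alpha>) \<or> less \<alpha> (mlcm b b')" by (rule su_less[OF b])
    show "?S b b' = lin F (su b b') + single 0 c * dv (sr b b')"
      using su[OF b] dv[OF sR[OF b]] by metis
  qed (rule Ghom)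
  let ?T = "f ` B \<union> (\<lambda>g. single 0 c * g) ` G"
  have TP: "?T \<subseteq> P" using content_basis.gens_P[OF cb] .
  note TI = ideal_generated_is_ideal[OF unital_poly_ring TP]
  have "gen H = gen ?T"
  proof (rule ideal_generated_eqI[OF unital_poly_ring HP TP])
    show "?T \<subseteq> gen H"
      using f(1) dv R(2) unfolding G_def J_def by auto
    show "H \<subseteq> gen ?T"
    proof
      fix h assume h: "h \<in> H"
      have "hr h \<in> R" using h by (auto simp: R_def)
      then have "hr h = single 0 c * dv (hr h)" "dv (hr h) \<in> G" using dv by (auto simp: G_def)
      then have 1: "hr h \<in> gen ?T" using ideal_generated_superset[of ?T P] by auto
      have "F \<alpha> \<in> gen ?T" if "\<alpha> \<in> L" for \<alpha>
        unfolding F_def using iota(1)[OF that] L_monoms[OF that] ideal_generated_superset[of ?T P]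
        by (intro is_idealD(4)[OF TI]) (auto intro: poly_ring_single)
      then have "lin F (hu h) \<in> gen ?T"
        unfolding lin_def using hu[OF h]
        by (intro is_ideal_sum[OF TI] is_idealD(4)[OF TI]) auto
      then show "h \<in> gen ?T" using hu[OF h] 1 is_idealD(3)[OF TI] by metis
    qed
  qed
  moreover have "nonunit c \<and> (\<exists>g\<in>G. \<exists>\<beta>. plm g \<beta> \<and> \<beta> \<notin> lms (gen H))" if c0: "c \<noteq> 0"
  proof -
    obtain r \<alpha> where r: "r \<in> R" "\<alpha> \<in> keys r" "c = lookup r \<alpha>" using c0 c(1) by auto
    have "nonunit c" using red R(2)[OF r(1)] r(3) by blast
    moreover have "c * lookup (dv r) \<alpha> = c" using dv[OF r(1)] r(3) by (metis lookup_const_mult)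
    then have "\<not> nonunit (lookup (dv r) \<alpha>)" using mult_nonunit_self c0 by blast
    then obtain \<beta> where "plm (dv r) \<beta>" using plm_exists by blast
    moreover have "\<beta> \<notin> lms (gen H)"
      using plm_keys[OF calculation(2)] dv[OF r(1)] R(2)[OF r(1)] L unfolding J_def by blast
    ultimately show ?thesis using r(1) unfolding G_def by blast
  qed
  ultimately show ?thesis using that cb by blast
qed

text \<open>
  For nonzero \<open>c\<close>, passing from \<open>J\<close> to \<open>(J : c)\<close> enlarges the set of leading monomials modulo the
  maximal ideal, so by Dickson's lemma this can be iterated only finitely often.
\<close>

lemma content_induct:
  assumes step: "\<And>B f c G su sg e. content_basis V N gam less B f c G su sg \<Longrightarrow>
      (\<And>x. c * x = 0 \<longleftrightarrow> e dvd x) \<Longrightarrow>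
      (c \<noteq> 0 \<Longrightarrow> nonunit c \<and> \<Phi> (gen (f ` B \<union> G \<union> {single 0 e}))) \<Longrightarrow>
      \<Phi> (gen (f ` B \<union> (\<lambda>g. single 0 c * g) ` G))"
    and H: "finite H" "\<And>h. h \<in> H \<Longrightarrow> homog h"
  shows "\<Phi> (gen H)"
proof -
  have "\<forall>H. finite H \<longrightarrow> (\<forall>h\<in>H. homog h) \<longrightarrow> lms (gen H) = X \<longrightarrow> \<Phi> (gen H)" for X
  proof (induction X rule: wf_induct_rule[OF wf_monom_upsets[of N]])
    case (1 X)
    show ?case
    proof (intro allI impI)
      fix H assume H: "finite H" "\<forall>h\<in>H. homog h" "lms (gen H) = X"
      obtain B f c G su sg where cb: "content_basis V N gam less B f c G su sg"
        and eq: "gen H = gen (f ` B \<union> (\<lambda>g. single 0 c * g) ` G)"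
        and c: "c \<noteq> 0 \<Longrightarrow> nonunit c \<and> (\<exists>g\<in>G. \<exists>\<beta>. plm g \<beta> \<and> \<beta> \<notin> lms (gen H))"
        using content_basis_exists[of H] H by blast
      interpret content_basis V N gam less B f c G su sg by (rule cb)
      obtain e where e: "\<And>x. c * x = 0 \<longleftrightarrow> e dvd x" using ann_principal by blast
      let ?H = "f ` B \<union> G \<union> {single 0 e}"
      have H1: "finite ?H" "\<forall>h\<in>?H. homog h"
        using B G f_hom hom_single[of 0 e] unfolding homog_def by auto
      have HP: "?H \<subseteq> P" "H \<subseteq> P" using H1 H homog_P by auto
      note I = ideal_generated_is_ideal[OF unital_poly_ring HP(1)]
      have \<Phi>H: "\<Phi> (gen ?H)" if c0: "c \<noteq> 0"
      proof -
        have "(\<lambda>g. single 0 c * g) ` G \<subseteq> gen ?H"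
          using is_idealD(4)[OF I poly_ring_const] ideal_generated_superset[of ?H P] by auto
        then have "gen H \<subseteq> gen ?H"
          unfolding eq by (intro ideal_generated_least[OF I]) (use ideal_generated_superset[of ?H P] in auto)
        then have sub: "lms (gen H) \<subseteq> lms (gen ?H)" unfolding lms_def by blast
        obtain g \<beta> where g: "g \<in> G" "plm g \<beta>" "\<beta> \<notin> lms (gen H)" using c[OF c0] by blast
        have "g \<in> gen ?H" using g(1) ideal_generated_superset[of ?H P] by auto
        then have "\<beta> \<in> lms (gen ?H)" using g G(2) unfolding lms_def by blast
        then have "lms (gen H) \<subset> lms (gen ?H)" using sub g(3) by blast
        moreover have "monom_upset N (lms (gen H))" "monom_upset N (lms (gen ?H))"
          using lms_upset I ideal_generated_is_ideal[OF unital_poly_ring HP(2)] by auto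
        ultimately have "(lms (gen ?H), X) \<in> {(L', L). monom_upset N L \<and> monom_upset N L' \<and> L \<subset> L'}"
          using H(3) by simp
        from 1[OF this, THEN spec, of ?H] H1 show ?thesis by simp
      qed
      have "nonunit c \<and> \<Phi> (gen ?H)" if "c \<noteq> 0" using c[OF that] \<Phi>H[OF that] by blast
      from step[OF cb e this] show "\<Phi> (gen H)" unfolding eq .
    qed
  qed
  then show ?thesis using H by blast
qed

end

section \<open>Coherence: syzygies of graded ideals\<close>

lemma mult_const_one [simp]:
  fixes f :: "'a::{comm_ring, comm_monoid_mult} mpoly"
  shows "f * single 0 1 = f"
  by (subst mult.commute) simp

definition syz_fg :: "nat \<Rightarrow> 'k set \<Rightarrow> ('k \<Rightarrow> 'a::{comm_ring, comm_monoid_mult} mpoly) \<Rightarrow> bool" where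
  "syz_fg n K h \<longleftrightarrow> (\<exists>Z. finite Z \<and>
     (\<forall>\<tau>\<in>Z. (\<forall>k\<in>K. \<tau> k \<in> poly_ring n) \<and> (\<Sum>k\<in>K. \<tau> k * h k) = 0) \<and>
     (\<forall>p. (\<forall>k\<in>K. p k \<in> poly_ring n) \<longrightarrow> (\<Sum>k\<in>K. p k * h k) = 0 \<longrightarrow>
        (\<exists>a. (\<forall>\<tau>\<in>Z. a \<tau> \<in> poly_ring n) \<and> (\<forall>k\<in>K. p k = (\<Sum>\<tau>\<in>Z. a \<tau> * \<tau> k)))))"

lemma syz_fgE:
  assumes "syz_fg n K h"
  obtains Z where "finite Z" "\<And>\<tau> k. \<tau> \<in> Z \<Longrightarrow> k \<in> K \<Longrightarrow> \<tau> k \<in> poly_ring n"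
    "\<And>\<tau>. \<tau> \<in> Z \<Longrightarrow> (\<Sum>k\<in>K. \<tau> k * h k) = 0"
    "\<And>p. \<forall>k\<in>K. p k \<in> poly_ring n \<Longrightarrow> (\<Sum>k\<in>K. p k * h k) = 0 \<Longrightarrow>
        (\<exists>a. (\<forall>\<tau>\<in>Z. a \<tau> \<in> poly_ring n) \<and> (\<forall>k\<in>K. p k = (\<Sum>\<tau>\<in>Z. a \<tau> * \<tau> k)))"
proof -
  obtain Z where "finite Z" "\<forall>\<tau>\<in>Z. (\<forall>k\<in>K. \<tau> k \<in> poly_ring n) \<and> (\<Sum>k\<in>K. \<tau> k * h k) = 0"
    "\<forall>p. (\<forall>k\<in>K. p k \<in> poly_ring n) \<longrightarrow> (\<Sum>k\<in>K. p k * h k) = 0 \<longrightarrow>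
        (\<exists>a. (\<forall>\<tau>\<in>Z. a \<tau> \<in> poly_ring n) \<and> (\<forall>k\<in>K. p k = (\<Sum>\<tau>\<in>Z. a \<tau> * \<tau> k)))"
    using assms unfolding syz_fg_def by blast
  then show thesis by (intro that[of Z]) simp_all
qed

lemma syz_fgI:
  assumes I: "finite I"
    and \<tau>: "\<And>i k. i \<in> I \<Longrightarrow> k \<in> K \<Longrightarrow> \<tau> i k \<in> poly_ring n"
      "\<And>i. i \<in> I \<Longrightarrow> (\<Sum>k\<in>K. \<tau> i k * h k) = 0"
    and p: "\<And>p. (\<forall>k\<in>K. p k \<in> poly_ring n) \<Longrightarrow> (\<Sum>k\<in>K. p k * h k) = 0 \<Longrightarrow>
      \<exists>a. (\<forall>i\<in>I. a i \<in> poly_ring n) \<and> (\<forall>k\<in>K. p k = (\<Sum>i\<in>I. a i * \<tau> i k))"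
  shows "syz_fg n K h"
  unfolding syz_fg_def
proof (intro exI[of _ "\<tau> ` I"] conjI allI impI)
  show "finite (\<tau> ` I)" using I by simp
  show "\<forall>t\<in>\<tau> ` I. (\<forall>k\<in>K. t k \<in> poly_ring n) \<and> (\<Sum>k\<in>K. t k * h k) = 0" using \<tau> by auto
  fix q assume "\<forall>k\<in>K. q k \<in> poly_ring n" "(\<Sum>k\<in>K. q k * h k) = 0"
  then obtain a where a: "\<forall>i\<in>I. a i \<in> poly_ring n" "\<forall>k\<in>K. q k = (\<Sum>i\<in>I. a i * \<tau> i k)"
    using p by blast
  let ?b = "\<lambda>t. \<Sum>i\<in>{i\<in>I. \<tau> i = t}. a i"
  have "(\<Sum>t\<in>\<tau> ` I. ?b t * t k) = (\<Sum>i\<in>I. a i * \<tau> i k)" for k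
    unfolding sum.image_gen[OF I, of "\<lambda>i. a i * \<tau> i k" \<tau>] by (simp add: sum_distrib_right)
  then show "\<exists>a. (\<forall>t\<in>\<tau> ` I. a t \<in> poly_ring n) \<and> (\<forall>k\<in>K. q k = (\<Sum>t\<in>\<tau> ` I. a t * t k))"
    using a by (intro exI[of _ ?b]) (auto intro: poly_ring_sum)
qed

text \<open>
  The syzygies of \<open>h'\<close> are the images of those of \<open>h\<close> under one transition matrix, up to the syzygies that
  express that passing from \<open>h'\<close> to \<open>h\<close> and back is the identity on the ideal. So finite generation is a
  property of the ideal alone.
\<close>

lemma syz_fg_transfer:
  fixes h :: "'k \<Rightarrow> 'a::{comm_ring, comm_monoid_mult} mpoly" and h' :: "'l \<Rightarrow> 'a mpoly"
  assumes K: "finite K" "h ` K \<subseteq> poly_ring n" and K': "finite K'" "h' ` K' \<subseteq> poly_ring n"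
    and eq: "ideal_generated (poly_ring n) (h ` K) = ideal_generated (poly_ring n) (h' ` K')"
    and syz: "syz_fg n K h"
  shows "syz_fg n K' h'"
proof -
  let ?P = "poly_ring n :: 'a mpoly set"
  have "\<forall>j\<in>K'. \<exists>p. (\<forall>k\<in>K. p k \<in> ?P) \<and> h' j = (\<Sum>k\<in>K. p k * h k)"
    using ideal_generated_family[OF unital_poly_ring K] ideal_generated_superset[of "h' ` K'" ?P]
    unfolding eq by auto
  then obtain M where M: "\<And>j k. j \<in> K' \<Longrightarrow> k \<in> K \<Longrightarrow> M j k \<in> ?P"
    "\<And>j. j \<in> K' \<Longrightarrow> h' j = (\<Sum>k\<in>K. M j k * h k)" by metis
  have "\<forall>k\<in>K. \<exists>p. (\<forall>j\<in>K'. p j \<in> ?P) \<and> h k = (\<Sum>j\<in>K'. p j * h' j)"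
    using ideal_generated_family[OF unital_poly_ring K'] ideal_generated_superset[of "h ` K" ?P]
    unfolding eq[symmetric] by auto
  then obtain R where R: "\<And>j k. j \<in> K' \<Longrightarrow> k \<in> K \<Longrightarrow> R k j \<in> ?P"
    "\<And>k. k \<in> K \<Longrightarrow> h k = (\<Sum>j\<in>K'. R k j * h' j)" by metis
  obtain Z where Z: "finite Z" "\<And>\<tau> k. \<tau> \<in> Z \<Longrightarrow> k \<in> K \<Longrightarrow> \<tau> k \<in> ?P"
    "\<And>\<tau>. \<tau> \<in> Z \<Longrightarrow> (\<Sum>k\<in>K. \<tau> k * h k) = 0"
    "\<And>p. \<forall>k\<in>K. p k \<in> ?P \<Longrightarrow> (\<Sum>k\<in>K. p k * h k) = 0 \<Longrightarrow>
        (\<exists>a. (\<forall>\<tau>\<in>Z. a \<tau> \<in> ?P) \<and> (\<forall>k\<in>K. p k = (\<Sum>\<tau>\<in>Z. a \<tau> * \<tau> k)))"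
    using syz by (rule syz_fgE) (rule that)
  let ?d = "\<lambda>i j. if i = j then single 0 (1::'a) else (0 :: 'a mpoly)"
  let ?\<tau> = "case_sum (\<lambda>t j. \<Sum>k\<in>K. t k * R k j) (\<lambda>i j. ?d i j - (\<Sum>k\<in>K. M i k * R k j))"
  have push: "(\<Sum>j\<in>K'. (\<Sum>k\<in>K. t k * R k j) * h' j) = (\<Sum>k\<in>K. t k * h k)" for t
  proof -
    have "(\<Sum>j\<in>K'. (\<Sum>k\<in>K. t k * R k j) * h' j) = (\<Sum>k\<in>K. t k * (\<Sum>j\<in>K'. R k j * h' j))"
      by (simp add: sum_distrib_left sum_distrib_right mult.assoc) (rule sum.swap)
    also have "\<dots> = (\<Sum>k\<in>K. t k * h k)" using R(2) by (intro sum.cong) auto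
    finally show ?thesis .
  qed
  have delta: "(\<Sum>j\<in>K'. q j * ?d j i) = q i" if "i \<in> K'" for q i
  proof -
    have "(\<Sum>j\<in>K'. q j * ?d j i) = (\<Sum>j\<in>K'. if j = i then q j else 0)"
      by (rule sum.cong) (auto simp: mult.commute)
    then show ?thesis using that K' by simp
  qed
  show ?thesis
  proof (rule syz_fgI[where I = "Z <+> K'" and \<tau> = ?\<tau>])
    show "finite (Z <+> K')" using Z K' by simp
    show "?\<tau> i k \<in> ?P" if "i \<in> Z <+> K'" "k \<in> K'" for i k
      using that Z(2) M(1) R(1)
      by (auto intro!: poly_ring_sum poly_ring_mult poly_ring_diff poly_ring_uminus)
    show "(\<Sum>k\<in>K'. ?\<tau> i k * h' k) = 0" if i: "i \<in> Z <+> K'" for i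
    proof (cases i)
      case (Inl t)
      then show ?thesis using push[of t] Z(3)[of t] i by auto
    next
      case (Inr j)
      then have j: "j \<in> K'" using i by auto
      have "(\<Sum>k\<in>K'. ?d j k * h' k) = h' j"
        using delta[OF j, of h'] by (simp add: mult.commute eq_commute cong: if_cong)
      moreover have "(\<Sum>k\<in>K'. (\<Sum>ka\<in>K. M j ka * R ka k) * h' k) = h' j"
        using push[of "M j"] M(2)[OF j] by simp
      ultimately show ?thesis using Inr by (simp add: left_diff_distrib sum_subtractf)
    qed
    fix p assume p: "\<forall>j\<in>K'. p j \<in> ?P" "(\<Sum>j\<in>K'. p j * h' j) = 0"
    let ?q = "\<lambda>k. \<Sum>j\<in>K'. p j * M j k"
    have "(\<Sum>k\<in>K. ?q k * h k) = (\<Sum>j\<in>K'. p j * (\<Sum>k\<in>K. M j k * h k))"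
      by (simp add: sum_distrib_left sum_distrib_right mult.assoc) (rule sum.swap)
    also have "\<dots> = (\<Sum>j\<in>K'. p j * h' j)" using M(2) by (intro sum.cong) auto
    finally have "(\<Sum>k\<in>K. ?q k * h k) = 0" using p by simp
    moreover have "\<forall>k\<in>K. ?q k \<in> ?P" using p(1) M(1) by (auto intro!: poly_ring_sum poly_ring_mult)
    ultimately obtain a where a: "\<forall>\<tau>\<in>Z. a \<tau> \<in> ?P" "\<forall>k\<in>K. ?q k = (\<Sum>\<tau>\<in>Z. a \<tau> * \<tau> k)"
      using Z(4)[of ?q] by blast
    show "\<exists>a. (\<forall>i\<in>Z <+> K'. a i \<in> ?P) \<and> (\<forall>k\<in>K'. p k = (\<Sum>i\<in>Z <+> K'. a i * ?\<tau> i k))"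
    proof (intro exI[of _ "case_sum a p"] conjI ballI)
      show "case_sum a p i \<in> ?P" if "i \<in> Z <+> K'" for i using that a p by auto
      fix j assume j: "j \<in> K'"
      have "(\<Sum>t\<in>Z. a t * (\<Sum>k\<in>K. t k * R k j)) = (\<Sum>k\<in>K. (\<Sum>t\<in>Z. a t * t k) * R k j)"
        by (simp add: sum_distrib_left sum_distrib_right mult.assoc) (rule sum.swap)
      also have "\<dots> = (\<Sum>k\<in>K. ?q k * R k j)" using a(2) by (intro sum.cong) auto
      also have "\<dots> = (\<Sum>i\<in>K'. p i * (\<Sum>k\<in>K. M i k * R k j))"
        by (simp add: sum_distrib_left sum_distrib_right mult.assoc) (rule sum.swap)
      finally have 1: "(\<Sum>t\<in>Z. a t * (\<Sum>k\<in>K. t k * R k j)) = (\<Sum>i\<in>K'. p i * (\<Sum>k\<in>K. M i k * R k j))" .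
      have "(\<Sum>i\<in>Z <+> K'. case_sum a p i * ?\<tau> i j) =
          (\<Sum>t\<in>Z. a t * (\<Sum>k\<in>K. t k * R k j)) + (\<Sum>i\<in>K'. p i * (?d i j - (\<Sum>k\<in>K. M i k * R k j)))"
        using Z K' by (simp add: sum.Plus)
      also have "\<dots> = p j"
        by (simp only: 1 right_diff_distrib sum_subtractf delta[OF j]) simp
      finally show "p j = (\<Sum>i\<in>Z <+> K'. case_sum a p i * ?\<tau> i j)" by simp
    qed
  qed
qed

context content_basis
begin

text \<open>
  After reduction by the S-pair vectors the combination is in normal form, so its coefficients inherit
  divisibility by \<open>c\<close>. Cancelling \<open>c\<close> leaves an error in the annihilator of \<open>c\<close>, which is the last summand.
\<close>

lemma relation_cancel:
  assumes e: "\<And>x. c * x = 0 \<longleftrightarrow> e dvd x"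
    and p: "\<And>b. b \<in> B \<Longrightarrow> p b \<in> P" and y: "y \<in> P"
    and eq: "(\<Sum>b\<in>B. p b * f b) = single 0 c * y"
  obtains a u h where "\<And>x y. x \<in> B \<Longrightarrow> y \<in> B \<Longrightarrow> a x y \<in> P" "keys u \<subseteq> L" "h \<in> P"
    "\<And>b. b \<in> B \<Longrightarrow> p b = (\<Sum>x\<in>B. \<Sum>y\<in>B. a x y * \<sigma> x y b) + single 0 c * lin (E b) u"
    "y = (\<Sum>x\<in>B. \<Sum>y\<in>B. a x y * sg x y) + lin F u + single 0 e * h"
proof -
  obtain a u where a: "\<forall>x\<in>B. \<forall>y\<in>B. a x y \<in> P" and u: "keys u \<subseteq> L"
    and p_eq: "\<forall>b\<in>B. p b = (\<Sum>x\<in>B. \<Sum>y\<in>B. a x y * \<sigma> x y b) + lin (E b) u"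
    using vector_reduction[of p, OF p] by blast
  let ?Q = "\<Sum>x\<in>B. \<Sum>y\<in>B. a x y * sg x y"
  have "(\<Sum>b\<in>B. p b * f b) = (\<Sum>b\<in>B. (\<Sum>x\<in>B. \<Sum>y\<in>B. a x y * (\<sigma> x y b * f b)) + lin (E b) u * f b)"
    using p_eq by (intro sum.cong) (auto simp: distrib_right sum_distrib_right mult.assoc)
  also have "\<dots> = (\<Sum>b\<in>B. \<Sum>x\<in>B. \<Sum>y\<in>B. a x y * (\<sigma> x y b * f b)) + lin F u"
    by (simp add: sum.distrib sum_lin_E[OF u])
  also have "(\<Sum>b\<in>B. \<Sum>x\<in>B. \<Sum>y\<in>B. a x y * (\<sigma> x y b * f b)) =
      (\<Sum>x\<in>B. \<Sum>y\<in>B. a x y * (\<Sum>b\<in>B. \<sigma> x y b * f b))"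
    by (subst sum.swap, rule sum.cong[OF refl], subst sum.swap) (simp add: sum_distrib_left)
  also have "\<dots> = single 0 c * ?Q"
    by (simp add: sum_\<sigma> sum_distrib_left mult.left_commute)
  finally have ev: "lin F u + 0 = single 0 c * (y - ?Q)"
    unfolding eq by (simp add: right_diff_distrib)
  have "c dvd lookup (lin F u + 0) \<alpha>" for \<alpha> unfolding ev by simp
  then have "c dvd lookup u \<alpha>" for \<alpha> using normal_form_dvd(1)[of u 0 c \<alpha>] u by simp
  then obtain u' where u': "u = single 0 c * u'" "keys u' \<subseteq> keys u" using const_dvdE by metis
  let ?R = "y - ?Q - lin F u'"
  have "single 0 c * ?R = 0" using ev by (simp add: u'(1) lin_const right_diff_distrib)
  then have "lookup (single 0 c * ?R) \<alpha> = 0" for \<alpha> by (simp only: lookup_zero)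
  then have "e dvd lookup ?R \<alpha>" for \<alpha> unfolding lookup_const_mult e .
  then obtain h where h: "?R = single 0 e * h" "keys h \<subseteq> keys ?R"
    by (rule const_dvdE)
  have "?R \<in> P"
    using F_P u u'(2) a sg G homog_P y
    by (intro poly_ring_diff poly_ring_sum poly_ring_mult lin_poly_ring) blast+
  then have hP: "h \<in> P" using h(2) by (auto simp: poly_ring_def)
  have "y = ?Q + lin F u' + ?R" by simp
  then have "y = ?Q + lin F u' + single 0 e * h" unfolding h(1) .
  moreover have "p b = (\<Sum>x\<in>B. \<Sum>y\<in>B. a x y * \<sigma> x y b) + single 0 c * lin (E b) u'" if "b \<in> B" for b
    using p_eq that by (simp add: u'(1) lin_const)
  ultimately show thesis using that[of a u' h] a u u'(2) hP by blast
qed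

text \<open>
  A relation between the \<open>f\<^sub>b\<close> and the \<open>c g\<close> reduces, modulo the S-pair relations, to a relation all of
  whose \<open>f\<close>-coefficients are divisible by \<open>c\<close>. After cancelling \<open>c\<close> it becomes a relation of \<open>(J : c)\<close>.
\<close>

lemma syz_fg_step:
  assumes e: "\<And>x. c * x = 0 \<longleftrightarrow> e dvd x"
    and IH: "syz_fg N (B <+> (G <+> {()})) (case_sum f (case_sum (\<lambda>g. g) (\<lambda>_. single 0 e)))"
  shows "syz_fg N (B <+> G) (case_sum f (\<lambda>g. single 0 c * g))"
proof -
  let ?h1 = "case_sum f (case_sum (\<lambda>g. g) (\<lambda>_. single 0 e))"
  let ?h0 = "case_sum f (\<lambda>g. single 0 c * g)"
  obtain Z where Z: "finite Z" "\<And>\<tau> k. \<tau> \<in> Z \<Longrightarrow> k \<in> B <+> (G <+> {()}) \<Longrightarrow> \<tau> k \<in> P"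
    "\<And>\<tau>. \<tau> \<in> Z \<Longrightarrow> (\<Sum>k\<in>B <+> (G <+> {()}). \<tau> k * ?h1 k) = 0"
    "\<And>p. \<forall>k\<in>B <+> (G <+> {()}). p k \<in> P \<Longrightarrow> (\<Sum>k\<in>B <+> (G <+> {()}). p k * ?h1 k) = 0 \<Longrightarrow>
        (\<exists>a. (\<forall>\<tau>\<in>Z. a \<tau> \<in> P) \<and> (\<forall>k\<in>B <+> (G <+> {()}). p k = (\<Sum>\<tau>\<in>Z. a \<tau> * \<tau> k)))"
    using IH by (rule syz_fgE) (rule that)
  have sum1: "(\<Sum>k\<in>B <+> (G <+> {()}). q k * ?h1 k) =
      (\<Sum>b\<in>B. q (Inl b) * f b) + (\<Sum>g\<in>G. q (Inr (Inl g)) * g) + q (Inr (Inr ())) * single 0 e" for q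
    using B G by (simp add: sum.Plus add.assoc)
  have sum0: "(\<Sum>k\<in>B <+> G. q k * ?h0 k) =
      (\<Sum>b\<in>B. q (Inl b) * f b) + single 0 c * (\<Sum>g\<in>G. q (Inr g) * g)" for q
    using B G by (simp add: sum.Plus sum_distrib_left mult.left_commute)
  have ce: "c * e = 0" using e[of e] by simp
  let ?\<tau> = "case_sum (\<lambda>(x, y). case_sum (\<sigma> x y) (\<lambda>g. if g = sg x y then - single 0 1 else 0))
    (\<lambda>t. case_sum (\<lambda>b. single 0 c * t (Inl b)) (\<lambda>g. t (Inr (Inl g))))"
  have pick: "(\<Sum>g\<in>G. (if g = h then - single 0 1 else 0) * g) = - h" if "h \<in> G" for h :: "'a mpoly"
  proof -
    have "(\<Sum>g\<in>G. (if g = h then - single 0 1 else 0) * g) = (\<Sum>g\<in>G. if g = h then - g else 0)"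
      by (rule sum.cong) auto
    then show ?thesis using that G by simp
  qed
  have ZP: "\<tau> (Inl b) \<in> P" if "\<tau> \<in> Z" "b \<in> B" for \<tau> b using Z(2)[OF that(1)] that(2) by blast
  have ZP': "\<tau> (Inr (Inl g)) \<in> P" if "\<tau> \<in> Z" "g \<in> G" for \<tau> g using Z(2)[OF that(1)] that(2) by blast
  show ?thesis
  proof (rule syz_fgI[where I = "(B \<times> B) <+> Z" and \<tau> = ?\<tau>])
    show "finite ((B \<times> B) <+> Z)" using B Z by simp
    show "?\<tau> i k \<in> P" if "i \<in> (B \<times> B) <+> Z" "k \<in> B <+> G" for i k
      using that ZP ZP' \<sigma>_P by (auto intro!: poly_ring_mult poly_ring_uminus)
    show "(\<Sum>k\<in>B <+> G. ?\<tau> i k * ?h0 k) = 0" if i: "i \<in> (B \<times> B) <+> Z" for i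
    proof (cases i)
      case (Inl xy)
      then obtain x y where xy: "xy = (x, y)" "x \<in> B" "y \<in> B" using i by auto
      then show ?thesis
        unfolding sum0 using Inl sum_\<sigma>[OF xy(2,3)] pick[OF sg[OF xy(2,3)]] by simp
    next
      case (Inr t)
      then have t: "t \<in> Z" using i by auto
      have "(\<Sum>b\<in>B. t (Inl b) * f b) + (\<Sum>g\<in>G. t (Inr (Inl g)) * g) = - (t (Inr (Inr ())) * single 0 e)"
        using Z(3)[OF t] unfolding sum1 by (simp add: eq_neg_iff_add_eq_0)
      moreover have "(\<Sum>k\<in>B <+> G. ?\<tau> i k * ?h0 k) =
          single 0 c * ((\<Sum>b\<in>B. t (Inl b) * f b) + (\<Sum>g\<in>G. t (Inr (Inl g)) * g))"
        unfolding sum0 using Inr by (simp add: distrib_left sum_distrib_left mult.assoc)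
      moreover have "single 0 c * (x * single 0 e) = 0" for x :: "'a mpoly"
        by (subst mult.left_commute) (simp add: mult_single ce)
      ultimately show ?thesis by simp
    qed
    fix p assume pP: "\<forall>k\<in>B <+> G. p k \<in> P" and p0: "(\<Sum>k\<in>B <+> G. p k * ?h0 k) = 0"
    have pB: "p (Inl b) \<in> P" if "b \<in> B" for b using pP that by auto
    have pG: "p (Inr g) \<in> P" if "g \<in> G" for g using pP that by auto
    let ?y = "- (\<Sum>g\<in>G. p (Inr g) * g)"
    have "(\<Sum>b\<in>B. p (Inl b) * f b) = single 0 c * ?y"
      using p0 unfolding sum0 by (simp only: mult_minus_right eq_neg_iff_add_eq_0)
    moreover have "?y \<in> P"
      using pG G homog_P by (intro poly_ring_uminus poly_ring_sum poly_ring_mult) blast+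
    ultimately obtain a u h where a: "\<And>x y. x \<in> B \<Longrightarrow> y \<in> B \<Longrightarrow> a x y \<in> P"
      and u: "keys u \<subseteq> L" and hP: "h \<in> P"
      and eq: "\<And>b. b \<in> B \<Longrightarrow> p (Inl b) = (\<Sum>x\<in>B. \<Sum>y\<in>B. a x y * \<sigma> x y b) + single 0 c * lin (E b) u"
      and h: "?y = (\<Sum>x\<in>B. \<Sum>y\<in>B. a x y * sg x y) + lin F u + single 0 e * h"
      using relation_cancel[OF e, of "\<lambda>b. p (Inl b)" ?y thesis, OF pB] by blast
    let ?q = "case_sum (\<lambda>b. lin (E b) u) (case_sum
      (\<lambda>g. p (Inr g) + (\<Sum>x\<in>B. \<Sum>y\<in>B. if sg x y = g then a x y else 0)) (\<lambda>_. h))"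
    have EP: "E x \<alpha> \<in> P" if "\<alpha> \<in> keys u" for x \<alpha>
      using E_P[OF L_monoms] u that by blast
    have qP: "\<forall>k\<in>B <+> (G <+> {()}). ?q k \<in> P"
      using EP a pG hP
      by (auto intro!: lin_poly_ring poly_ring_add poly_ring_sum poly_ring_uminus)
    have "(\<Sum>g\<in>G. (\<Sum>x\<in>B. \<Sum>y\<in>B. if sg x y = g then a x y else 0) * g) =
        (\<Sum>x\<in>B. \<Sum>y\<in>B. \<Sum>g\<in>G. if sg x y = g then a x y * g else 0)"
      unfolding sum_distrib_right
      by (subst sum.swap, rule sum.cong[OF refl], subst sum.swap, intro sum.cong refl) simp
    also have "\<dots> = (\<Sum>x\<in>B. \<Sum>y\<in>B. a x y * sg x y)"
      using sg G by (intro sum.cong refl) simp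
    finally have "(\<Sum>k\<in>B <+> (G <+> {()}). ?q k * ?h1 k) =
        ((\<Sum>x\<in>B. \<Sum>y\<in>B. a x y * sg x y) + lin F u + single 0 e * h) - ?y"
      unfolding sum1 using sum_lin_E[of u] u
      by (simp add: distrib_right sum.distrib mult.commute[of h])
    also have "\<dots> = 0" unfolding h[symmetric] by simp
    finally obtain a' where a': "\<forall>t\<in>Z. a' t \<in> P"
      "\<forall>k\<in>B <+> (G <+> {()}). ?q k = (\<Sum>t\<in>Z. a' t * t k)" using Z(4)[OF qP] by blast
    show "\<exists>a. (\<forall>i\<in>(B \<times> B) <+> Z. a i \<in> P) \<and>
        (\<forall>k\<in>B <+> G. p k = (\<Sum>i\<in>(B \<times> B) <+> Z. a i * ?\<tau> i k))"
    proof (intro exI[of _ "case_sum (\<lambda>(x, y). a x y) a'"] conjI ballI)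
      show "case_sum (\<lambda>(x, y). a x y) a' i \<in> P" if "i \<in> (B \<times> B) <+> Z" for i
        using that a a' by auto
      fix k assume k: "k \<in> B <+> G"
      have split: "(\<Sum>i\<in>(B \<times> B) <+> Z. case_sum (\<lambda>(x, y). a x y) a' i * ?\<tau> i k) =
          (\<Sum>x\<in>B. \<Sum>y\<in>B. a x y * ?\<tau> (Inl (x, y)) k) + (\<Sum>t\<in>Z. a' t * ?\<tau> (Inr t) k)"
        using B Z by (simp add: sum.Plus sum.cartesian_product split_def)
      show "p k = (\<Sum>i\<in>(B \<times> B) <+> Z. case_sum (\<lambda>(x, y). a x y) a' i * ?\<tau> i k)"
      proof (cases k)
        case (Inl b)
        then have b: "b \<in> B" using k by auto
        have "(\<Sum>t\<in>Z. a' t * ?\<tau> (Inr t) k) = single 0 c * (\<Sum>t\<in>Z. a' t * t (Inl b))"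
          using Inl by (simp add: sum_distrib_left mult.left_commute)
        also have "\<dots> = single 0 c * lin (E b) u"
          using bspec[OF a'(2) InlI[OF b]] by simp
        finally have 1: "(\<Sum>t\<in>Z. a' t * ?\<tau> (Inr t) k) = single 0 c * lin (E b) u" .
        have "p k = (\<Sum>x\<in>B. \<Sum>y\<in>B. a x y * ?\<tau> (Inl (x, y)) k) + single 0 c * lin (E b) u"
          using eq b Inl by simp
        then show ?thesis using split unfolding 1 by (rule trans[OF _ sym])
      next
        case (Inr g)
        then have g: "g \<in> G" using k by auto
        have 1: "(\<Sum>t\<in>Z. a' t * ?\<tau> (Inr t) k) =
            p (Inr g) + (\<Sum>x\<in>B. \<Sum>y\<in>B. if sg x y = g then a x y else 0)"
          using bspec[OF a'(2) InrI[OF InlI[OF g]]] Inr by simp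
        have "(\<Sum>x\<in>B. \<Sum>y\<in>B. a x y * ?\<tau> (Inl (x, y)) k) =
            (\<Sum>x\<in>B. \<Sum>y\<in>B. - (if sg x y = g then a x y else 0))"
          using Inr by (intro sum.cong refl) (auto simp: mult.commute)
        also have "\<dots> = - (\<Sum>x\<in>B. \<Sum>y\<in>B. if sg x y = g then a x y else 0)"
          by (simp add: sum_negf)
        finally have "p k = (\<Sum>x\<in>B. \<Sum>y\<in>B. a x y * ?\<tau> (Inl (x, y)) k) +
            (p (Inr g) + (\<Sum>x\<in>B. \<Sum>y\<in>B. if sg x y = g then a x y else 0))"
          using Inr by simp
        then show ?thesis using split unfolding 1 by (rule trans[OF _ sym])
      qed
    qed
  qed
qed

end

context graded_polynomials
begin

text \<open>
  In the induction, the hypothesis on \<open>(J : c)\<close> is transferred to the generators that the step needs.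
\<close>

lemma syz_fg_homog:
  assumes K: "finite K" "\<And>k. k \<in> K \<Longrightarrow> homog (h k)"
  shows "syz_fg N K h"
proof -
  let ?\<Phi> = "\<lambda>J. \<exists>H. finite H \<and> H \<subseteq> P \<and> gen H = J \<and> syz_fg N H (\<lambda>x. x)"
  have "?\<Phi> (gen (h ` K))"
  proof (rule content_induct)
    fix B f c G su sg e
    assume cb: "content_basis V N gam less B f c G su sg" and e: "\<And>x. c * x = 0 \<longleftrightarrow> e dvd x"
      and IH: "c \<noteq> 0 \<Longrightarrow> nonunit c \<and> ?\<Phi> (gen (f ` B \<union> G \<union> {single 0 e}))"
    interpret content_basis V N gam less B f c G su sg by (rule cb)
    let ?h1 = "case_sum f (case_sum (\<lambda>g. g) (\<lambda>_::unit. single 0 e))"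
    let ?h0 = "case_sum f (\<lambda>g. single 0 c * g)"
    let ?K1 = "B <+> (G <+> {()})"
    have im1: "?h1 ` ?K1 = f ` B \<union> G \<union> {single 0 e}"
      unfolding Plus_def image_Un image_image by auto
    have im0: "?h0 ` (B <+> G) = f ` B \<union> (\<lambda>g. single 0 c * g) ` G"
      unfolding Plus_def image_Un image_image by simp
    have P1: "?h1 ` ?K1 \<subseteq> P" unfolding im1 using f_P G homog_P by auto
    have P0: "?h0 ` (B <+> G) \<subseteq> P" unfolding im0 by (rule gens_P)
    have fin: "finite ?K1" "finite (B <+> G)" using B G by auto
    have syz1: "syz_fg N ?K1 ?h1"
    proof (cases "c = 0")
      case False
      then obtain H where H: "finite H" "H \<subseteq> P" "gen H = gen (?h1 ` ?K1)" "syz_fg N H (\<lambda>x. x)"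
        using IH unfolding im1 by blast
      show ?thesis
        by (rule syz_fg_transfer[of H "\<lambda>x. x" N ?K1 ?h1]) (use H fin P1 in auto)
    next
      case True
      \<comment> \<open>Here \<open>e\<close> is a unit, so the ideal is the unit ideal, whose single generator has no relations.\<close>
      then have "e dvd 1" using e[of 1] by simp
      then obtain i where i: "1 = e * i" by (rule dvdE)
      let ?one = "single 0 (1::'a) :: 'a mpoly"
      have "syz_fg N {()} (\<lambda>_. ?one)"
        by (rule syz_fgI[where I = "{}" and \<tau> = "\<lambda>_ _. 0"]) auto
      moreover have "gen ((\<lambda>_. ?one) ` {()}) = gen (?h1 ` ?K1)"
      proof (rule ideal_generated_eqI[OF unital_poly_ring _ P1])
        note I1 = ideal_generated_is_ideal[OF unital_poly_ring P1]
        have "single 0 e \<in> gen (?h1 ` ?K1)"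
          using ideal_generated_superset[of "?h1 ` ?K1" P] unfolding im1 by auto
        from is_idealD(4)[OF I1 poly_ring_const this, of i]
        show "(\<lambda>_. ?one) ` {()} \<subseteq> gen (?h1 ` ?K1)" using i by (simp add: mult_single mult.commute)
        have sub: "(\<lambda>_. ?one) ` {()} \<subseteq> P" by auto
        note I2 = ideal_generated_is_ideal[OF unital_poly_ring sub]
        have "x \<in> gen ((\<lambda>_. ?one) ` {()})" if "x \<in> P" for x
          using is_idealD(4)[OF I2 that, of ?one] ideal_generated_superset[of "(\<lambda>_. ?one) ` {()}" P]
          by simp
        then show "?h1 ` ?K1 \<subseteq> gen ((\<lambda>_. ?one) ` {()})" using P1 by blast
      qed auto
      ultimately show ?thesis using syz_fg_transfer[of "{()}" "\<lambda>_. ?one" N ?K1 ?h1] fin P1 by auto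
    qed
    have "syz_fg N (B <+> G) ?h0" by (rule syz_fg_step[OF e syz1])
    then have "syz_fg N (?h0 ` (B <+> G)) (\<lambda>x. x)"
      using syz_fg_transfer[of "B <+> G" ?h0 N "?h0 ` (B <+> G)" "\<lambda>x. x"] fin P0 by auto
    then show "?\<Phi> (gen (f ` B \<union> (\<lambda>g. single 0 c * g) ` G))"
      unfolding im0[symmetric] using fin P0 by blast
  qed (use K in auto)
  then obtain H where H: "finite H" "H \<subseteq> P" "gen H = gen (h ` K)" "syz_fg N H (\<lambda>x. x)" by blast
  show ?thesis
    by (rule syz_fg_transfer[of H "\<lambda>x. x" N K h]) (use H K homog_P in auto)
qed

lemma colon_fg:
  assumes H: "finite H" "\<And>h. h \<in> H \<Longrightarrow> homog h" and t: "t \<in> monoms N"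
  shows "finitely_generated_ideal P {q\<in>P. single t 1 * q \<in> gen H}"
proof -
  let ?h = "\<lambda>k. case k of None \<Rightarrow> single t 1 | Some x \<Rightarrow> x"
  let ?K = "insert None (Some ` H)"
  have HP: "H \<subseteq> P" using H homog_P by blast
  have "homog (single t 1)" using hom_single[OF t, of 1] unfolding homog_def by blast
  then have "syz_fg N ?K ?h"
    by (intro syz_fg_homog) (use H in auto)
  then obtain Z where Z: "finite Z" "\<And>\<tau> k. \<tau> \<in> Z \<Longrightarrow> k \<in> ?K \<Longrightarrow> \<tau> k \<in> P"
    "\<And>\<tau>. \<tau> \<in> Z \<Longrightarrow> (\<Sum>k\<in>?K. \<tau> k * ?h k) = 0"
    "\<And>p. \<forall>k\<in>?K. p k \<in> P \<Longrightarrow> (\<Sum>k\<in>?K. p k * ?h k) = 0 \<Longrightarrow>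
        (\<exists>a. (\<forall>\<tau>\<in>Z. a \<tau> \<in> P) \<and> (\<forall>k\<in>?K. p k = (\<Sum>\<tau>\<in>Z. a \<tau> * \<tau> k)))"
    by (rule syz_fgE) (rule that)
  have sumK: "(\<Sum>k\<in>?K. p k * ?h k) = p None * single t 1 + (\<Sum>x\<in>H. p (Some x) * x)" for p
    using H(1) by (simp add: sum.reindex)
  have memH: "x \<in> gen H \<longleftrightarrow> (\<exists>p. (\<forall>k\<in>H. p k \<in> P) \<and> x = (\<Sum>k\<in>H. p k * k))" for x
    using ideal_generated_family[OF unital_poly_ring H(1), of "\<lambda>x. x" N x] HP by simp
  let ?S = "(\<lambda>\<tau>. \<tau> None) ` Z"
  have SP: "?S \<subseteq> P" using Z(2) by blast
  have "{q\<in>P. single t 1 * q \<in> gen H} = gen ?S"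
  proof (intro equalityI subsetI)
    fix q assume q: "q \<in> {q\<in>P. single t 1 * q \<in> gen H}"
    then obtain p where p: "\<forall>k\<in>H. p k \<in> P" "single t 1 * q = (\<Sum>k\<in>H. p k * k)" using memH by blast
    let ?p = "\<lambda>k. case k of None \<Rightarrow> q | Some x \<Rightarrow> - p x"
    have "(\<Sum>k\<in>?K. ?p k * ?h k) = 0"
      unfolding sumK using p(2) by (simp add: sum_negf mult.commute)
    moreover have "\<forall>k\<in>?K. ?p k \<in> P" using p(1) q by (auto intro: poly_ring_uminus)
    ultimately obtain a where "\<forall>\<tau>\<in>Z. a \<tau> \<in> P" "\<forall>k\<in>?K. ?p k = (\<Sum>\<tau>\<in>Z. a \<tau> * \<tau> k)"
      using Z(4)[of ?p] by blast
    then show "q \<in> gen ?S"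
      using ideal_generated_family[OF unital_poly_ring Z(1) SP, of q] by auto
  next
    fix q assume "q \<in> gen ?S"
    then obtain a where a: "\<forall>\<tau>\<in>Z. a \<tau> \<in> P" "q = (\<Sum>\<tau>\<in>Z. a \<tau> * \<tau> None)"
      using ideal_generated_family[OF unital_poly_ring Z(1) SP, of q] by auto
    have qP: "q \<in> P" using a Z(2) by (auto intro!: poly_ring_sum poly_ring_mult)
    note I = ideal_generated_is_ideal[OF unital_poly_ring HP]
    have "single t 1 * \<tau> None \<in> gen H" if "\<tau> \<in> Z" for \<tau>
    proof -
      have "single t 1 * \<tau> None = (\<Sum>x\<in>H. (- \<tau> (Some x)) * x)"
        using Z(3)[OF that] unfolding sumK by (simp add: sum_negf eq_neg_iff_add_eq_0 mult.commute)
      then show ?thesis unfolding memH using Z(2)[OF that] by (auto intro!: exI[of _ "\<lambda>x. - \<tau> (Some x)"] poly_ring_uminus)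
    qed
    then have "a \<tau> * (single t 1 * \<tau> None) \<in> gen H" if "\<tau> \<in> Z" for \<tau>
      using a(1) that is_idealD(4)[OF I] by blast
    then have "(\<Sum>\<tau>\<in>Z. a \<tau> * (single t 1 * \<tau> None)) \<in> gen H"
      by (rule is_ideal_sum[OF I])
    then show "q \<in> {q\<in>P. single t 1 * q \<in> gen H}"
      using qP a(2) by (simp add: sum_distrib_left mult.left_commute)
  qed
  then show ?thesis unfolding finitely_generated_ideal_def using Z(1) SP by blast
qed

end

section \<open>Saturation with respect to a variable\<close>

lemma monom_factor:
  fixes f :: "'a::{comm_ring, comm_monoid_mult} mpoly"
  assumes "\<And>\<beta>. \<beta> \<in> keys f \<Longrightarrow> monom_dvd \<gamma> \<beta>"
  obtains g where "f = single \<gamma> 1 * g" "keys g \<subseteq> (\<lambda>\<beta>. \<beta> - \<gamma>) ` keys f"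
proof -
  let ?g = "\<Sum>\<beta>\<in>keys f. single (\<beta> - \<gamma>) (lookup f \<beta>)"
  have "single \<gamma> 1 * ?g = (\<Sum>\<beta>\<in>keys f. single \<beta> (lookup f \<beta>))"
    unfolding sum_distrib_left using assms by (intro sum.cong) (auto simp: mult_single monom_dvd_diff)
  then have "f = single \<gamma> 1 * ?g" by (simp flip: poly_sum_singles)
  moreover have "keys ?g \<subseteq> (\<lambda>\<beta>. \<beta> - \<gamma>) ` keys f"
    using keys_sum_subset[of "\<lambda>\<beta>. single (\<beta> - \<gamma>) (lookup f \<beta>)" "keys f"] by (auto split: if_splits)
  ultimately show thesis using that by blast
qed

locale saturation = graded_polynomials V N gam less
  for V :: "'a::{comm_ring, comm_monoid_mult} itself" and N and gam :: "monom \<Rightarrow> 'g" and less +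
  fixes t :: nat
  assumes t: "t < N"
    and revlex: "lookup \<alpha> t < lookup \<beta> t \<Longrightarrow> less \<beta> \<alpha>"
    and arch: "nonunit (a::'a) \<Longrightarrow> nonunit b \<Longrightarrow> a \<noteq> 0 \<Longrightarrow> b \<noteq> 0 \<Longrightarrow> \<exists>k. a dvd b ^ k"
begin

definition T :: "nat \<Rightarrow> 'a mpoly" where
  "T j = single (Poly_Mapping.single t j) 1"

lemma t_monom: "Poly_Mapping.single t j \<in> monoms N"
  using t by (auto simp: monoms_def)

lemma T_P: "T j \<in> P" unfolding T_def by (intro poly_ring_single t_monom)

lemma T_add: "T (i + j) = T i * T j"
  by (simp add: T_def mult_single single_add)

lemma T_0: "T 0 * x = x" by (simp add: T_def)

definition sat :: "'a mpoly set \<Rightarrow> 'a mpoly set" where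
  "sat J = {z\<in>P. \<exists>j. T j * z \<in> J}"

lemma T_mono: "is_ideal P J \<Longrightarrow> T j * z \<in> J \<Longrightarrow> j \<le> k \<Longrightarrow> T k * z \<in> J"
  using is_idealD(4)[of P J "T (k - j)" "T j * z"] T_P T_add[of "k - j" j]
  by (simp add: mult.assoc)

lemma sat_ideal: "is_ideal P J \<Longrightarrow> is_ideal P (sat J)"
proof -
  assume J: "is_ideal P J"
  show ?thesis
    unfolding is_ideal_def
  proof (intro conjI ballI)
    show "sat J \<subseteq> P" by (auto simp: sat_def)
    show "0 \<in> sat J" using is_idealD(2)[OF J] by (simp add: sat_def)
    fix x assume "x \<in> sat J"
    then obtain i where x: "x \<in> P" "T i * x \<in> J" by (auto simp: sat_def)
    { fix y assume "y \<in> sat J"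
      then obtain j where y: "y \<in> P" "T j * y \<in> J" by (auto simp: sat_def)
      have "T (max i j) * x + T (max i j) * y \<in> J"
        using T_mono[OF J x(2), of "max i j"] T_mono[OF J y(2), of "max i j"] is_idealD(3)[OF J] by simp
      then show "x + y \<in> sat J" using x y unfolding sat_def
        by (auto simp: distrib_left poly_ring_add) }
    { fix r assume r: "r \<in> P"
      have "r * (T i * x) \<in> J" by (rule is_idealD(4)[OF J r x(2)])
      then show "r * x \<in> sat J" using x r unfolding sat_def
        by (auto simp: poly_ring_mult mult.left_commute) }
  qed
qed

lemma restrict_single_mult:
  "restrict {\<kappa>. gam \<kappa> = gam (\<gamma> + \<alpha>)} (single \<gamma> 1 * z) = single \<gamma> 1 * restrict {\<kappa>. gam \<kappa> = gam \<alpha>} z"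
  for z :: "'a mpoly"
proof (rule poly_mapping_eqI)
  fix \<kappa>
  show "lookup (restrict {\<kappa>. gam \<kappa> = gam (\<gamma> + \<alpha>)} (single \<gamma> 1 * z)) \<kappa> =
      lookup (single \<gamma> 1 * restrict {\<kappa>. gam \<kappa> = gam \<alpha>} z) \<kappa>"
  proof (cases "monom_dvd \<gamma> \<kappa>")
    case True
    then have "gam \<kappa> = gam (\<gamma> + \<alpha>) \<longleftrightarrow> gam (\<kappa> - \<gamma>) = gam \<alpha>"
      using gam_add[of \<gamma> "\<kappa> - \<gamma>" \<alpha>] by (simp add: monom_dvd_diff)
    then show ?thesis using True by (simp add: lookup_single_mult')
  qed (simp add: lookup_single_mult')
qed

lemma sat_component:
  assumes J: "is_ideal P J" "\<And>f g. f \<in> J \<Longrightarrow> restrict {\<alpha>. gam \<alpha> = g} f \<in> J" and z: "z \<in> sat J"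
  shows "restrict {\<alpha>. gam \<alpha> = g} z \<in> sat J"
proof (cases "\<exists>\<alpha>\<in>keys z. gam \<alpha> = g")
  case True
  then obtain \<alpha> where "gam \<alpha> = g" by blast
  obtain j where j: "z \<in> P" "T j * z \<in> J" using z by (auto simp: sat_def)
  have "T j * restrict {\<alpha>. gam \<alpha> = g} z \<in> J"
    using J(2)[OF j(2), of "gam (Poly_Mapping.single t j + \<alpha>)"]
    unfolding T_def restrict_single_mult \<open>gam \<alpha> = g\<close> .
  then show ?thesis using restrict_poly_ring[OF j(1)] by (auto simp: sat_def)
next
  case False
  then have "restrict {\<alpha>. gam \<alpha> = g} z = 0" by (intro restrict_empty) auto
  then show ?thesis using is_idealD(2)[OF sat_ideal[OF J(1)]] by simp
qed

text \<open>
  If the quotient by \<open>J\<close> has no constant torsion, then bounded \<open>T\<close>-torsion holds for the same reason as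
  over a field: Dickson's lemma provides finitely many elements of the saturation whose leading
  monomials divide all others, and division by them only introduces constant denominators.
\<close>

lemma sat_bounded_torsion_free:
  assumes J: "is_ideal P J" "\<And>f g. f \<in> J \<Longrightarrow> restrict {\<alpha>. gam \<alpha> = g} f \<in> J"
    and tf: "\<And>a z. a \<noteq> 0 \<Longrightarrow> z \<in> P \<Longrightarrow> single 0 a * z \<in> J \<Longrightarrow> z \<in> J"
  shows "\<exists>n. \<forall>z\<in>sat J. T n * z \<in> J"
proof -
  let ?lm = "\<lambda>h \<alpha>. \<alpha> \<in> keys h \<and> (\<forall>\<beta>\<in>keys h. \<beta> = \<alpha> \<or> less \<beta> \<alpha>)"
  let ?S = "{\<alpha>. \<exists>h\<in>sat J. homog h \<and> ?lm h \<alpha>}"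
  note SI = sat_ideal[OF J(1)]
  have "?S \<subseteq> monoms N" using homog_P poly_ringD by blast
  from dickson[OF this] obtain B where B: "finite B" "B \<subseteq> ?S" "\<forall>\<alpha>\<in>?S. \<exists>\<beta>\<in>B. monom_dvd \<beta> \<alpha>"
    by blast
  have "\<forall>b\<in>B. \<exists>h. h \<in> sat J \<and> homog h \<and> ?lm h b" using B(2) by blast
  from bchoice[OF this] obtain h where h: "\<forall>b\<in>B. h b \<in> sat J \<and> homog (h b) \<and> ?lm (h b) b" by blast
  have "\<forall>b\<in>B. \<exists>j. T j * h b \<in> J" using h by (auto simp: sat_def)
  from bchoice[OF this] obtain j where j: "\<forall>b\<in>B. T (j b) * h b \<in> J" by blast
  define n where "n = Max (insert 0 (j ` B))"
  have n: "T n * h b \<in> J" if "b \<in> B" for b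
  proof (rule T_mono[OF J(1)])
    show "T (j b) * h b \<in> J" using j that by blast
    show "j b \<le> n" unfolding n_def using B(1) that by (intro Max_ge) auto
  qed
  have hom_case: "T n * z \<in> J" if "z \<in> sat J" "hom g z" for z g
    using that
  proof (induction "card {\<beta>\<in>fiber g. \<exists>\<kappa>\<in>keys z. \<beta> = \<kappa> \<or> less \<beta> \<kappa>}" arbitrary: z rule: less_induct)
    case less
    show ?case
    proof (cases "z = 0")
      case True
      then show ?thesis using is_idealD(2)[OF J(1)] by simp
    next
      case False
      then obtain \<alpha> where a: "?lm z \<alpha>" using finite_has_max[of "keys z"] keys_eq_empty[of z] by auto
      have "\<alpha> \<in> ?S" using less.prems a unfolding homog_def by blast
      then obtain b where b: "b \<in> B" "monom_dvd b \<alpha>" using B(3) by blast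
      have hb: "h b \<in> sat J" "homog (h b)" "?lm (h b) b" using h b(1) by auto
      have \<alpha>N: "\<alpha> \<in> monoms N" "gam \<alpha> = g" using a less.prems(2) by (auto simp: hom_def fiber_def)
      have eq: "\<alpha> - b + b = \<alpha>" using monom_dvd_diff[OF b(2)] by (simp add: add.commute)
      define c d where "c = lookup (h b) b" and "d = lookup z \<alpha>"
      have c0: "c \<noteq> 0" using hb(3) by (simp add: c_def in_keys_iff)
      let ?m = "single (\<alpha> - b) d * h b"
      have mP: "single (\<alpha> - b) d \<in> P" using \<alpha>N by (simp add: poly_ring_single)
      obtain g' where "hom g' (h b)" using hb(2) by (auto simp: homog_def)
      then have "hom (gam b) (h b)" using hb(3) by (auto simp: hom_def fiber_def)
      then have mh: "hom g ?m" using hom_single_mult[of b "h b" "\<alpha> - b" d] \<alpha>N eq by simp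
      define z' where "z' = single 0 c * z - ?m"
      have z'S: "z' \<in> sat J" unfolding z'_def
        by (intro is_ideal_diff[OF unital_poly_ring SI] is_idealD(4)[OF SI] mP hb(1) less.prems(1)) simp
      have z'h: "hom g z'" unfolding z'_def by (intro hom_diff hom_const mh less.prems(2))
      have low: "less \<beta> \<alpha>" if be: "\<beta> \<in> keys z'" for \<beta>
      proof -
        have "lookup ?m \<alpha> = d * c"
          using lookup_single_mult[of "\<alpha> - b" d "h b" b] eq by (simp add: c_def)
        then have "lookup z' \<alpha> = 0"
          by (simp add: z'_def lookup_minus d_def[symmetric] mult.commute[of c])
        then have "\<beta> \<noteq> \<alpha>" using be by (auto simp: in_keys_iff)
        have "\<beta> \<in> keys z \<or> \<beta> \<in> keys ?m"
          using be by (auto simp: z'_def in_keys_iff lookup_minus)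
        then show ?thesis
        proof
          assume "\<beta> \<in> keys z" then show ?thesis using a \<open>\<beta> \<noteq> \<alpha>\<close> by blast
        next
          assume "\<beta> \<in> keys ?m"
          then obtain \<kappa> where k: "\<kappa> \<in> keys (h b)" "\<beta> = \<alpha> - b + \<kappa>" using keys_single_mult by blast
          then have "\<kappa> = b \<or> less \<kappa> b" using hb(3) by blast
          then show ?thesis using less_add[of \<kappa> b "\<alpha> - b"] k(2) eq \<open>\<beta> \<noteq> \<alpha>\<close> by auto
        qed
      qed
      have "{\<beta>\<in>fiber g. \<exists>\<kappa>\<in>keys z'. \<beta> = \<kappa> \<or> less \<beta> \<kappa>} \<subseteq> {\<beta>\<in>fiber g. \<exists>\<kappa>\<in>keys z. \<beta> = \<kappa> \<or> less \<beta> \<kappa>} - {\<alpha>}"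
      proof
        fix \<beta> assume "\<beta> \<in> {\<beta>\<in>fiber g. \<exists>\<kappa>\<in>keys z'. \<beta> = \<kappa> \<or> less \<beta> \<kappa>}"
        then have "\<beta> \<in> fiber g" "less \<beta> \<alpha>" using low less_trans by blast+
        then show "\<beta> \<in> {\<beta>\<in>fiber g. \<exists>\<kappa>\<in>keys z. \<beta> = \<kappa> \<or> less \<beta> \<kappa>} - {\<alpha>}"
          using a less_irrefl by blast
      qed
      moreover have "\<alpha> \<in> {\<beta>\<in>fiber g. \<exists>\<kappa>\<in>keys z. \<beta> = \<kappa> \<or> less \<beta> \<kappa>}"
        using a \<alpha>N by (auto simp: fiber_def)
      ultimately have "{\<beta>\<in>fiber g. \<exists>\<kappa>\<in>keys z'. \<beta> = \<kappa> \<or> less \<beta> \<kappa>} \<subset> {\<beta>\<in>fiber g. \<exists>\<kappa>\<in>keys z. \<beta> = \<kappa> \<or> less \<beta> \<kappa>}"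
        by blast
      then have "card {\<beta>\<in>fiber g. \<exists>\<kappa>\<in>keys z'. \<beta> = \<kappa> \<or> less \<beta> \<kappa>} < card {\<beta>\<in>fiber g. \<exists>\<kappa>\<in>keys z. \<beta> = \<kappa> \<or> less \<beta> \<kappa>}"
        by (intro psubset_card_mono) (auto simp: finite_fiber)
      then have z'J: "T n * z' \<in> J" by (rule less.hyps[OF _ z'S z'h])
      have "single (\<alpha> - b) d * (T n * h b) \<in> J" by (rule is_idealD(4)[OF J(1) mP n[OF b(1)]])
      then have "T n * z' + single (\<alpha> - b) d * (T n * h b) \<in> J" by (rule is_idealD(3)[OF J(1) z'J])
      moreover have "T n * z' + single (\<alpha> - b) d * (T n * h b) = single 0 c * (T n * z)"
        by (simp add: z'_def right_diff_distrib mult.left_commute)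
      ultimately have "single 0 c * (T n * z) \<in> J" by simp
      moreover have "T n * z \<in> P" using less.prems(1) T_P by (auto simp: sat_def poly_ring_mult)
      ultimately show ?thesis using tf c0 by blast
    qed
  qed
  have "T n * z \<in> J" if z: "z \<in> sat J" for z
  proof -
    have "T n * restrict {\<alpha>. gam \<alpha> = g} z \<in> J" for g
    proof (rule hom_case)
      show "restrict {\<alpha>. gam \<alpha> = g} z \<in> sat J" by (rule sat_component[OF J z])
      show "hom g (restrict {\<alpha>. gam \<alpha> = g} z)"
        using z poly_ringD by (auto simp: hom_def fiber_def sat_def)
    qed
    then have "(\<Sum>g\<in>gam ` keys z. T n * restrict {\<alpha>. gam \<alpha> = g} z) \<in> J"
      by (intro is_ideal_sum[OF J(1)])
    then show ?thesis using sum_components[of z gam] by (simp flip: sum_distrib_left)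
  qed
  then show ?thesis by blast
qed

text \<open>
  If \<open>a b = 0\<close> with \<open>a\<close> and \<open>b\<close> nonzero, then by the archimedean property both divide powers of \<open>d\<close>, so that
  \<open>d\<close> is nilpotent: a valuation ring with zero divisors behaves like its quotients by nonzero constants.
\<close>

lemma power_in_const:
  assumes c: "c \<noteq> 0 \<Longrightarrow> nonunit (c::'a)" "c \<noteq> 0 \<or> (\<exists>a b::'a. a \<noteq> 0 \<and> b \<noteq> 0 \<and> a * b = 0)"
    and d: "nonunit d"
  shows "\<exists>k. c dvd d ^ k"
proof (cases "d = 0")
  case True
  then show ?thesis using dvd_zero_ring[of c] by (intro exI[of _ "Suc 0"]) simp
next
  case False
  show ?thesis
  proof (cases "c = 0")
    case True
    then obtain a b :: 'a where ab: "a \<noteq> 0" "b \<noteq> 0" "a * b = 0" using c(2) by blast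
    have nu: "nonunit x" if xy: "x * y = 0" "y \<noteq> 0" for x y :: 'a
    proof (rule ccontr)
      assume "\<not> nonunit x"
      then obtain i where "x * i = 1" using unit_inverse by blast
      then have "y = i * (x * y)" by (metis mult.assoc mult.commute mult_1)
      then show False using xy by simp
    qed
    obtain k l where "a dvd d ^ k" "b dvd d ^ l"
      using arch[OF _ d ab(1) False] arch[OF _ d ab(2) False] nu[OF ab(3,2)] nu[of b a] ab
      by (metis mult.commute)
    then have "a * b dvd d ^ k * d ^ l" by (rule mult_dvd_mono)
    then show ?thesis using True ab(3) by (intro exI[of _ "k + l"]) (simp add: power_add)
  qed (use arch[OF c(1) d] False in blast)
qed

end

text \<open>
  The flat case modulo \<open>c\<close>, where some power of every nonunit vanishes. With respect to the reverse
  lexicographic order, \<open>f\<^sub>b = T\<^bsup>a\<^esup> h\<^sub>b + \<delta> s\<^sub>b\<close> with a monic \<open>h\<^sub>b\<close> whose leading monomial is free of \<open>T\<close>, and with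
  one nonunit \<open>\<delta>\<close> for all \<open>b\<close>. Dividing by the \<open>h\<^sub>b\<close> shows that a fixed power of \<open>T\<close> moves every element
  of the saturation into \<open>J + cP + \<delta>P\<close>, with the cofactor of \<open>\<delta>\<close> in the same situation; this can be
  iterated until the power of \<open>\<delta>\<close> is divisible by \<open>c\<close>.
\<close>

locale content_saturation = content_basis V N gam less B f c G su sg + saturation V N gam less t
  for V :: "'a::{comm_ring, comm_monoid_mult} itself" and N and gam :: "monom \<Rightarrow> 'g" and less
    and B :: "monom set" and f :: "monom \<Rightarrow> 'a mpoly" and c :: 'a and G :: "'a mpoly set"
    and su sg :: "monom \<Rightarrow> monom \<Rightarrow> 'a mpoly" and t :: nat
begin

definition Jc :: "'a mpoly set" where
  "Jc = {y + single 0 c * q | y q. y \<in> J \<and> q \<in> P}"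

lemma Jc_ideal: "is_ideal P Jc"
  unfolding is_ideal_def
proof (intro conjI ballI)
  show "Jc \<subseteq> P" unfolding Jc_def using is_idealD(1)[OF J_ideal] by (auto intro!: poly_ring_add poly_ring_mult)
  have "0 + single 0 c * 0 \<in> Jc" unfolding Jc_def using is_idealD(2)[OF J_ideal] poly_ring_0 by blast
  then show "0 \<in> Jc" by simp
  fix x assume "x \<in> Jc"
  then obtain y q where x: "x = y + single 0 c * q" "y \<in> J" "q \<in> P" by (auto simp: Jc_def)
  { fix x' assume "x' \<in> Jc"
    then obtain y' q' where x': "x' = y' + single 0 c * q'" "y' \<in> J" "q' \<in> P" by (auto simp: Jc_def)
    have "x + x' = (y + y') + single 0 c * (q + q')" by (simp add: x x' distrib_left)
    then show "x + x' \<in> Jc" unfolding Jc_def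
      using is_idealD(3)[OF J_ideal x(2) x'(2)] poly_ring_add[OF x(3) x'(3)] by blast }
  { fix r assume r: "r \<in> P"
    have "r * x = r * y + single 0 c * (r * q)" by (simp add: x distrib_left mult.left_commute)
    then show "r * x \<in> Jc" unfolding Jc_def
      using is_idealD(4)[OF J_ideal r x(2)] poly_ring_mult[OF r x(3)] by blast }
qed

lemma J_Jc: "y \<in> J \<Longrightarrow> y \<in> Jc"
proof -
  assume "y \<in> J"
  then have "y + single 0 c * 0 \<in> Jc" unfolding Jc_def using poly_ring_0 by blast
  then show ?thesis by simp
qed

lemma c_Jc: "q \<in> P \<Longrightarrow> single 0 c * q \<in> Jc"
proof -
  assume "q \<in> P"
  then have "0 + single 0 c * q \<in> Jc" unfolding Jc_def using is_idealD(2)[OF J_ideal] by blast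
  then show ?thesis by simp
qed

lemma Jc_reduction:
  assumes "x \<in> Jc"
  shows "\<exists>u q. keys u \<subseteq> L \<and> q \<in> P \<and> x = lin F u + single 0 c * q"
proof -
  obtain y q where x: "x = y + single 0 c * q" "y \<in> J" "q \<in> P" using assms by (auto simp: Jc_def)
  obtain u q' where "keys u \<subseteq> L" "q' \<in> P" "y = lin F u + single 0 c * q'"
    using J_reduction[OF x(2)] by blast
  then show ?thesis using x
    by (intro exI[of _ u] exI[of _ "q' + q"]) (auto simp: distrib_left poly_ring_add)
qed

definition free :: "monom \<Rightarrow> monom" where
  "free b = b - Poly_Mapping.single t (lookup b t)"

lemma free_eq: "Poly_Mapping.single t (lookup b t) + free b = b"
  unfolding free_def by (rule monom_dvd_diff) (auto simp: monom_dvd_def lookup_single when_def)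

lemma decompose_basis:
  obtains \<delta> h s where "nonunit \<delta>"
    "\<And>b. b \<in> B \<Longrightarrow> f b = T (lookup b t) * h b + single 0 \<delta> * s b"
    "\<And>b. b \<in> B \<Longrightarrow> s b \<in> P"
    "\<And>b. b \<in> B \<Longrightarrow> hom (gam (free b)) (h b)" "\<And>b. b \<in> B \<Longrightarrow> lookup (h b) (free b) = 1"
    "\<And>b \<beta>. b \<in> B \<Longrightarrow> less (free b) \<beta> \<Longrightarrow> lookup (h b) \<beta> = 0"
proof -
  define U where "U = (\<lambda>b. restrict {\<beta>. \<not> nonunit (lookup (f b) \<beta>)} (f b))"
  define R where "R = (\<lambda>b. f b - U b)"
  have R: "lookup (R b) \<beta> = (if nonunit (lookup (f b) \<beta>) then lookup (f b) \<beta> else 0)" for b \<beta>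
    by (simp add: R_def U_def lookup_minus)
  let ?C = "\<Union>b\<in>B. lookup (R b) ` keys (R b)"
  obtain \<delta> where \<delta>: "\<delta> \<in> insert 0 ?C" "\<forall>x\<in>?C. \<delta> dvd x" using finite_content[of ?C] B by auto
  have "nonunit \<delta>" using \<delta>(1) R nonunit_0 by auto
  have "\<exists>s. R b = single 0 \<delta> * s \<and> keys s \<subseteq> keys (R b)" if b: "b \<in> B" for b
  proof -
    have "\<delta> dvd lookup (R b) \<beta>" for \<beta>
      using \<delta>(2) b by (cases "\<beta> \<in> keys (R b)") (auto simp: in_keys_iff dvd_zero_ring)
    then obtain s where "R b = single 0 \<delta> * s" "keys s \<subseteq> keys (R b)" by (rule const_dvdE)
    then show ?thesis by blast
  qed
  then have "\<forall>b\<in>B. \<exists>s. R b = single 0 \<delta> * s \<and> keys s \<subseteq> keys (R b)" by blast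
  from bchoice[OF this] obtain s where s: "\<forall>b\<in>B. R b = single 0 \<delta> * s b \<and> keys (s b) \<subseteq> keys (R b)" by blast
  have "\<exists>h. U b = T (lookup b t) * h \<and> hom (gam (free b)) h \<and> lookup h (free b) = 1 \<and>
      (\<forall>\<beta>. less (free b) \<beta> \<longrightarrow> lookup h \<beta> = 0)" if b: "b \<in> B" for b
  proof -
    let ?m = "Poly_Mapping.single t (lookup b t)"
    have kU: "\<beta> \<in> monoms N" "gam \<beta> = gam b" "\<not> less b \<beta>" if "\<beta> \<in> keys (U b)" for \<beta>
      using that f_hom[OF b] f_less[OF b] by (auto simp: U_def hom_def fiber_def)
    have dv: "monom_dvd ?m \<beta>" if "\<beta> \<in> keys (U b)" for \<beta>
    proof -
      have "lookup b t \<le> lookup \<beta> t" using kU(3)[OF that] revlex[of \<beta> b] by (meson not_le)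
      then show ?thesis by (auto simp: monom_dvd_def lookup_single when_def)
    qed
    obtain h where h: "U b = single ?m 1 * h" "keys h \<subseteq> (\<lambda>\<beta>. \<beta> - ?m) ` keys (U b)"
      using monom_factor[OF dv] by blast
    have kh: "\<exists>\<beta>\<in>keys (U b). \<beta> = ?m + \<kappa>" if "\<kappa> \<in> keys h" for \<kappa>
    proof -
      obtain \<beta> where "\<beta> \<in> keys (U b)" "\<kappa> = \<beta> - ?m" using h(2) \<open>\<kappa> \<in> keys h\<close> by blast
      then show ?thesis using monom_dvd_diff[OF dv] by metis
    qed
    have "\<kappa> \<in> fiber (gam (free b))" "\<not> less (free b) \<kappa>" if k: "\<kappa> \<in> keys h" for \<kappa>
    proof -
      obtain \<beta> where be: "\<beta> \<in> keys (U b)" "\<beta> = ?m + \<kappa>" using kh[OF k] by blast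
      have "gam (?m + \<kappa>) = gam (?m + free b)" using kU(2)[OF be(1)] be(2) free_eq[of b] by simp
      then show "\<kappa> \<in> fiber (gam (free b))" using kU(1)[OF be(1)] be(2) by (simp add: fiber_def gam_add)
      show "\<not> less (free b) \<kappa>"
        using kU(3)[OF be(1)] less_add[of "free b" \<kappa> ?m] be(2) free_eq[of b] by auto
    qed
    then have "hom (gam (free b)) h" "\<forall>\<beta>. less (free b) \<beta> \<longrightarrow> lookup h \<beta> = 0"
      by (auto simp: hom_def in_keys_iff)
    moreover have "lookup (U b) b = 1" using f_one[OF b] unit_1 by (simp add: U_def)
    then have "lookup h (free b) = 1"
      using lookup_single_mult[of ?m 1 h "free b"] free_eq[of b] h(1) by simp
    ultimately show ?thesis using h(1) by (auto simp: T_def)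
  qed
  then have "\<forall>b\<in>B. \<exists>h. U b = T (lookup b t) * h \<and> hom (gam (free b)) h \<and> lookup h (free b) = 1 \<and>
      (\<forall>\<beta>. less (free b) \<beta> \<longrightarrow> lookup h \<beta> = 0)" by blast
  from bchoice[OF this] obtain h where h: "\<forall>b\<in>B. U b = T (lookup b t) * h b \<and> hom (gam (free b)) (h b) \<and>
      lookup (h b) (free b) = 1 \<and> (\<forall>\<beta>. less (free b) \<beta> \<longrightarrow> lookup (h b) \<beta> = 0)" by blast
  show thesis
  proof (rule that[of \<delta> h s])
    show "nonunit \<delta>" by fact
    fix b assume b: "b \<in> B"
    have "f b = U b + R b" by (simp add: R_def)
    then show "f b = T (lookup b t) * h b + single 0 \<delta> * s b" using h s b by simp
    have "keys (R b) \<subseteq> keys (f b)" using R by (auto simp: in_keys_iff split: if_splits)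
    then have "keys (s b) \<subseteq> keys (f b)" using s b by blast
    then show "s b \<in> P" using f_P[OF b] by (auto simp: poly_ring_def)
    show "hom (gam (free b)) (h b)" "lookup (h b) (free b) = 1" using h b by auto
    show "lookup (h b) \<beta> = 0" if "less (free b) \<beta>" for \<beta> using h b that by blast
  qed
qed

text \<open>
  The remainder \<open>r\<close> of the division by the \<open>h\<close> stays reduced after multiplication with powers of \<open>T\<close>, since
  the leading monomials of the \<open>h\<close> do not involve \<open>T\<close>. Comparing normal forms therefore shows that \<open>d r\<close> is
  divisible by \<open>d \<delta>\<close> up to multiples of \<open>c\<close>.
\<close>

lemma flat_torsion_step:
  obtains \<delta> n where "nonunit \<delta>"
    "\<And>z d j. z \<in> P \<Longrightarrow> T j * (single 0 d * z) \<in> Jc \<Longrightarrow>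
      \<exists>z'\<in>P. T n * (single 0 d * z) - single 0 (d * \<delta>) * z' \<in> Jc"
proof -
  obtain \<delta> h s where \<delta>: "nonunit \<delta>"
    and fb: "\<And>b. b \<in> B \<Longrightarrow> f b = T (lookup b t) * h b + single 0 \<delta> * s b"
    and sP: "\<And>b. b \<in> B \<Longrightarrow> s b \<in> P"
    and h: "\<And>b. b \<in> B \<Longrightarrow> hom (gam (free b)) (h b)" "\<And>b. b \<in> B \<Longrightarrow> lookup (h b) (free b) = 1"
      "\<And>b \<beta>. b \<in> B \<Longrightarrow> less (free b) \<beta> \<Longrightarrow> lookup (h b) \<beta> = 0"
    by (rule decompose_basis) (rule that)
  define B' where "B' = free ` B"
  define ch where "ch = (\<lambda>\<beta>. SOME b. b \<in> B \<and> free b = \<beta>)"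
  have ch: "ch \<beta> \<in> B" "free (ch \<beta>) = \<beta>" if "\<beta> \<in> B'" for \<beta>
  proof -
    have "\<exists>b. b \<in> B \<and> free b = \<beta>" using that by (auto simp: B'_def)
    from someI_ex[OF this] show "ch \<beta> \<in> B" "free (ch \<beta>) = \<beta>" by (auto simp: ch_def)
  qed
  interpret div: lead_basis V N gam less B' "\<lambda>\<beta>. h (ch \<beta>)"
  proof
    show "finite B'" using B by (simp add: B'_def)
    have "free b \<in> monoms N" if "b \<in> B" for b
      using that B free_eq[of b] monoms_add[of "Poly_Mapping.single t (lookup b t)" "free b" N] by auto
    then show "B' \<subseteq> monoms N" by (auto simp: B'_def)
    fix \<beta> assume be: "\<beta> \<in> B'"
    show "hom (gam \<beta>) (h (ch \<beta>))" using h(1)[OF ch(1)[OF be]] ch(2)[OF be] by simp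
    show "lookup (h (ch \<beta>)) \<beta> = 1" using h(2)[OF ch(1)[OF be]] ch(2)[OF be] by simp
    show "nonunit (lookup (h (ch \<beta>)) \<gamma>)" if "less \<beta> \<gamma>" for \<gamma>
      using h(3)[OF ch(1)[OF be]] ch(2)[OF be] that nonunit_0 by simp
  qed
  define n where "n = Max (insert 0 ((\<lambda>b. lookup b t) ` B))"
  have n: "lookup b t \<le> n" if "b \<in> B" for b
    unfolding n_def using B(1) that by (intro Max_ge) auto
  have "\<exists>z'\<in>P. T n * (single 0 d * z) - single 0 (d * \<delta>) * z' \<in> Jc"
    if z: "z \<in> P" "T j * (single 0 d * z) \<in> Jc" for z d j
  proof -
    obtain w r where w: "z = lin div.F w + r" "keys w \<subseteq> div.L" "keys r \<subseteq> monoms N - div.L"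
      using div.normal_form[OF z(1)] by blast
    let ?q = "\<lambda>\<beta>. lin (div.E \<beta>) w * T (n - lookup (ch \<beta>) t)"
    have qP: "?q \<beta> \<in> P" for \<beta>
      using div.E_P[OF div.L_monoms] w(2) by (intro poly_ring_mult T_P lin_poly_ring) blast
    define y where "y = (\<Sum>\<beta>\<in>B'. ?q \<beta> * f (ch \<beta>))"
    define s' where "s' = (\<Sum>\<beta>\<in>B'. ?q \<beta> * s (ch \<beta>))"
    have yJ: "y \<in> J"
      unfolding y_def using f_J ch(1) qP by (intro is_ideal_sum[OF J_ideal] is_idealD(4)[OF J_ideal]) auto
    have s'P: "s' \<in> P" unfolding s'_def using sP ch(1) by (intro poly_ring_sum poly_ring_mult[OF qP]) auto
    have rP: "r \<in> P" using w(3) by (auto simp: poly_ring_def)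
    have Tn: "T n * z = y - single 0 \<delta> * s' + T n * r"
    proof -
      have "T n * lin div.F w = (\<Sum>\<beta>\<in>B'. lin (div.E \<beta>) w * (T n * h (ch \<beta>)))"
        unfolding div.sum_lin_E[OF w(2), symmetric] sum_distrib_left by (simp add: mult.left_commute)
      also have "\<dots> = (\<Sum>\<beta>\<in>B'. ?q \<beta> * f (ch \<beta>) - single 0 \<delta> * (?q \<beta> * s (ch \<beta>)))"
      proof (rule sum.cong[OF refl])
        fix \<beta> assume "\<beta> \<in> B'"
        then have b: "ch \<beta> \<in> B" by (rule ch)
        have "T n = T (n - lookup (ch \<beta>) t) * T (lookup (ch \<beta>) t)"
          using n[OF b] T_add[of "n - lookup (ch \<beta>) t" "lookup (ch \<beta>) t"] by simp
        then have "T n * h (ch \<beta>) = T (n - lookup (ch \<beta>) t) * (f (ch \<beta>) - single 0 \<delta> * s (ch \<beta>))"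
          using fb[OF b] by (simp add: mult.assoc)
        then show "lin (div.E \<beta>) w * (T n * h (ch \<beta>)) = ?q \<beta> * f (ch \<beta>) - single 0 \<delta> * (?q \<beta> * s (ch \<beta>))"
          by (simp add: right_diff_distrib mult.assoc mult.left_commute)
      qed
      also have "\<dots> = y - single 0 \<delta> * s'"
        by (simp add: sum_subtractf y_def s'_def sum_distrib_left)
      finally show ?thesis by (simp add: w(1) distrib_left)
    qed
    obtain v \<rho> where v: "T j * s' = lin F v + \<rho>" "keys v \<subseteq> L" "keys \<rho> \<subseteq> monoms N - L"
      using normal_form[OF poly_ring_mult[OF T_P s'P]] by blast
    define r2 where "r2 = T (j + n) * r"
    have r2L: "keys r2 \<inter> L = {}"
    proof -
      have "\<alpha> \<notin> L" if al: "\<alpha> \<in> keys r2" for \<alpha>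
      proof
        assume "\<alpha> \<in> L"
        then obtain b where b: "b \<in> B" "monom_dvd b \<alpha>" by (auto simp: L_def)
        obtain \<kappa> where k: "\<kappa> \<in> keys r" "\<alpha> = Poly_Mapping.single t (j + n) + \<kappa>"
          using al keys_single_mult unfolding r2_def T_def by blast
        have "monom_dvd (free b) \<kappa>"
          unfolding monom_dvd_def
        proof
          fix i
          have "lookup b i \<le> lookup \<alpha> i" using b(2) by (simp add: monom_dvd_def)
          then show "lookup (free b) i \<le> lookup \<kappa> i"
            by (cases "i = t") (auto simp: free_def k(2) lookup_add lookup_minus lookup_single when_def)
        qed
        moreover have "\<kappa> \<in> monoms N" "free b \<in> B'" using k(1) w(3) b(1) by (auto simp: B'_def)
        ultimately have "\<kappa> \<in> div.L" unfolding div.L_def by blast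
        then show False using k(1) w(3) by blast
      qed
      then show ?thesis by blast
    qed
    have "T j * (single 0 d * (T n * z)) \<in> Jc"
      using is_idealD(4)[OF Jc_ideal T_P[of n] z(2)] by (simp add: mult.left_commute)
    moreover have "T j * (single 0 d * y) \<in> Jc"
      by (intro is_idealD(4)[OF Jc_ideal] T_P J_Jc yJ poly_ring_const)
    ultimately have "T j * (single 0 d * (T n * z)) - T j * (single 0 d * y) \<in> Jc"
      by (rule is_ideal_diff[OF unital_poly_ring Jc_ideal])
    moreover have "T j * (single 0 d * (T n * z)) - T j * (single 0 d * y) =
        single 0 d * r2 - single 0 (d * \<delta>) * (lin F v + \<rho>)"
      unfolding Tn v(1)[symmetric] r2_def
      by (simp add: T_add distrib_left right_diff_distrib const_const[symmetric] mult.assoc mult.left_commute)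
    ultimately obtain u q where u: "keys u \<subseteq> L" "q \<in> P"
      "single 0 d * r2 - single 0 (d * \<delta>) * (lin F v + \<rho>) = lin F u + single 0 c * q"
      using Jc_reduction by metis
    let ?u = "- (u + single 0 (d * \<delta>) * v)" and ?r = "single 0 d * r2 - single 0 (d * \<delta>) * \<rho>"
    have "lin F ?u = - (lin F u + single 0 (d * \<delta>) * lin F v)"
      by (simp only: lin_uminus lin_add lin_const)
    then have eq: "lin F ?u + ?r = single 0 c * q"
      using u(3) by (simp add: algebra_simps)
    have ku: "keys ?u \<subseteq> L"
      using Poly_Mapping.keys_add[of u "single 0 (d * \<delta>) * v"] keys_const_mult[of "d * \<delta>" v] u(1) v(2)
      by (auto simp only: keys_uminus)
    have kr: "keys ?r \<inter> L = {}"
    proof -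
      have "keys ?r \<subseteq> keys r2 \<union> keys \<rho>" by (auto simp: in_keys_iff lookup_minus)
      then show ?thesis using r2L v(3) by blast
    qed
    have dvd: "c dvd lookup ?r \<alpha>" for \<alpha>
      by (rule normal_form_dvd(2)[OF ku kr], subst eq) simp
    have "\<exists>x y. d * lookup r \<kappa> = d * \<delta> * x + c * y" for \<kappa>
    proof -
      have "lookup r2 (Poly_Mapping.single t (j + n) + \<kappa>) = lookup r \<kappa>"
        unfolding r2_def T_def using lookup_single_mult[of _ 1 r \<kappa>] by simp
      then have "c dvd d * lookup r \<kappa> - d * \<delta> * lookup \<rho> (Poly_Mapping.single t (j + n) + \<kappa>)"
        using dvd[of "Poly_Mapping.single t (j + n) + \<kappa>"] by (simp add: lookup_minus)
      then obtain y where "d * lookup r \<kappa> - d * \<delta> * lookup \<rho> (Poly_Mapping.single t (j + n) + \<kappa>) = c * y"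
        by (rule dvdE)
      then show ?thesis by (metis add.commute diff_add_cancel)
    qed
    then obtain xc yc where xy: "\<And>\<kappa>. d * lookup r \<kappa> = d * \<delta> * xc \<kappa> + c * yc \<kappa>" by metis
    define X where "X = (\<Sum>\<kappa>\<in>keys r. single \<kappa> (xc \<kappa>))"
    define Y where "Y = (\<Sum>\<kappa>\<in>keys r. single \<kappa> (yc \<kappa>))"
    have XY: "X \<in> P" "Y \<in> P" unfolding X_def Y_def using w(3) by (auto intro!: poly_ring_sum poly_ring_single)
    have dr: "single 0 d * r = single 0 (d * \<delta>) * X + single 0 c * Y"
    proof (rule poly_mapping_eqI)
      fix \<kappa>
      show "lookup (single 0 d * r) \<kappa> = lookup (single 0 (d * \<delta>) * X + single 0 c * Y) \<kappa>"
        using xy[of \<kappa>] by (cases "\<kappa> \<in> keys r")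
          (auto simp: X_def Y_def lookup_add lookup_sum lookup_single when_def in_keys_iff)
    qed
    let ?z' = "T n * X - s'"
    have "T n * (single 0 d * z) = single 0 d * (T n * z)" by (simp add: mult.left_commute)
    also have "\<dots> = single 0 d * y - single 0 (d * \<delta>) * s' + T n * (single 0 d * r)"
      unfolding Tn by (simp add: distrib_left right_diff_distrib const_const mult.left_commute[of "single 0 d" "T n"])
    finally have "T n * (single 0 d * z) - single 0 (d * \<delta>) * ?z' = single 0 d * y + single 0 c * (T n * Y)"
      unfolding dr by (simp add: distrib_left right_diff_distrib mult.left_commute)
    moreover have "single 0 d * y + single 0 c * (T n * Y) \<in> Jc"
      by (intro is_idealD(3)[OF Jc_ideal] J_Jc is_idealD(4)[OF J_ideal] yJ c_Jc poly_ring_mult T_P XY) simp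
    ultimately show ?thesis
      using poly_ring_diff[OF poly_ring_mult[OF T_P XY(1)] s'P] by metis
  qed
  then show thesis using that \<delta> by blast
qed

lemma flat_torsion:
  assumes "\<And>d. nonunit d \<Longrightarrow> \<exists>k. c dvd d ^ k"
  shows "\<exists>n. \<forall>z\<in>P. \<forall>j. T j * z \<in> Jc \<longrightarrow> T n * z \<in> Jc"
proof -
  obtain \<delta> n where \<delta>: "nonunit \<delta>" and step: "\<And>z d j. z \<in> P \<Longrightarrow> T j * (single 0 d * z) \<in> Jc \<Longrightarrow>
      \<exists>z'\<in>P. T n * (single 0 d * z) - single 0 (d * \<delta>) * z' \<in> Jc"
    by (rule flat_torsion_step) (rule that)
  obtain k where k: "c dvd \<delta> ^ k" using assms[OF \<delta>] by blast
  have "T (i * n) * z \<in> Jc \<or> (\<exists>z'\<in>P. T (i * n) * z - single 0 (\<delta> ^ i) * z' \<in> Jc \<and> T j * (single 0 (\<delta> ^ i) * z') \<in> Jc)"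
    if z: "z \<in> P" "T j * z \<in> Jc" for z j i
  proof (induction i)
    case 0
    show ?case using z is_idealD(2)[OF Jc_ideal] by (auto simp: T_0 intro!: bexI[of _ z])
  next
    case (Suc i)
    then show ?case
    proof
      assume "T (i * n) * z \<in> Jc"
      then show ?thesis using T_mono[OF Jc_ideal, of "i * n" z "Suc i * n"] by simp
    next
      assume "\<exists>z'\<in>P. T (i * n) * z - single 0 (\<delta> ^ i) * z' \<in> Jc \<and> T j * (single 0 (\<delta> ^ i) * z') \<in> Jc"
      then obtain z1 where z1: "z1 \<in> P" "T (i * n) * z - single 0 (\<delta> ^ i) * z1 \<in> Jc"
        "T j * (single 0 (\<delta> ^ i) * z1) \<in> Jc" by blast
      obtain z2 where z2: "z2 \<in> P" "T n * (single 0 (\<delta> ^ i) * z1) - single 0 (\<delta> ^ i * \<delta>) * z2 \<in> Jc"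
        using step[OF z1(1,3)] by blast
      have "T n * (T (i * n) * z - single 0 (\<delta> ^ i) * z1) +
          (T n * (single 0 (\<delta> ^ i) * z1) - single 0 (\<delta> ^ i * \<delta>) * z2) \<in> Jc"
        by (intro is_idealD(3)[OF Jc_ideal] z2 is_idealD(4)[OF Jc_ideal] z1 T_P)
      then have 1: "T (Suc i * n) * z - single 0 (\<delta> ^ Suc i) * z2 \<in> Jc"
        by (simp add: right_diff_distrib T_add mult.assoc power_commutes)
      have "T n * (T j * (single 0 (\<delta> ^ i) * z1)) -
          T j * (T n * (single 0 (\<delta> ^ i) * z1) - single 0 (\<delta> ^ i * \<delta>) * z2) \<in> Jc"
        by (intro is_ideal_diff[OF unital_poly_ring Jc_ideal] is_idealD(4)[OF Jc_ideal] z1 z2 T_P)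
      then have "T j * (single 0 (\<delta> ^ Suc i) * z2) \<in> Jc"
        by (simp add: right_diff_distrib mult.left_commute power_commutes)
      then show ?thesis using 1 z2(1) by blast
    qed
  qed
  note iter = this
  have "T (k * n) * z \<in> Jc" if z: "z \<in> P" "T j * z \<in> Jc" for z j
    using iter[OF z, of k]
  proof
    assume "\<exists>z'\<in>P. T (k * n) * z - single 0 (\<delta> ^ k) * z' \<in> Jc \<and> T j * (single 0 (\<delta> ^ k) * z') \<in> Jc"
    then obtain z' where z': "z' \<in> P" "T (k * n) * z - single 0 (\<delta> ^ k) * z' \<in> Jc" by blast
    obtain x where "\<delta> ^ k = c * x" using k by (rule dvdE)
    then have "single 0 (\<delta> ^ k) * z' = single 0 c * (single 0 x * z')" by (simp add: const_const)
    then have "single 0 (\<delta> ^ k) * z' \<in> Jc" using c_Jc[of "single 0 x * z'"] z'(1) by (simp add: poly_ring_mult)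
    from is_idealD(3)[OF Jc_ideal z'(2) this] show ?thesis by simp
  qed
  then show ?thesis by blast
qed

text \<open>
  With its converse \<open>quotient_mult\<close>, this says that \<open>f\<close>, \<open>G\<close> and the annihilator of \<open>c\<close> generate \<open>(J : c)\<close>. It
  holds because a combination of the \<open>f\<close> that is divisible by \<open>c\<close> can be divided by \<open>c\<close> within the ideal.
\<close>

lemma quotient_mem:
  assumes e: "\<And>x. c * x = 0 \<longleftrightarrow> e dvd x" and x: "x \<in> P" "single 0 c * x \<in> J"
  shows "x \<in> gen (f ` B \<union> G \<union> {single 0 e})"
proof -
  let ?H = "f ` B \<union> G \<union> {single 0 e}"
  have HP: "?H \<subseteq> P" using f_P G homog_P by auto
  note I = ideal_generated_is_ideal[OF unital_poly_ring HP]
  have sub: "?H \<subseteq> gen ?H" by (rule ideal_generated_superset)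
  obtain p q where p: "\<forall>b\<in>B. p b \<in> P" and q: "\<forall>g\<in>G. q g \<in> P"
    and eq: "single 0 c * x = (\<Sum>b\<in>B. p b * f b) + single 0 c * (\<Sum>g\<in>G. q g * g)"
    using J_cases[OF x(2)] by blast
  let ?s = "\<Sum>g\<in>G. q g * g"
  have sP: "?s \<in> P" using q G homog_P by (intro poly_ring_sum poly_ring_mult) auto
  have sI: "?s \<in> gen ?H" using q sub by (intro is_ideal_sum[OF I] is_idealD(4)[OF I]) auto
  have pP: "\<And>b. b \<in> B \<Longrightarrow> p b \<in> P" using p by blast
  have p_eq: "(\<Sum>b\<in>B. p b * f b) = single 0 c * (x - ?s)" using eq by (simp add: right_diff_distrib)
  obtain a u h where a: "\<And>x y. x \<in> B \<Longrightarrow> y \<in> B \<Longrightarrow> a x y \<in> P" and u: "keys u \<subseteq> L" and h: "h \<in> P"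
    and x_eq: "x - ?s = (\<Sum>x\<in>B. \<Sum>y\<in>B. a x y * sg x y) + lin F u + single 0 e * h"
    using relation_cancel[OF e, of p "x - ?s" thesis, OF pP poly_ring_diff[OF x(1) sP] p_eq] by blast
  have "F \<alpha> \<in> gen ?H" if "\<alpha> \<in> L" for \<alpha>
    unfolding F_def using iota(1)[OF that] L_monoms[OF that] sub
    by (intro is_idealD(4)[OF I]) (auto intro: poly_ring_single)
  then have "lin F u \<in> gen ?H"
    unfolding lin_def using u by (intro is_ideal_sum[OF I] is_idealD(4)[OF I]) auto
  moreover have "a x y * sg x y \<in> gen ?H" if "x \<in> B" "y \<in> B" for x y
    using is_idealD(4)[OF I a[OF that]] sg[OF that] sub by blast
  then have "(\<Sum>x\<in>B. \<Sum>y\<in>B. a x y * sg x y) \<in> gen ?H" by (intro is_ideal_sum[OF I])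
  moreover have "h * single 0 e \<in> gen ?H" using is_idealD(4)[OF I h] sub by blast
  then have "single 0 e * h \<in> gen ?H" by (simp add: mult.commute)
  ultimately have "x - ?s \<in> gen ?H" unfolding x_eq by (intro is_idealD(3)[OF I])
  from is_idealD(3)[OF I this sI] show ?thesis by simp
qed

lemma quotient_mult:
  assumes e: "c * e = 0" and x: "x \<in> gen (f ` B \<union> G \<union> {single 0 e})"
  shows "single 0 c * x \<in> J"
proof -
  have HP: "f ` B \<union> G \<union> {single 0 e} \<subseteq> P" using f_P G homog_P by auto
  show ?thesis using x HP
  proof (induction rule: ideal_generated_induct)
    case zero
    show ?case using is_idealD(2)[OF J_ideal] by simp
  next
    case (add x y)
    then show ?case using is_idealD(3)[OF J_ideal] by (simp add: distrib_left)
  next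
    case (single \<beta> d s)
    have "single 0 c * s \<in> J"
    proof -
      consider "s \<in> f ` B" | "s \<in> G" | "s = single 0 e" using single(2) by blast
      then show ?thesis
      proof cases
        case 1
        then show ?thesis using f_J is_idealD(4)[OF J_ideal poly_ring_const] by blast
      next
        case 3
        then show ?thesis using e is_idealD(2)[OF J_ideal] by (simp add: mult_single)
      qed (rule G_J)
    qed
    from is_idealD(4)[OF J_ideal poly_ring_single[OF single(1), of d] this]
    show ?case by (simp add: mult.left_commute)
  qed
qed

end

context saturation
begin

text \<open>
  Bounded torsion is inherited by extensions: if a power of \<open>T\<close> moves the saturation of \<open>J\<close> into \<open>J + c P\<close>,
  then what remains is \<open>c w\<close> with \<open>w\<close> in the saturation of \<open>(J : c)\<close>. The first part is the flat case. It
  excludes \<open>c = 0\<close> over a domain, where instead uniqueness of normal forms shows that there is no constant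
  torsion.
\<close>

lemma sat_bounded:
  assumes H: "finite H" "\<And>h. h \<in> H \<Longrightarrow> homog h"
  shows "\<exists>n. \<forall>z\<in>P. \<forall>j. T j * z \<in> gen H \<longrightarrow> T n * z \<in> gen H"
proof (rule content_induct[OF _ H, where \<Phi> = "\<lambda>J. \<exists>n. \<forall>z\<in>P. \<forall>j. T j * z \<in> J \<longrightarrow> T n * z \<in> J"])
  fix B f c G su sg e
  assume cb: "content_basis V N gam less B f c G su sg" and e: "\<And>x. c * x = 0 \<longleftrightarrow> e dvd x"
    and IH: "c \<noteq> 0 \<Longrightarrow> nonunit c \<and>
      (\<exists>n. \<forall>z\<in>P. \<forall>j. T j * z \<in> gen (f ` B \<union> G \<union> {single 0 e}) \<longrightarrow> T n * z \<in> gen (f ` B \<union> G \<union> {single 0 e}))"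
  interpret content_basis V N gam less B f c G su sg by (rule cb)
  interpret content_saturation V N gam less B f c G su sg t ..
  have "\<exists>n. \<forall>z\<in>P. \<forall>j. T j * z \<in> J \<longrightarrow> T n * z \<in> J"
  proof (cases "c = 0 \<and> (\<forall>a b::'a. a * b = 0 \<longrightarrow> a = 0 \<or> b = 0)")
    case True
    have "\<exists>n. \<forall>z\<in>sat J. T n * z \<in> J"
    proof (rule sat_bounded_torsion_free[OF J_ideal])
      show "restrict {\<alpha>. gam \<alpha> = g} x \<in> J" if "x \<in> J" for x g
        using component_mem[OF gens_homog] that unfolding J_def by blast
      fix a and z :: "'a mpoly" assume a: "a \<noteq> 0" "z \<in> P" "single 0 a * z \<in> J"
      obtain v r where v: "z = lin F v + r" "keys v \<subseteq> L" "keys r \<subseteq> monoms N - L"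
        using normal_form[OF a(2)] by blast
      obtain u q where u: "keys u \<subseteq> L" "single 0 a * z = lin F u + single 0 c * q"
        using J_reduction[OF a(3)] by blast
      let ?u = "single 0 a * v - u"
      have "keys ?u \<subseteq> L"
      proof -
        have "keys ?u \<subseteq> keys v \<union> keys u" by (auto simp: in_keys_iff lookup_minus)
        then show ?thesis using u(1) v(2) by blast
      qed
      moreover have "keys (single 0 a * r) \<inter> L = {}" using keys_const_mult[of a r] v(3) by blast
      moreover have "lin F u = single 0 a * lin F v + single 0 a * r"
        using u(2) True by (simp add: v(1) distrib_left)
      then have "lin F ?u + single 0 a * r = 0" by (simp add: lin_diff lin_const)
      ultimately have "0 dvd a * lookup r \<alpha>" for \<alpha>
        using normal_form_dvd(2)[of ?u "single 0 a * r" 0 \<alpha>] by simp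
      then have "a * lookup r \<alpha> = 0" for \<alpha> by (auto simp: dvd_def)
      then have "r = 0" using a(1) True by (intro poly_mapping_eqI) auto
      moreover have "lin F v \<in> J"
      proof -
        have "F \<alpha> \<in> J" if "\<alpha> \<in> L" for \<alpha>
          unfolding F_def using iota(1)[OF that] L_monoms[OF that] f_J
          by (intro is_idealD(4)[OF J_ideal]) (auto intro: poly_ring_single)
        then show ?thesis
          unfolding lin_def using v(2) by (intro is_ideal_sum[OF J_ideal] is_idealD(4)[OF J_ideal]) auto
      qed
      ultimately show "z \<in> J" using v(1) by simp
    qed
    then show ?thesis unfolding sat_def by blast
  next
    case False
    then have nz: "c \<noteq> 0 \<or> (\<exists>a b::'a. a \<noteq> 0 \<and> b \<noteq> 0 \<and> a * b = 0)" by blast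
    have "\<exists>k. c dvd d ^ k" if "nonunit d" for d
      by (rule power_in_const[OF _ nz that]) (use IH in blast)
    from flat_torsion[OF this]
    obtain n where n: "\<forall>z\<in>P. \<forall>j. T j * z \<in> Jc \<longrightarrow> T n * z \<in> Jc" ..
    obtain m where m: "c = 0 \<or> (\<forall>z\<in>P. \<forall>j. T j * z \<in> gen (f ` B \<union> G \<union> {single 0 e}) \<longrightarrow>
        T m * z \<in> gen (f ` B \<union> G \<union> {single 0 e}))" using IH by blast
    have "T (m + n) * z \<in> J" if z: "z \<in> P" "T j * z \<in> J" for z j
    proof -
      have "T n * z \<in> Jc" using n z J_Jc by blast
      then obtain y w where yw: "T n * z = y + single 0 c * w" "y \<in> J" "w \<in> P" by (auto simp: Jc_def)
      have Ty: "T i * y \<in> J" for i by (rule is_idealD(4)[OF J_ideal T_P yw(2)])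
      have "T m * (single 0 c * w) \<in> J"
      proof (cases "c = 0")
        case True
        then show ?thesis using is_idealD(2)[OF J_ideal] by simp
      next
        case False
        have "T n * (T j * z) - T j * y \<in> J"
          by (intro is_ideal_diff[OF unital_poly_ring J_ideal] is_idealD(4)[OF J_ideal T_P] z Ty)
        moreover have "T n * (T j * z) - T j * y = T j * (T n * z) - T j * y"
          by (simp add: mult.left_commute)
        ultimately have "T j * (T n * z) - T j * y \<in> J" by simp
        then have "single 0 c * (T j * w) \<in> J"
          unfolding yw(1) by (simp add: distrib_left mult.left_commute)
        then have "T j * w \<in> gen (f ` B \<union> G \<union> {single 0 e})"
          by (intro quotient_mem[OF e] poly_ring_mult T_P yw(3))
        then have "T m * w \<in> gen (f ` B \<union> G \<union> {single 0 e})" using m False yw(3) by blast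
        then have "single 0 c * (T m * w) \<in> J" using quotient_mult e[of e] by simp
        then show ?thesis by (simp add: mult.left_commute)
      qed
      then have "T m * y + T m * (single 0 c * w) \<in> J" by (intro is_idealD(3)[OF J_ideal] Ty)
      then show ?thesis by (simp add: T_add mult.assoc yw(1) distrib_left)
    qed
    then show ?thesis by blast
  qed
  then show "\<exists>n. \<forall>z\<in>P. \<forall>j. T j * z \<in> gen (f ` B \<union> (\<lambda>g. single 0 c * g) ` G) \<longrightarrow>
      T n * z \<in> gen (f ` B \<union> (\<lambda>g. single 0 c * g) ` G)" unfolding J_def .
qed

text \<open>By bounded torsion the saturation is a quotient by a single monomial, to which coherence applies.\<close>

theorem sat_fg:
  assumes H: "finite H" "\<And>h. h \<in> H \<Longrightarrow> homog h"
  shows "finitely_generated_ideal P (sat (gen H))"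
proof -
  obtain n where n: "\<forall>z\<in>P. \<forall>j. T j * z \<in> gen H \<longrightarrow> T n * z \<in> gen H" using sat_bounded[OF H] by blast
  have "sat (gen H) = {q\<in>P. single (Poly_Mapping.single t n) 1 * q \<in> gen H}"
    using n unfolding sat_def T_def by blast
  then show ?thesis using colon_fg[OF H t_monom] by simp
qed

end

section \<open>Homogenization\<close>

definition wt :: "nat \<Rightarrow> (nat \<Rightarrow> nat) \<Rightarrow> monom \<Rightarrow> nat" where
  "wt n w \<alpha> = (\<Sum>i<n. w i * lookup \<alpha> i)"

definition grade :: "nat \<Rightarrow> (nat \<Rightarrow> nat) list \<Rightarrow> monom \<Rightarrow> nat list" where
  "grade n ws \<alpha> = map (\<lambda>w. wt n w \<alpha>) ws"

abbreviation total :: "nat \<Rightarrow> nat" where "total \<equiv> \<lambda>_. 1"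

lemma wt_add: "wt n w (\<alpha> + \<beta>) = wt n w \<alpha> + wt n w \<beta>"
  by (simp add: wt_def lookup_add distrib_left sum.distrib)

lemma wt_single [simp]: "wt n w (Poly_Mapping.single n k) = 0"
  by (simp add: wt_def lookup_single when_def)

lemma grade_add: "grade n ws (\<gamma> + \<alpha>) = grade n ws (\<gamma> + \<beta>) \<longleftrightarrow> grade n ws \<alpha> = grade n ws \<beta>"
  by (simp add: grade_def wt_add)

lemma lookup_le_total: "i < n \<Longrightarrow> lookup \<alpha> i \<le> wt n total \<alpha>"
  unfolding wt_def using member_le_sum[of i "{..<n}" "lookup \<alpha>"] by simp

lemma grade_total: "total \<in> set ws \<Longrightarrow> grade n ws \<alpha> = g \<Longrightarrow> wt n total \<alpha> \<in> set g"
  by (auto simp: grade_def)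

lemma lookup_le_grade:
  assumes "total \<in> set ws" "i < n"
  shows "lookup \<alpha> i \<le> Max (set (grade n ws \<alpha>))"
proof -
  have "wt n total \<alpha> \<le> Max (set (grade n ws \<alpha>))"
    using grade_total[OF assms(1) refl] by (intro Max_ge) auto
  then show ?thesis using lookup_le_total[OF assms(2), of \<alpha>] by linarith
qed

lemma finite_grade: "total \<in> set ws \<Longrightarrow> finite {\<alpha>\<in>monoms n. grade n ws \<alpha> = g}"
  by (rule finite_subset[OF _ finite_bounded_monoms[of n "Max (set g)"]]) (auto simp: lookup_le_grade)

lemma lin_cong: "(\<And>\<alpha>. \<alpha> \<in> keys u \<Longrightarrow> M \<alpha> = M' \<alpha>) \<Longrightarrow> lin M u = lin M' u"
  by (simp add: lin_def)

lemma lin_sum: "lin M (\<Sum>i\<in>A. f i) = (\<Sum>i\<in>A. lin M (f i))"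
  by (induction A rule: infinite_finite_induct) (auto simp: lin_add)

lemma lin_lin:
  fixes u :: "'a::{comm_ring, comm_monoid_mult} mpoly"
  shows "lin M (lin M' u) = lin (\<lambda>\<alpha>. lin M (M' \<alpha>)) u"
  by (simp add: lin_def[of M' u] lin_sum lin_const) (simp add: lin_def[of "\<lambda>\<alpha>. lin M (M' \<alpha>)"])

lemma lin_monomials: "lin (\<lambda>\<alpha>. single \<alpha> (1::'a::{comm_ring, comm_monoid_mult})) u = u"
  unfolding lin_def by (simp add: mult_single flip: poly_sum_singles)

lemma lin_mult:
  fixes f g :: "'a::{comm_ring, comm_monoid_mult} mpoly"
  assumes M: "\<And>\<alpha> \<beta>. M (\<alpha> + \<beta>) = M \<alpha> * M \<beta>" and f: "f \<in> poly_ring n" and g: "g \<in> poly_ring n"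
  shows "lin M (f * g) = lin M f * lin M g"
  using f
proof (induction rule: poly_induct_single)
  case (single \<alpha> a)
  show ?case using g
  proof (induction rule: poly_induct_single)
    case (single \<beta> b)
    show ?case by (simp add: mult_single M const_const[symmetric] mult.assoc mult.left_commute)
  qed (simp_all add: distrib_left lin_add)
qed (simp_all add: distrib_right lin_add)

lemma keys_lin_single:
  fixes u :: "'a::{comm_ring, comm_monoid_mult} mpoly"
  shows "keys (lin (\<lambda>\<alpha>. single (\<phi> \<alpha>) 1) u) \<subseteq> \<phi> ` keys u"
proof -
  have "lin (\<lambda>\<alpha>. single (\<phi> \<alpha>) 1) u = (\<Sum>\<alpha>\<in>keys u. single (\<phi> \<alpha>) (lookup u \<alpha>))"
    by (simp add: lin_def mult_single)
  then show ?thesis using keys_sum_subset[of "\<lambda>\<alpha>. single (\<phi> \<alpha>) (lookup u \<alpha>)" "keys u"]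
    by (auto split: if_splits)
qed

text \<open>
  \<open>lift n w e\<close> homogenizes with the variable of index \<open>n\<close> to \<open>w\<close>-degree \<open>e\<close>, \<open>dehom n\<close> sets this variable to
  \<open>1\<close>, and \<open>at0 n\<close> sets it to \<open>0\<close>.
\<close>

definition lift :: "nat \<Rightarrow> (nat \<Rightarrow> nat) \<Rightarrow> nat \<Rightarrow> 'a::{comm_ring, comm_monoid_mult} mpoly \<Rightarrow> 'a mpoly" where
  "lift n w e = lin (\<lambda>\<alpha>. single (\<alpha> + Poly_Mapping.single n (e - wt n w \<alpha>)) 1)"

definition cut :: "nat \<Rightarrow> monom \<Rightarrow> monom" where
  "cut n \<alpha> = Poly_Mapping.update n 0 \<alpha>"

definition dehom :: "nat \<Rightarrow> 'a::{comm_ring, comm_monoid_mult} mpoly \<Rightarrow> 'a mpoly" where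
  "dehom n = lin (\<lambda>\<alpha>. single (cut n \<alpha>) 1)"

definition at0 :: "nat \<Rightarrow> 'a::{comm_ring, comm_monoid_mult} mpoly \<Rightarrow> 'a mpoly" where
  "at0 n = lin (\<lambda>\<alpha>. if lookup \<alpha> n = 0 then single \<alpha> 1 else 0)"

lemma cut_add: "cut n (\<alpha> + \<beta>) = cut n \<alpha> + cut n \<beta>"
  by (rule poly_mapping_eqI) (simp add: cut_def lookup_update lookup_add)

lemma cut_split: "cut n \<alpha> + Poly_Mapping.single n (lookup \<alpha> n) = \<alpha>"
  by (rule poly_mapping_eqI) (simp add: cut_def lookup_update lookup_add lookup_single when_def)

lemma cut_id: "\<alpha> \<in> monoms n \<Longrightarrow> cut n \<alpha> = \<alpha>"
  by (rule poly_mapping_eqI) (auto simp: cut_def lookup_update monoms_iff)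

lemma cut_single [simp]: "cut n (Poly_Mapping.single n k) = 0"
  by (rule poly_mapping_eqI) (simp add: cut_def lookup_update lookup_single when_def)

lemma cut_monoms: "\<alpha> \<in> monoms (Suc n) \<Longrightarrow> cut n \<alpha> \<in> monoms n"
  by (auto simp: monoms_iff cut_def lookup_update)

lemma wt_cut: "wt n w (cut n \<alpha>) = wt n w \<alpha>"
  using wt_add[of n w "cut n \<alpha>" "Poly_Mapping.single n (lookup \<alpha> n)"] by (simp add: cut_split)

lemma var_monom: "Poly_Mapping.single n k \<in> monoms (Suc n)"
  by (auto simp: monoms_iff lookup_single when_def)

lemma lift_P: "f \<in> poly_ring n \<Longrightarrow> lift n w e f \<in> poly_ring (Suc n)"
  unfolding lift_def
  by (intro lin_poly_ring poly_ring_single) (auto simp: var_monom dest: poly_ringD intro: monoms_mono[of n "Suc n"])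

lemma dehom_P: "f \<in> poly_ring (Suc n) \<Longrightarrow> dehom n f \<in> poly_ring n"
  unfolding dehom_def by (intro lin_poly_ring poly_ring_single cut_monoms) (rule poly_ringD)

lemma at0_P: "f \<in> poly_ring (Suc n) \<Longrightarrow> at0 n f \<in> poly_ring n"
  unfolding at0_def
proof (intro lin_poly_ring)
  fix \<alpha> assume "f \<in> poly_ring (Suc n)" "\<alpha> \<in> keys f"
  then have "\<alpha> \<in> monoms (Suc n)" by (rule poly_ringD)
  moreover have "\<alpha> \<in> monoms n" if "\<alpha> \<in> monoms (Suc n)" "lookup \<alpha> n = 0"
    using that unfolding monoms_iff by (metis Suc_leI le_neq_implies_less)
  ultimately show "(if lookup \<alpha> n = 0 then single \<alpha> 1 else 0) \<in> poly_ring n"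
    by (auto intro!: poly_ring_single)
qed

lemma dehom_mult: "f \<in> poly_ring n' \<Longrightarrow> g \<in> poly_ring n' \<Longrightarrow> dehom n (f * g) = dehom n f * dehom n g"
  unfolding dehom_def by (rule lin_mult) (auto simp: cut_add mult_single)

lemma at0_mult: "f \<in> poly_ring n' \<Longrightarrow> g \<in> poly_ring n' \<Longrightarrow> at0 n (f * g) = at0 n f * at0 n g"
  unfolding at0_def by (rule lin_mult) (auto simp: mult_single lookup_add)

lemma at0_add: "at0 n (f + g) = at0 n f + at0 n g"
  unfolding at0_def by (rule lin_add)

lemma dehom_add: "dehom n (f + g) = dehom n f + dehom n g"
  unfolding dehom_def by (rule lin_add)

lemma dehom_id: "f \<in> poly_ring n \<Longrightarrow> dehom n f = f"
  unfolding dehom_def using lin_monomials[of f] cut_id poly_ringD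
  by (metis (no_types, lifting) lin_cong)

lemma at0_id: "f \<in> poly_ring n \<Longrightarrow> at0 n f = f"
proof -
  assume f: "f \<in> poly_ring n"
  have "at0 n f = lin (\<lambda>\<alpha>. single \<alpha> 1) f"
    unfolding at0_def using poly_ringD[OF f] by (intro lin_cong) (auto simp: monoms_iff)
  then show ?thesis by (simp add: lin_monomials)
qed

lemma poly_ring_Suc: "f \<in> poly_ring n \<Longrightarrow> f \<in> poly_ring (Suc n)"
  using monoms_mono[of n "Suc n"] by (auto simp: poly_ring_def)

lemma dehom_onto: "dehom n ` poly_ring (Suc n) = (poly_ring n :: 'a::{comm_ring, comm_monoid_mult} mpoly set)"
  using dehom_P dehom_id poly_ring_Suc by (metis (no_types, lifting) equalityI image_subsetI rev_image_eqI subsetI)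

lemma at0_onto: "at0 n ` poly_ring (Suc n) = (poly_ring n :: 'a::{comm_ring, comm_monoid_mult} mpoly set)"
  using at0_P at0_id poly_ring_Suc by (metis (no_types, lifting) equalityI image_subsetI rev_image_eqI subsetI)

lemma dehom_lift: "f \<in> poly_ring n \<Longrightarrow> dehom n (lift n w e f) = f"
proof -
  assume f: "f \<in> poly_ring n"
  have "dehom n (lift n w e f) = lin (\<lambda>\<alpha>. single \<alpha> 1) f"
    unfolding dehom_def lift_def lin_lin
    by (rule lin_cong) (use poly_ringD[OF f] in \<open>auto simp: cut_add cut_id\<close>)
  then show ?thesis by (simp add: lin_monomials)
qed

lemma lift_single_mult:
  assumes wt: "\<And>\<alpha>. \<alpha> \<in> keys f \<Longrightarrow> wt n w \<alpha> \<le> e'" and e: "wt n w \<beta> + e' \<le> e"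
  shows "lift n w e (single \<beta> c * f) =
    single (\<beta> + Poly_Mapping.single n (e - wt n w \<beta> - e')) c * lift n w e' f"
proof -
  have "single \<beta> c * f = (\<Sum>\<alpha>\<in>keys f. single (\<beta> + \<alpha>) (c * lookup f \<alpha>))"
    by (subst poly_sum_singles[of f]) (simp add: sum_distrib_left mult_single)
  then have "lift n w e (single \<beta> c * f) =
      (\<Sum>\<alpha>\<in>keys f. single (\<beta> + \<alpha> + Poly_Mapping.single n (e - wt n w (\<beta> + \<alpha>))) (c * lookup f \<alpha>))"
    by (simp add: lift_def lin_sum mult_single)
  also have "\<dots> = (\<Sum>\<alpha>\<in>keys f. single (\<beta> + Poly_Mapping.single n (e - wt n w \<beta> - e')) c *
      single (\<alpha> + Poly_Mapping.single n (e' - wt n w \<alpha>)) (lookup f \<alpha>))"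
  proof (rule sum.cong[OF refl])
    fix \<alpha> assume "\<alpha> \<in> keys f"
    then have "e - wt n w (\<beta> + \<alpha>) = (e - wt n w \<beta> - e') + (e' - wt n w \<alpha>)"
      using wt[of \<alpha>] e by (simp add: wt_add)
    then show "single (\<beta> + \<alpha> + Poly_Mapping.single n (e - wt n w (\<beta> + \<alpha>))) (c * lookup f \<alpha>) =
        single (\<beta> + Poly_Mapping.single n (e - wt n w \<beta> - e')) c *
        single (\<alpha> + Poly_Mapping.single n (e' - wt n w \<alpha>)) (lookup f \<alpha>)"
      by (simp add: mult_single single_add ac_simps)
  qed
  also have "\<dots> = single (\<beta> + Poly_Mapping.single n (e - wt n w \<beta> - e')) c * lift n w e' f"
    by (simp add: lift_def lin_def mult_single sum_distrib_left)
  finally show ?thesis .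
qed

lemma at0_lift:
  fixes f :: "'a::{comm_ring, comm_monoid_mult} mpoly"
  assumes f: "f \<in> poly_ring n" and wt: "\<And>\<alpha>. \<alpha> \<in> keys f \<Longrightarrow> wt n w \<alpha> \<le> e"
  shows "at0 n (lift n w e f) = restrict {\<alpha>. wt n w \<alpha> = e} f"
proof -
  have "at0 n (lift n w e f) = lin (\<lambda>\<alpha>. if wt n w \<alpha> = e then single \<alpha> 1 else 0) f"
    unfolding at0_def lift_def lin_lin
  proof (rule lin_cong)
    fix \<alpha> assume a: "\<alpha> \<in> keys f"
    then have "lookup \<alpha> n = 0" "wt n w \<alpha> \<le> e" using poly_ringD[OF f] wt by (auto simp: monoms_iff)
    then show "lin (\<lambda>\<alpha>. if lookup \<alpha> n = 0 then single \<alpha> 1 else 0)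
        (single (\<alpha> + Poly_Mapping.single n (e - wt n w \<alpha>)) 1) =
        (if wt n w \<alpha> = e then single \<alpha> (1::'a) else 0)"
      by (auto simp: lookup_add lookup_single)
  qed
  also have "\<dots> = (\<Sum>\<alpha>\<in>keys f. if wt n w \<alpha> = e then single \<alpha> (lookup f \<alpha>) else 0)"
    unfolding lin_def by (intro sum.cong) (auto simp: mult_single)
  also have "\<dots> = restrict {\<alpha>. wt n w \<alpha> = e} f"
    by (simp add: restrict_def sum.inter_restrict)
  finally show ?thesis .
qed

text \<open>
  The grading for which homogenizations with respect to \<open>w\<close> are homogeneous, refined by the weights \<open>vs\<close>,
  to which the new variable does not contribute.
\<close>

definition hgrade :: "nat \<Rightarrow> (nat \<Rightarrow> nat) \<Rightarrow> (nat \<Rightarrow> nat) list \<Rightarrow> monom \<Rightarrow> nat \<times> nat list" where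
  "hgrade n w vs \<alpha> = (wt n w \<alpha> + lookup \<alpha> n, grade n vs \<alpha>)"

lemma lift_dehom:
  fixes F :: "'a::{comm_ring, comm_monoid_mult} mpoly"
  assumes F: "\<And>\<kappa>. \<kappa> \<in> keys F \<Longrightarrow> wt n w \<kappa> + lookup \<kappa> n = e"
  shows "lift n w e (dehom n F) = F"
proof -
  have "lift n w e (dehom n F) = lin (\<lambda>\<alpha>. single \<alpha> 1) F"
    unfolding dehom_def lift_def lin_lin
  proof (rule lin_cong)
    fix \<kappa> assume "\<kappa> \<in> keys F"
    then have "e - wt n w (cut n \<kappa>) = lookup \<kappa> n" using F[of \<kappa>] by (simp add: wt_cut)
    then show "lin (\<lambda>\<alpha>. single (\<alpha> + Poly_Mapping.single n (e - wt n w \<alpha>)) 1) (single (cut n \<kappa>) 1) = single \<kappa> (1::'a)"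
      by (simp add: cut_split)
  qed
  then show ?thesis by (simp add: lin_monomials)
qed

text \<open>
  Homogenization is not additive across degrees, but for a fixed target degree it is linear, and in high
  degrees it maps monomial multiples of a generator to monomial multiples of its homogenization.
\<close>

lemma lift_mem:
  fixes H :: "'a::{comm_ring, comm_monoid_mult} mpoly set"
  assumes H: "H \<subseteq> poly_ring n" and e: "\<And>h \<alpha>. h \<in> H \<Longrightarrow> \<alpha> \<in> keys h \<Longrightarrow> wt n w \<alpha> \<le> e h"
    and f: "f \<in> ideal_generated (poly_ring n) H"
  shows "\<exists>e0. \<forall>e'\<ge>e0. lift n w e' f \<in> ideal_generated (poly_ring (Suc n)) ((\<lambda>h. lift n w (e h) h) ` H)"
proof -
  let ?J = "ideal_generated (poly_ring (Suc n)) ((\<lambda>h. lift n w (e h) h) ` H)"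
  have HP: "(\<lambda>h. lift n w (e h) h) ` H \<subseteq> poly_ring (Suc n)" using H lift_P by blast
  note I = ideal_generated_is_ideal[OF unital_poly_ring HP]
  show ?thesis using f H
  proof (induction rule: ideal_generated_induct)
    case zero
    show ?case using is_idealD(2)[OF I] by (simp add: lift_def)
  next
    case (add x y)
    then obtain a b where "\<forall>e'\<ge>a. lift n w e' x \<in> ?J" "\<forall>e'\<ge>b. lift n w e' y \<in> ?J" by blast
    then show ?case using is_idealD(3)[OF I]
      by (intro exI[of _ "max a b"]) (simp add: lift_def lin_add)
  next
    case (single \<beta> c h)
    have "lift n w e' (Poly_Mapping.single \<beta> c * h) \<in> ?J" if "wt n w \<beta> + e h \<le> e'" for e'
    proof -
      have "lift n w (e h) h \<in> ?J" using single(2) ideal_generated_superset[of "(\<lambda>h. lift n w (e h) h) ` H"] by blast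
      moreover have "\<beta> + Poly_Mapping.single n (e' - wt n w \<beta> - e h) \<in> monoms (Suc n)"
        using monoms_mono[of n "Suc n" \<beta>] single(1) var_monom by simp
      ultimately have "Poly_Mapping.single (\<beta> + Poly_Mapping.single n (e' - wt n w \<beta> - e h)) c *
          lift n w (e h) h \<in> ?J"
        by (intro is_idealD(4)[OF I] poly_ring_single)
      moreover have "lift n w e' (Poly_Mapping.single \<beta> c * h) =
          Poly_Mapping.single (\<beta> + Poly_Mapping.single n (e' - wt n w \<beta> - e h)) c * lift n w (e h) h"
        by (rule lift_single_mult[OF e[OF single(2)] that])
      ultimately show ?thesis by simp
    qed
    then show ?case by blast
  qed
qed

lemma dehom_mem:
  fixes H :: "'a::{comm_ring, comm_monoid_mult} mpoly set"
  assumes H: "H \<subseteq> poly_ring n"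
    and F: "F \<in> ideal_generated (poly_ring (Suc n)) ((\<lambda>h. lift n w (e h) h) ` H)"
  shows "dehom n F \<in> ideal_generated (poly_ring n) H"
proof -
  have HP: "(\<lambda>h. lift n w (e h) h) ` H \<subseteq> poly_ring (Suc n)" using H lift_P by blast
  note I = ideal_generated_is_ideal[OF unital_poly_ring H]
  show ?thesis using F HP
  proof (induction rule: ideal_generated_induct)
    case zero
    show ?case using is_idealD(2)[OF I] by (simp add: dehom_def)
  next
    case (add x y)
    then show ?case using is_idealD(3)[OF I] by (simp add: dehom_def lin_add)
  next
    case (single \<beta> c s)
    then obtain h where h: "h \<in> H" "s = lift n w (e h) h" by blast
    have sP: "Poly_Mapping.single \<beta> c \<in> poly_ring (Suc n)" using single by (simp add: poly_ring_single)
    have "s \<in> poly_ring (Suc n)" using HP single(2) by blast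
    moreover have "dehom n s = h" unfolding h(2) by (rule dehom_lift) (use h(1) H in blast)
    ultimately have "dehom n (Poly_Mapping.single \<beta> c * s) = dehom n (Poly_Mapping.single \<beta> c) * h"
      using dehom_mult[OF sP, of s n] by simp
    then show ?case using is_idealD(4)[OF I dehom_P[OF sP]] ideal_generated_superset[of H] h(1) by auto
  qed
qed

definition homogeneous :: "nat \<Rightarrow> (nat \<Rightarrow> nat) list \<Rightarrow> 'a::comm_ring mpoly \<Rightarrow> bool" where
  "homogeneous n ws f \<longleftrightarrow> f \<in> poly_ring n \<and> (\<exists>g. \<forall>\<alpha>\<in>keys f. grade n ws \<alpha> = g)"

definition graded_ideal :: "nat \<Rightarrow> (nat \<Rightarrow> nat) list \<Rightarrow> 'a::comm_ring mpoly set \<Rightarrow> bool" where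
  "graded_ideal n ws J \<longleftrightarrow> is_ideal (poly_ring n) J \<and>
     (\<forall>f\<in>J. \<forall>g. restrict {\<alpha>. grade n ws \<alpha> = g} f \<in> J)"

definition lead_form :: "nat \<Rightarrow> (nat \<Rightarrow> nat) \<Rightarrow> 'a::comm_ring mpoly \<Rightarrow> 'a mpoly" where
  "lead_form n w f = restrict {\<alpha>. wt n w \<alpha> = Max (wt n w ` keys f)} f"

lemma lead_form_nonzero: "f \<noteq> 0 \<Longrightarrow> lead_form n w f \<noteq> 0"
proof -
  assume "f \<noteq> 0"
  then have "keys f \<noteq> {}" by simp
  then have "Max (wt n w ` keys f) \<in> wt n w ` keys f" by (intro Max_in) auto
  then have "keys (lead_form n w f) \<noteq> {}" by (auto simp: lead_form_def)
  then show ?thesis by auto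
qed

lemma graded_fg_homogeneous_gens:
  assumes J: "graded_ideal n ws J" and fg: "finitely_generated_ideal (poly_ring n) (J :: 'a::{comm_ring, comm_monoid_mult} mpoly set)"
  obtains H where "finite H" "\<And>h. h \<in> H \<Longrightarrow> homogeneous n ws h" "J = ideal_generated (poly_ring n) H"
proof -
  obtain S where S: "finite S" "S \<subseteq> poly_ring n" "J = ideal_generated (poly_ring n) S"
    using fg by (auto simp: finitely_generated_ideal_def)
  let ?H = "\<Union>f\<in>S. (\<lambda>g. restrict {\<alpha>. grade n ws \<alpha> = g} f) ` grade n ws ` keys f"
  have hom: "homogeneous n ws h" if "h \<in> ?H" for h
    using that S(2) restrict_poly_ring unfolding homogeneous_def by fastforce
  then have HP: "?H \<subseteq> poly_ring n" unfolding homogeneous_def by blast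
  have "J = ideal_generated (poly_ring n) ?H"
    unfolding S(3)
  proof (rule ideal_generated_eqI[OF unital_poly_ring S(2) HP])
    show "?H \<subseteq> ideal_generated (poly_ring n) S"
      using J S(3) ideal_generated_superset[of S] unfolding graded_ideal_def by blast
    show "S \<subseteq> ideal_generated (poly_ring n) ?H"
    proof
      fix f assume f: "f \<in> S"
      have "f = (\<Sum>g\<in>grade n ws ` keys f. restrict {\<alpha>. grade n ws \<alpha> = g} f)"
        by (rule sum_components)
      moreover have "(\<Sum>g\<in>grade n ws ` keys f. restrict {\<alpha>. grade n ws \<alpha> = g} f) \<in> ideal_generated (poly_ring n) ?H"
        using f ideal_generated_superset[of ?H]
        by (intro is_ideal_sum[OF ideal_generated_is_ideal[OF unital_poly_ring HP]]) blast
      ultimately show "f \<in> ideal_generated (poly_ring n) ?H" by simp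
    qed
  qed
  then show thesis using that[of ?H] hom S(1) by auto
qed

section \<open>Leading forms with respect to a weight\<close>

locale coherent_archimedean = valuation_ring_nontrivial V
  for V :: "'a::{comm_ring, comm_monoid_mult} itself" +
  assumes ann: "\<exists>e. \<forall>x. (c::'a) * x = 0 \<longleftrightarrow> e dvd x"
    and archi: "nonunit (a::'a) \<Longrightarrow> nonunit b \<Longrightarrow> a \<noteq> 0 \<Longrightarrow> b \<noteq> 0 \<Longrightarrow> \<exists>k. a dvd b ^ k"
begin

lemma saturation_hgrade:
  assumes vs: "total \<in> set vs"
  shows "saturation V (Suc n) (hgrade n w vs)
    (\<lambda>\<alpha> \<beta>. lookup \<beta> n < lookup \<alpha> n \<or> (lookup \<alpha> n = lookup \<beta> n \<and> \<alpha> < \<beta>)) n"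
proof unfold_locales
  fix g
  show "finite {\<alpha> \<in> monoms (Suc n). hgrade n w vs \<alpha> = g}"
  proof (rule finite_subset[OF _ finite_bounded_monoms[of "Suc n" "fst g + Max (set (snd g))"]], intro subsetI CollectI conjI allI impI)
    fix \<alpha> i assume a: "\<alpha> \<in> {\<alpha> \<in> monoms (Suc n). hgrade n w vs \<alpha> = g}" "i < Suc n"
    show "lookup \<alpha> i \<le> fst g + Max (set (snd g))"
    proof (cases "i < n")
      case True
      then show ?thesis using lookup_le_grade[OF vs True, of \<alpha>] a by (auto simp: hgrade_def)
    next
      case False
      then show ?thesis using a by (auto simp: hgrade_def less_Suc_eq)
    qed
  qed auto
qed (auto simp: hgrade_def wt_add lookup_add grade_add ann archi intro: add_strict_left_mono)

lemma graded_polynomials_grade: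
  "total \<in> set vs \<Longrightarrow> graded_polynomials V n (grade n vs) (<)"
  by unfold_locales (auto simp: grade_add ann finite_grade intro: add_strict_left_mono)

text \<open>
  Setting the new variable to zero turns the homogenization of \<open>f\<close> into its leading form, and the
  homogeneous elements of the saturated homogenized ideal are exactly the homogenizations of elements of
  \<open>J\<close>, up to powers of the variable. So the ideal of leading forms is the image of this saturation. The
  last two claims allow to iterate the construction with further weights.
\<close>

lemma lead_forms:
  fixes J :: "'a mpoly set" and w :: "nat \<Rightarrow> nat"
  assumes vs: "total \<in> set vs" and J: "graded_ideal n vs J" "finitely_generated_ideal (poly_ring n) J"
  defines "S \<equiv> {lead_form n w f | f. f \<in> J \<and> f \<noteq> 0 \<and> homogeneous n vs f}"
  shows "finitely_generated_ideal (poly_ring n) (ideal_generated (poly_ring n) S)"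
    and "graded_ideal n (w # vs) (ideal_generated (poly_ring n) S)"
    and "{h\<in>ideal_generated (poly_ring n) S. h \<noteq> 0 \<and> homogeneous n (w # vs) h} = S"
proof -
  define Pn where "Pn = (poly_ring n :: 'a mpoly set)"
  interpret saturation V "Suc n" "hgrade n w vs"
    "\<lambda>\<alpha> \<beta>. lookup \<beta> n < lookup \<alpha> n \<or> (lookup \<alpha> n = lookup \<beta> n \<and> \<alpha> < \<beta>)" n
    by (rule saturation_hgrade[OF vs])
  obtain H where H: "finite H" "\<And>h. h \<in> H \<Longrightarrow> homogeneous n vs h" "J = ideal_generated (poly_ring n) H"
    by (rule graded_fg_homogeneous_gens[OF J]) (rule that)
  have HP: "H \<subseteq> poly_ring n" using H(2) by (auto simp: homogeneous_def)
  have JP: "J \<subseteq> poly_ring n" using J(1) is_idealD(1) unfolding graded_ideal_def by blast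
  define e where "e = (\<lambda>h::'a mpoly. Max (wt n w ` keys h))"
  have e: "wt n w \<alpha> \<le> e h" if "\<alpha> \<in> keys h" for h \<alpha>
    unfolding e_def using that by (intro Max_ge) auto
  define Hh where "Hh = (\<lambda>h. lift n w (e h) h) ` H"
  have lift_hom: "hom (d, g) (lift n w d f)"
    if f: "f \<in> poly_ring n" "\<And>\<alpha>. \<alpha> \<in> keys f \<Longrightarrow> wt n w \<alpha> \<le> d" "\<And>\<alpha>. \<alpha> \<in> keys f \<Longrightarrow> grade n vs \<alpha> = g" for f d g
  proof -
    have "\<kappa> \<in> fiber (d, g)" if k: "\<kappa> \<in> keys (lift n w d f)" for \<kappa>
    proof -
      obtain \<alpha> where a: "\<alpha> \<in> keys f" "\<kappa> = \<alpha> + Poly_Mapping.single n (d - wt n w \<alpha>)"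
        using k keys_lin_single[of "\<lambda>\<alpha>. \<alpha> + Poly_Mapping.single n (d - wt n w \<alpha>)" f] unfolding lift_def by blast
      have "lookup \<alpha> n = 0" using poly_ringD[OF f(1) a(1)] by (simp add: monoms_iff)
      moreover have "\<kappa> \<in> monoms (Suc n)" using poly_ringD[OF lift_P[OF f(1)] k] .
      moreover have "grade n vs \<kappa> = grade n vs \<alpha>" by (simp add: a(2) grade_def wt_add)
      ultimately show ?thesis
        using f(2)[OF a(1)] f(3)[OF a(1)] unfolding fiber_def hgrade_def a(2)
        by (simp add: wt_add lookup_add)
    qed
    then show ?thesis by (auto simp: hom_def)
  qed
  have Hh: "finite Hh" "\<And>h. h \<in> Hh \<Longrightarrow> homog h"
  proof -
    show "finite Hh" using H by (simp add: Hh_def)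
    fix h' assume "h' \<in> Hh"
    then obtain h where h: "h \<in> H" "h' = lift n w (e h) h" by (auto simp: Hh_def)
    obtain g where "\<forall>\<alpha>\<in>keys h. grade n vs \<alpha> = g" using H(2)[OF h(1)] by (auto simp: homogeneous_def)
    then have "hom (e h, g) h'" using lift_hom[of h "e h" g] h HP e by blast
    then show "homog h'" unfolding homog_def by blast
  qed
  have HhP: "Hh \<subseteq> P" using Hh homog_P by blast
  define D where "D = sat (gen Hh)"
  have DI: "is_ideal P D" unfolding D_def
    by (rule sat_ideal[OF ideal_generated_is_ideal[OF unital_poly_ring HhP]])
  have Dfg: "finitely_generated_ideal P D" unfolding D_def by (rule sat_fg[OF Hh])
  have Dcomp: "restrict {\<alpha>. hgrade n w vs \<alpha> = g} x \<in> D" if "x \<in> D" for x g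
    using sat_component[OF ideal_generated_is_ideal[OF unital_poly_ring HhP] component_mem[OF Hh(2)]] that
    unfolding D_def by blast
  have D_lift: "lift n w d f \<in> D" if f: "f \<in> J" "\<And>\<alpha>. \<alpha> \<in> keys f \<Longrightarrow> wt n w \<alpha> \<le> d" for f d
  proof -
    obtain e0 where e0: "\<forall>e'\<ge>e0. lift n w e' f \<in> gen Hh"
      using lift_mem[OF HP, of w e f] e f(1) H(3) unfolding Hh_def by blast
    have "lift n w (d + e0) (single 0 1 * f) = single (0 + Poly_Mapping.single n (d + e0 - wt n w 0 - d)) 1 * lift n w d f"
      by (rule lift_single_mult) (use f in \<open>auto simp: wt_def\<close>)
    then have "lift n w (d + e0) f = T e0 * lift n w d f" by (simp add: T_def wt_def)
    then have "T e0 * lift n w d f \<in> gen Hh" using e0 by (metis le_add2)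
    then show ?thesis unfolding D_def sat_def using lift_P f(1) JP by blast
  qed
  have D_dehom: "dehom n F \<in> J" if F: "F \<in> D" for F
  proof -
    obtain j where j: "F \<in> P" "T j * F \<in> gen Hh" using F by (auto simp: D_def sat_def)
    have "dehom n (T j * F) \<in> J" using dehom_mem[OF HP] j(2) H(3) unfolding Hh_def by blast
    moreover have "dehom n (T j) = single 0 1" by (simp add: T_def dehom_def mult_single)
    ultimately show ?thesis using dehom_mult[OF T_P j(1)] by simp
  qed
  \<comment> \<open>A homogeneous element of the saturation is determined by its dehomogenization.\<close>
  have D_at0: "at0 n F \<in> insert 0 S" if F: "F \<in> D" "\<And>\<kappa>. \<kappa> \<in> keys F \<Longrightarrow> hgrade n w vs \<kappa> = (d, g)" for F d g
  proof -
    let ?f = "dehom n F"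
    have FP: "F \<in> P" using F(1) is_idealD(1)[OF DI] by blast
    have fP: "?f \<in> poly_ring n" by (rule dehom_P[OF FP])
    have kf: "wt n w \<alpha> \<le> d" "grade n vs \<alpha> = g" if a: "\<alpha> \<in> keys ?f" for \<alpha>
    proof -
      obtain \<kappa> where k: "\<kappa> \<in> keys F" "\<alpha> = cut n \<kappa>" using a keys_lin_single[of "cut n" F] unfolding dehom_def by blast
      then show "wt n w \<alpha> \<le> d" "grade n vs \<alpha> = g"
        using F(2)[OF k(1)] by (auto simp: hgrade_def wt_cut grade_def)
    qed
    have "F = lift n w d ?f" using lift_dehom[of F n w d] F(2) by (simp add: hgrade_def)
    then have "at0 n F = restrict {\<alpha>. wt n w \<alpha> = d} ?f" using at0_lift[OF fP, of w d] kf(1) by simp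
    moreover have "restrict {\<alpha>. wt n w \<alpha> = d} ?f \<in> insert 0 S"
    proof (cases "\<exists>\<alpha>\<in>keys ?f. wt n w \<alpha> = d")
      case True
      then have "Max (wt n w ` keys ?f) = d" using kf(1) by (intro Max_eqI) auto
      then have "restrict {\<alpha>. wt n w \<alpha> = d} ?f = lead_form n w ?f" by (simp add: lead_form_def)
      moreover have "homogeneous n vs ?f" using fP kf(2) unfolding homogeneous_def by blast
      moreover have "?f \<noteq> 0" using True by auto
      ultimately show ?thesis using D_dehom[OF F(1)] unfolding S_def by blast
    next
      case False
      then have "restrict {\<alpha>. wt n w \<alpha> = d} ?f = 0" by (intro restrict_empty) auto
      then show ?thesis by simp
    qed
    ultimately show ?thesis by simp
  qed
  have SP: "S \<subseteq> poly_ring n" unfolding S_def lead_form_def using JP restrict_poly_ring by blast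
  note SI = ideal_generated_is_ideal[OF unital_poly_ring SP]
  obtain K where K: "finite K" "K \<subseteq> P" "D = gen K" using Dfg by (auto simp: finitely_generated_ideal_def)
  have im: "at0 n ` D = ideal_generated (poly_ring n) (at0 n ` K)"
    unfolding K(3) by (rule image_ideal_generated[OF unital_poly_ring unital_poly_ring K(2) at0_onto])
      (simp_all add: at0_mult at0_add)
  have KP: "at0 n ` K \<subseteq> poly_ring n" using K(2) at0_P by blast
  have imI: "is_ideal (poly_ring n) (at0 n ` D)"
    unfolding im by (rule ideal_generated_is_ideal[OF unital_poly_ring KP])
  have S_D: "S \<subseteq> at0 n ` D"
  proof
    fix x assume "x \<in> S"
    then obtain f where f: "x = lead_form n w f" "f \<in> J" by (auto simp: S_def)
    have "lift n w (e f) f \<in> D" using D_lift[OF f(2)] e by blast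
    moreover have "at0 n (lift n w (e f) f) = x"
      using at0_lift[of f n w "e f"] f JP e by (auto simp: lead_form_def e_def)
    ultimately show "x \<in> at0 n ` D" by (metis imageI)
  qed
  have gen_S: "ideal_generated (poly_ring n) S = at0 n ` D"
  proof
    show "ideal_generated (poly_ring n) S \<subseteq> at0 n ` D" by (rule ideal_generated_least[OF imI S_D])
    show "at0 n ` D \<subseteq> ideal_generated (poly_ring n) S"
    proof (rule image_subsetI)
      fix F assume F: "F \<in> D"
      have "at0 n (restrict {\<kappa>. hgrade n w vs \<kappa> = g} F) \<in> ideal_generated (poly_ring n) S" for g
      proof -
        have "at0 n (restrict {\<kappa>. hgrade n w vs \<kappa> = g} F) \<in> insert 0 S"
          by (rule D_at0[OF Dcomp[OF F], of _ "fst g" "snd g"]) auto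
        then show ?thesis using ideal_generated_superset[of S "poly_ring n"] is_idealD(2)[OF SI] by auto
      qed
      then have "(\<Sum>g\<in>hgrade n w vs ` keys F. at0 n (restrict {\<kappa>. hgrade n w vs \<kappa> = g} F)) \<in> ideal_generated (poly_ring n) S"
        by (intro is_ideal_sum[OF SI])
      then show "at0 n F \<in> ideal_generated (poly_ring n) S"
        using sum_components[of F "hgrade n w vs"] by (simp add: at0_def flip: lin_sum)
    qed
  qed
  have at0_comp: "restrict {\<alpha>. grade n (w # vs) \<alpha> = d # g} (at0 n F) = at0 n (restrict {\<kappa>. hgrade n w vs \<kappa> = (d, g)} F)" for F :: "'a mpoly" and d g
  proof (rule poly_mapping_eqI)
    fix \<alpha>
    have at0_lookup: "lookup (at0 n G) \<alpha> = (if lookup \<alpha> n = 0 then lookup G \<alpha> else 0)" for G :: "'a mpoly"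
    proof -
      have "lookup (at0 n G) \<alpha> = (\<Sum>\<kappa>\<in>keys G. if \<kappa> = \<alpha> then (if lookup \<alpha> n = 0 then lookup G \<alpha> else 0) else 0)"
        unfolding at0_def lookup_lin by (intro sum.cong) (auto simp: lookup_single when_def)
      then show ?thesis by (simp add: in_keys_iff)
    qed
    show "lookup (restrict {\<alpha>. grade n (w # vs) \<alpha> = d # g} (at0 n F)) \<alpha> =
        lookup (at0 n (restrict {\<kappa>. hgrade n w vs \<kappa> = (d, g)} F)) \<alpha>"
      by (simp add: at0_lookup grade_def hgrade_def)
  qed
  show "finitely_generated_ideal (poly_ring n) (ideal_generated (poly_ring n) S)"
    unfolding gen_S im finitely_generated_ideal_def using K(1) KP by blast
  show "graded_ideal n (w # vs) (ideal_generated (poly_ring n) S)"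
    unfolding graded_ideal_def gen_S
  proof (intro conjI ballI allI imI)
    fix x g assume "x \<in> at0 n ` D"
    then obtain F where F: "F \<in> D" "x = at0 n F" by blast
    show "restrict {\<alpha>. grade n (w # vs) \<alpha> = g} x \<in> at0 n ` D"
    proof (cases g)
      case Nil
      then have "restrict {\<alpha>. grade n (w # vs) \<alpha> = g} x = 0" by (intro restrict_empty) (auto simp: grade_def)
      then show ?thesis using is_idealD(2)[OF imI] by simp
    next
      case (Cons d g')
      then show ?thesis unfolding F(2) Cons at0_comp using Dcomp[OF F(1)] by blast
    qed
  qed
  show "{h\<in>ideal_generated (poly_ring n) S. h \<noteq> 0 \<and> homogeneous n (w # vs) h} = S"
  proof (intro equalityI subsetI)
    fix h assume "h \<in> {h\<in>ideal_generated (poly_ring n) S. h \<noteq> 0 \<and> homogeneous n (w # vs) h}"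
    then obtain F g where F: "F \<in> D" "h = at0 n F" "h \<noteq> 0" "\<forall>\<alpha>\<in>keys h. grade n (w # vs) \<alpha> = g"
      unfolding gen_S homogeneous_def by blast
    then obtain \<alpha> where "\<alpha> \<in> keys h" using keys_eq_empty[of h] by blast
    then obtain d g' where g: "g = d # g'" using F(4) by (auto simp: grade_def)
    have "h = restrict {\<alpha>. grade n (w # vs) \<alpha> = d # g'} h"
      using F(4) g by (intro restrict_id[symmetric]) auto
    also have "\<dots> = at0 n (restrict {\<kappa>. hgrade n w vs \<kappa> = (d, g')} F)" unfolding F(2) by (rule at0_comp)
    also have "\<dots> \<in> insert 0 S" by (rule D_at0[OF Dcomp[OF F(1)], of _ d g']) auto
    finally show "h \<in> S" using F(3) by blast
  next
    fix h assume h: "h \<in> S"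
    then obtain f where f: "h = lead_form n w f" "f \<in> J" "f \<noteq> 0" "homogeneous n vs f" by (auto simp: S_def)
    have "h \<noteq> 0" unfolding f(1) by (rule lead_form_nonzero[OF f(3)])
    moreover have "homogeneous n (w # vs) h"
      using f(4) restrict_poly_ring unfolding homogeneous_def f(1) lead_form_def
      by (auto simp: grade_def)
    ultimately show "h \<in> {h\<in>ideal_generated (poly_ring n) S. h \<noteq> 0 \<and> homogeneous n (w # vs) h}"
      using subsetD[OF ideal_generated_superset[of S "poly_ring n"] h] by blast
  qed
qed

end

fun lead_forms_iter :: "nat \<Rightarrow> (nat \<Rightarrow> nat) list \<Rightarrow> 'a::comm_ring mpoly \<Rightarrow> 'a mpoly" where
  "lead_forms_iter n [] f = f"
| "lead_forms_iter n (w # ws) f = lead_forms_iter n ws (lead_form n w f)"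

context coherent_archimedean
begin

lemma lead_forms_iter_fg:
  fixes J :: "'a mpoly set"
  assumes "total \<in> set vs" "graded_ideal n vs J" "finitely_generated_ideal (poly_ring n) J"
  shows "finitely_generated_ideal (poly_ring n)
    (ideal_generated (poly_ring n) {lead_forms_iter n ws f | f. f \<in> J \<and> f \<noteq> 0 \<and> homogeneous n vs f})"
  using assms
proof (induction ws arbitrary: vs J)
  case Nil
  obtain H where H: "finite H" "\<And>h. h \<in> H \<Longrightarrow> homogeneous n vs h" "J = ideal_generated (poly_ring n) H"
    by (rule graded_fg_homogeneous_gens[OF Nil(2,3)]) (rule that)
  have JI: "is_ideal (poly_ring n) J" using Nil(2) by (simp add: graded_ideal_def)
  let ?S = "{lead_forms_iter n [] f | f. f \<in> J \<and> f \<noteq> 0 \<and> homogeneous n vs f}"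
  have SJ: "?S \<subseteq> J" by auto
  have SP: "?S \<subseteq> poly_ring n" using SJ is_idealD(1)[OF JI] by blast
  note SI = ideal_generated_is_ideal[OF unital_poly_ring SP]
  have "H \<subseteq> ideal_generated (poly_ring n) ?S"
  proof
    fix h assume h: "h \<in> H"
    then have "h \<in> J" using H(3) ideal_generated_superset[of H] by blast
    then show "h \<in> ideal_generated (poly_ring n) ?S"
      using H(2)[OF h] ideal_generated_superset[of ?S "poly_ring n"] is_idealD(2)[OF SI]
      by (cases "h = 0") auto
  qed
  then have "ideal_generated (poly_ring n) H \<subseteq> ideal_generated (poly_ring n) ?S"
    by (rule ideal_generated_least[OF SI])
  then have "J \<subseteq> ideal_generated (poly_ring n) ?S" using H(3) by blast
  then have "ideal_generated (poly_ring n) ?S = J"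
    using ideal_generated_least[OF JI SJ] by blast
  then show ?case using Nil(3) by simp
next
  case (Cons w ws)
  let ?S = "{lead_form n w f | f. f \<in> J \<and> f \<noteq> 0 \<and> homogeneous n vs f}"
  let ?J = "ideal_generated (poly_ring n) ?S"
  note * = lead_forms[OF Cons.prems, of w]
  have "finitely_generated_ideal (poly_ring n)
    (ideal_generated (poly_ring n) {lead_forms_iter n ws f | f. f \<in> ?J \<and> f \<noteq> 0 \<and> homogeneous n (w # vs) f})"
    by (rule Cons.IH[OF _ *(2,1)]) (use Cons.prems in auto)
  moreover have "{lead_forms_iter n ws f | f. f \<in> ?J \<and> f \<noteq> 0 \<and> homogeneous n (w # vs) f} =
      lead_forms_iter n ws ` {f\<in>?J. f \<noteq> 0 \<and> homogeneous n (w # vs) f}" by blast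
  moreover have "\<dots> = lead_forms_iter n ws ` ?S" by (simp only: *(3))
  moreover have "lead_forms_iter n ws ` ?S = {lead_forms_iter n (w # ws) f | f. f \<in> J \<and> f \<noteq> 0 \<and> homogeneous n vs f}"
    by auto
  ultimately show ?case by simp
qed

end

section \<open>Rational monomial orders\<close>

fun lexlt :: "nat \<Rightarrow> (nat \<Rightarrow> nat) list \<Rightarrow> monom \<Rightarrow> monom \<Rightarrow> bool" where
  "lexlt n [] \<alpha> \<beta> = False"
| "lexlt n (w # ws) \<alpha> \<beta> = (wt n w \<alpha> < wt n w \<beta> \<or> (wt n w \<alpha> = wt n w \<beta> \<and> lexlt n ws \<alpha> \<beta>))"

lemma lexlt_iff:
  "lexlt n ws \<alpha> \<beta> \<longleftrightarrow> (\<exists>i<length ws. (\<forall>j<i. wt n (ws ! j) \<alpha> = wt n (ws ! j) \<beta>) \<and> wt n (ws ! i) \<alpha> < wt n (ws ! i) \<beta>)"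
  by (induction ws) (auto simp: Ex_less_Suc2 All_less_Suc2)

lemma lead_forms_iter_max:
  assumes "f \<noteq> 0"
  shows "lead_forms_iter n ws f \<noteq> 0"
    and "\<And>\<alpha>. \<alpha> \<in> keys (lead_forms_iter n ws f) \<Longrightarrow> \<alpha> \<in> keys f \<and>
      lookup (lead_forms_iter n ws f) \<alpha> = lookup f \<alpha> \<and> (\<forall>\<beta>\<in>keys f. \<not> lexlt n ws \<alpha> \<beta>)"
proof -
  have "lead_forms_iter n ws f \<noteq> 0 \<and> (\<forall>\<alpha>\<in>keys (lead_forms_iter n ws f). \<alpha> \<in> keys f \<and>
      lookup (lead_forms_iter n ws f) \<alpha> = lookup f \<alpha> \<and> (\<forall>\<beta>\<in>keys f. \<not> lexlt n ws \<alpha> \<beta>))"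
    using assms
  proof (induction ws arbitrary: f)
    case (Cons w ws)
    let ?g = "lead_form n w f"
    have g: "?g \<noteq> 0" by (rule lead_form_nonzero[OF Cons.prems])
    have kg: "\<alpha> \<in> keys ?g \<longleftrightarrow> \<alpha> \<in> keys f \<and> wt n w \<alpha> = Max (wt n w ` keys f)" for \<alpha>
      by (auto simp: lead_form_def)
    have "\<alpha> \<in> keys f \<and> lookup (lead_forms_iter n ws ?g) \<alpha> = lookup f \<alpha> \<and> (\<forall>\<beta>\<in>keys f. \<not> lexlt n (w # ws) \<alpha> \<beta>)"
      if a: "\<alpha> \<in> keys (lead_forms_iter n ws ?g)" for \<alpha>
    proof -
      have *: "\<alpha> \<in> keys ?g" "lookup (lead_forms_iter n ws ?g) \<alpha> = lookup ?g \<alpha>" "\<forall>\<beta>\<in>keys ?g. \<not> lexlt n ws \<alpha> \<beta>"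
        using Cons.IH[OF g] a by blast+
      have le: "wt n w \<beta> \<le> wt n w \<alpha>" if "\<beta> \<in> keys f" for \<beta>
        using *(1) that unfolding kg by (metis Max_ge finite_imageI finite_keys imageI)
      have "\<not> lexlt n (w # ws) \<alpha> \<beta>" if "\<beta> \<in> keys f" for \<beta>
      proof -
        have "\<not> lexlt n ws \<alpha> \<beta>" if "wt n w \<alpha> = wt n w \<beta>"
          using *(1,3) kg[of \<alpha>] kg[of \<beta>] that \<open>\<beta> \<in> keys f\<close> by simp
        then show ?thesis using le[OF that] by auto
      qed
      then show ?thesis using *(1,2) by (simp add: lead_form_def)
    qed
    then show ?case using Cons.IH[OF g] by simp
  qed auto
  then show "lead_forms_iter n ws f \<noteq> 0"
    "\<And>\<alpha>. \<alpha> \<in> keys (lead_forms_iter n ws f) \<Longrightarrow> \<alpha> \<in> keys f \<and>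
      lookup (lead_forms_iter n ws f) \<alpha> = lookup f \<alpha> \<and> (\<forall>\<beta>\<in>keys f. \<not> lexlt n ws \<alpha> \<beta>)" by blast+
qed

lemma common_denominator:
  "finite (S :: rat set) \<Longrightarrow> \<exists>D>0. \<forall>q\<in>S. \<exists>z::int. of_nat D * q = of_int z"
proof (induction S rule: finite_induct)
  case (insert q S)
  then obtain D where D: "D > 0" "\<forall>q\<in>S. \<exists>z::int. of_nat D * q = of_int z" by blast
  obtain a b where ab: "quotient_of q = (a, b)" by (cases "quotient_of q")
  have b: "b > 0" "q = of_int a / of_int b"
    using quotient_of_denom_pos[OF ab] quotient_of_div[OF ab] by auto
  have "\<exists>z::int. of_nat (D * nat b) * x = of_int z" if x: "x \<in> insert q S" for x
  proof (cases "x = q")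
    case True
    have "of_nat (D * nat b) * x = (of_int (int D * a) :: rat)"
      using b True by (simp add: field_simps)
    then show ?thesis by blast
  next
    case False
    then obtain z :: int where "of_nat D * x = of_int z" using D(2) x by blast
    then have "of_nat (D * nat b) * x = of_int z * of_int b" using b(1)
      by (simp add: mult.assoc mult.left_commute mult.commute[of _ x])
    then have "of_nat (D * nat b) * x = of_int (z * b)" by simp
    then show ?thesis by blast
  qed
  moreover have "D * nat b > 0" using D(1) b(1) by simp
  ultimately show ?case by blast
qed (auto intro: exI[of _ 1])

lemma wt_Suc: "wt (Suc n) w \<alpha> = wt n w \<alpha> + w n * lookup \<alpha> n"
  by (simp add: wt_def)

text \<open>
  On monomials of the same total degree in one more variable, a rational order is the lexicographic
  comparison of finitely many weights with natural coefficients: denominators are cleared, and adding a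
  multiple of the total degree to a weight makes it nonnegative without affecting the comparison.
\<close>

lemma rational_order_weights:
  assumes "rational_monomial_order n lt"
  obtains ws where "\<And>\<alpha> \<beta>. \<alpha> \<in> monoms (Suc n) \<Longrightarrow> \<beta> \<in> monoms (Suc n) \<Longrightarrow>
    wt (Suc n) total \<alpha> = wt (Suc n) total \<beta> \<Longrightarrow> lexlt (Suc n) ws \<alpha> \<beta> \<longleftrightarrow> lt (cut n \<alpha>) (cut n \<beta>)"
proof -
  obtain m and Q :: "nat \<Rightarrow> nat \<Rightarrow> rat" where Q: "\<And>\<alpha> \<beta>. \<alpha> \<in> monoms n \<Longrightarrow> \<beta> \<in> monoms n \<Longrightarrow>
      lt \<alpha> \<beta> \<longleftrightarrow> lex_less m (\<lambda>i. \<Sum>j<n. of_rat (Q i j) * of_nat (lookup \<alpha> j))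
                   (\<lambda>i. \<Sum>j<n. of_rat (Q i j) * of_nat (lookup \<beta> j))"
    using assms unfolding rational_monomial_order_def by blast
  have "finite ((\<lambda>(i, j). Q i j) ` ({..<m} \<times> {..<n}))" by simp
  from common_denominator[OF this] obtain D where D: "D > 0"
    "\<forall>q\<in>(\<lambda>(i, j). Q i j) ` ({..<m} \<times> {..<n}). \<exists>z::int. of_nat D * q = of_int z" by blast
  have "\<forall>i j. \<exists>z::int. i < m \<longrightarrow> j < n \<longrightarrow> of_nat D * Q i j = of_int z" using D(2) by auto
  then obtain z :: "nat \<Rightarrow> nat \<Rightarrow> int" where z: "\<And>i j. i < m \<Longrightarrow> j < n \<Longrightarrow> of_nat D * Q i j = of_int (z i j)"
    by metis
  define C where "C = nat (\<Sum>i<m. \<Sum>j<n. \<bar>z i j\<bar>)"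
  have C: "z i j + int C \<ge> 0" if "i < m" "j < n" for i j
  proof -
    have "\<bar>z i j\<bar> \<le> (\<Sum>j<n. \<bar>z i j\<bar>)" using that by (intro member_le_sum) auto
    also have "\<dots> \<le> (\<Sum>i<m. \<Sum>j<n. \<bar>z i j\<bar>)"
      using that by (intro member_le_sum[of i "{..<m}" "\<lambda>i. \<Sum>j<n. \<bar>z i j\<bar>"]) (auto intro: sum_nonneg)
    also have "\<dots> = int C" unfolding C_def by (simp add: sum_nonneg)
    finally show ?thesis by linarith
  qed
  define w where "w = (\<lambda>i j. if j < n then nat (z i j + int C) else C)"
  define ws where "ws = map w [0..<m]"
  have wt: "real (wt (Suc n) (w i) \<alpha>) =
      real D * (\<Sum>j<n. of_rat (Q i j) * of_nat (lookup \<alpha> j)) + real C * real (wt (Suc n) total \<alpha>)"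
    if i: "i < m" for i \<alpha>
  proof -
    have wij: "real (w i j) = real D * of_rat (Q i j) + real C" if j: "j < n" for j
    proof -
      have "real (w i j) = of_int (z i j) + real C" using C[OF i j] j by (simp add: w_def)
      also have "(of_int (z i j) :: real) = of_rat (of_nat D * Q i j)" using z[OF i j] by simp
      finally show ?thesis by (simp add: of_rat_mult)
    qed
    have "real (wt n (w i) \<alpha>) = (\<Sum>j<n. (real D * of_rat (Q i j) + real C) * real (lookup \<alpha> j))"
      unfolding wt_def of_nat_sum of_nat_mult by (rule sum.cong) (auto simp: wij)
    also have "\<dots> = real D * (\<Sum>j<n. of_rat (Q i j) * of_nat (lookup \<alpha> j)) + real C * real (wt n total \<alpha>)"
      by (simp add: wt_def distrib_right sum.distrib sum_distrib_left mult.assoc)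
    finally show ?thesis by (simp add: wt_Suc w_def distrib_left)
  qed
  show thesis
  proof (rule that[of ws])
    fix \<alpha> \<beta> assume a: "\<alpha> \<in> monoms (Suc n)" "\<beta> \<in> monoms (Suc n)" "wt (Suc n) total \<alpha> = wt (Suc n) total \<beta>"
    let ?q = "\<lambda>\<alpha> i. \<Sum>j<n. of_rat (Q i j) * real (lookup \<alpha> j)"
    have less: "wt (Suc n) (w i) \<alpha> < wt (Suc n) (w i) \<beta> \<longleftrightarrow> ?q \<beta> i - ?q \<alpha> i > 0" if "i < m" for i
    proof -
      have "wt (Suc n) (w i) \<alpha> < wt (Suc n) (w i) \<beta> \<longleftrightarrow> real D * ?q \<alpha> i < real D * ?q \<beta> i"
        unfolding of_nat_less_iff[where ?'a = real, symmetric] wt[OF that] a(3) by simp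
      then show ?thesis using D(1) by simp
    qed
    have eq: "wt (Suc n) (w i) \<alpha> = wt (Suc n) (w i) \<beta> \<longleftrightarrow> ?q \<beta> i - ?q \<alpha> i = 0" if "i < m" for i
    proof -
      have "wt (Suc n) (w i) \<alpha> = wt (Suc n) (w i) \<beta> \<longleftrightarrow> real D * ?q \<alpha> i = real D * ?q \<beta> i"
        unfolding of_nat_eq_iff[where ?'a = real, symmetric] wt[OF that] a(3) by simp
      then show ?thesis using D(1) by auto
    qed
    have cut: "?q (cut n \<gamma>) = ?q \<gamma>" for \<gamma>
      by (rule ext, rule sum.cong) (auto simp: cut_def lookup_update)
    have "lexlt (Suc n) ws \<alpha> \<beta> \<longleftrightarrow> (\<exists>i<m. (\<forall>j<i. wt (Suc n) (w j) \<alpha> = wt (Suc n) (w j) \<beta>) \<and>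
        wt (Suc n) (w i) \<alpha> < wt (Suc n) (w i) \<beta>)"
      unfolding lexlt_iff by (auto simp: ws_def)
    also have "\<dots> \<longleftrightarrow> lex_less m (?q \<alpha>) (?q \<beta>)"
    proof -
      have "(\<forall>j<i. wt (Suc n) (w j) \<alpha> = wt (Suc n) (w j) \<beta>) \<and> wt (Suc n) (w i) \<alpha> < wt (Suc n) (w i) \<beta> \<longleftrightarrow>
          (\<forall>j<i. ?q \<beta> j - ?q \<alpha> j = 0) \<and> ?q \<beta> i - ?q \<alpha> i > 0" if i: "i < m" for i
      proof -
        have "wt (Suc n) (w j) \<alpha> = wt (Suc n) (w j) \<beta> \<longleftrightarrow> ?q \<beta> j - ?q \<alpha> j = 0" if "j < i" for j
          by (rule eq) (use that i in simp)
        then show ?thesis unfolding less[OF i] by blast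
      qed
      then show ?thesis unfolding lex_less_def by blast
    qed
    also have "\<dots> \<longleftrightarrow> lt (cut n \<alpha>) (cut n \<beta>)"
      using Q[OF cut_monoms[OF a(1)] cut_monoms[OF a(2)]] unfolding cut by simp
    finally show "lexlt (Suc n) ws \<alpha> \<beta> \<longleftrightarrow> lt (cut n \<alpha>) (cut n \<beta>)" .
  qed
qed

lemma leading_term_eq:
  assumes lt: "monomial_order n lt" and f: "f \<in> poly_ring n" and \<alpha>: "\<alpha> \<in> keys f"
    and max: "\<And>\<beta>. \<beta> \<in> keys f \<Longrightarrow> \<beta> = \<alpha> \<or> lt \<beta> \<alpha>"
  shows "leading_term lt f = single \<alpha> (lookup f \<alpha>)"
proof -
  have "leading_monom lt f = \<alpha>"
    unfolding leading_monom_def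
  proof (rule the_equality)
    show "\<alpha> \<in> keys f \<and> (\<forall>\<beta>\<in>keys f. \<beta> = \<alpha> \<or> lt \<beta> \<alpha>)" using \<alpha> max by blast
    fix \<alpha>' assume a: "\<alpha>' \<in> keys f \<and> (\<forall>\<beta>\<in>keys f. \<beta> = \<alpha>' \<or> lt \<beta> \<alpha>')"
    have mon: "\<alpha> \<in> monoms n" "\<alpha>' \<in> monoms n" using poly_ringD[OF f] \<alpha> a by auto
    show "\<alpha>' = \<alpha>"
    proof (rule ccontr)
      assume "\<alpha>' \<noteq> \<alpha>"
      then have "lt \<alpha>' \<alpha>" "lt \<alpha> \<alpha>'" using max[of \<alpha>'] a \<alpha> by auto
      then have "lt \<alpha> \<alpha>" using lt mon unfolding monomial_order_def by (meson transp_onD)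
      then show False using lt mon unfolding monomial_order_def by (meson irreflp_onD)
    qed
  qed
  then show ?thesis by (simp add: leading_term_def)
qed

context coherent_archimedean
begin

text \<open>
  On homogeneous polynomials, dehomogenization is injective on monomials and preserves the order, and the
  iterated leading form is a single term because the order is total.
\<close>

lemma leading_term_dehom:
  fixes F :: "'a mpoly"
  assumes lt: "monomial_order n lt"
    and ws: "\<And>\<alpha> \<beta>. \<alpha> \<in> monoms (Suc n) \<Longrightarrow> \<beta> \<in> monoms (Suc n) \<Longrightarrow>
      wt (Suc n) total \<alpha> = wt (Suc n) total \<beta> \<Longrightarrow> lexlt (Suc n) ws \<alpha> \<beta> \<longleftrightarrow> lt (cut n \<alpha>) (cut n \<beta>)"
    and F: "F \<noteq> 0" "homogeneous (Suc n) [total] F"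
  shows "dehom n F \<noteq> 0" "leading_term lt (dehom n F) = dehom n (lead_forms_iter (Suc n) ws F)"
proof -
  let ?G = "lead_forms_iter (Suc n) ws F"
  have FP: "F \<in> poly_ring (Suc n)" using F(2) by (simp add: homogeneous_def)
  have wt: "wt (Suc n) total \<alpha> = wt (Suc n) total \<beta>" if "\<alpha> \<in> keys F" "\<beta> \<in> keys F" for \<alpha> \<beta>
  proof -
    obtain g where "\<forall>\<alpha>\<in>keys F. grade (Suc n) [total] \<alpha> = g" using F(2) by (auto simp: homogeneous_def)
    then have "grade (Suc n) [total] \<alpha> = grade (Suc n) [total] \<beta>" using that by simp
    then show ?thesis by (simp add: grade_def)
  qed
  have inj: "\<alpha> = \<beta>" if ab: "\<alpha> \<in> keys F" "\<beta> \<in> keys F" "cut n \<alpha> = cut n \<beta>" for \<alpha> \<beta>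
  proof -
    have "wt n total \<alpha> = wt n total \<beta>" using ab(3) wt_cut by metis
    then have lk: "lookup \<alpha> n = lookup \<beta> n" using wt[OF ab(1,2)] by (simp add: wt_Suc)
    have "\<alpha> = cut n \<alpha> + Poly_Mapping.single n (lookup \<alpha> n)" by (rule cut_split[symmetric])
    also have "\<dots> = cut n \<beta> + Poly_Mapping.single n (lookup \<beta> n)" by (simp only: lk ab(3))
    also have "\<dots> = \<beta>" by (rule cut_split)
    finally show ?thesis .
  qed
  have lk: "lookup (dehom n F) (cut n \<alpha>) = lookup F \<alpha>" if a: "\<alpha> \<in> keys F" for \<alpha>
  proof -
    have "lookup (dehom n F) (cut n \<alpha>) = (\<Sum>\<kappa>\<in>keys F. if \<kappa> = \<alpha> then lookup F \<alpha> else 0)"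
      unfolding dehom_def lookup_lin using inj[OF _ a] by (intro sum.cong) (auto simp: lookup_single when_def)
    then show ?thesis using a by simp
  qed
  have kd: "keys (dehom n F) \<subseteq> cut n ` keys F" unfolding dehom_def by (rule keys_lin_single)
  obtain \<alpha> where \<alpha>: "\<alpha> \<in> keys ?G" using lead_forms_iter_max(1)[OF F(1)] keys_eq_empty[of ?G] by blast
  have G: "\<beta> \<in> keys F" "lookup ?G \<beta> = lookup F \<beta>" "\<And>\<gamma>. \<gamma> \<in> keys F \<Longrightarrow> \<not> lt (cut n \<beta>) (cut n \<gamma>)"
    if "\<beta> \<in> keys ?G" for \<beta>
    using lead_forms_iter_max(2)[OF F(1) that] ws poly_ringD[OF FP] wt by blast+
  have tot: "cut n \<beta> = cut n \<gamma> \<or> lt (cut n \<beta>) (cut n \<gamma>) \<or> lt (cut n \<gamma>) (cut n \<beta>)"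
    if "\<beta> \<in> keys F" "\<gamma> \<in> keys F" for \<beta> \<gamma>
  proof -
    have "totalp_on (monoms n) lt" using lt by (simp add: monomial_order_def)
    then show ?thesis
      using totalp_onD[OF _ cut_monoms[OF poly_ringD[OF FP that(1)]] cut_monoms[OF poly_ringD[OF FP that(2)]]]
      by blast
  qed
  have \<alpha>F: "\<alpha> \<in> keys F" by (rule G(1)[OF \<alpha>])
  have ca: "cut n \<alpha> \<in> keys (dehom n F)" using lk[OF \<alpha>F] \<alpha>F by (simp add: in_keys_iff)
  then show "dehom n F \<noteq> 0" by auto
  have "leading_term lt (dehom n F) = single (cut n \<alpha>) (lookup (dehom n F) (cut n \<alpha>))"
  proof (rule leading_term_eq[OF lt dehom_P[OF FP] ca])
    fix \<beta> assume "\<beta> \<in> keys (dehom n F)"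
    then obtain \<gamma> where g: "\<gamma> \<in> keys F" "\<beta> = cut n \<gamma>" using kd by blast
    show "\<beta> = cut n \<alpha> \<or> lt \<beta> (cut n \<alpha>)"
      using tot[OF \<alpha>F g(1)] G(3)[OF \<alpha> g(1)] g(2) by auto
  qed
  also have "\<dots> = dehom n (single \<alpha> (lookup F \<alpha>))" using lk[OF \<alpha>F] by (simp add: dehom_def mult_single)
  also have "single \<alpha> (lookup F \<alpha>) = ?G"
  proof (rule poly_mapping_eqI)
    fix \<beta>
    have "\<beta> \<notin> keys ?G" if "\<beta> \<noteq> \<alpha>"
    proof
      assume b: "\<beta> \<in> keys ?G"
      then have "cut n \<beta> = cut n \<alpha>" using tot[OF G(1)[OF b] \<alpha>F] G(3)[OF b \<alpha>F] G(3)[OF \<alpha> G(1)[OF b]] by blast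
      then show False using inj[OF G(1)[OF b] \<alpha>F] that by blast
    qed
    then show "lookup (single \<alpha> (lookup F \<alpha>)) \<beta> = lookup ?G \<beta>"
      using G(2)[OF \<alpha>] by (auto simp: lookup_single when_def in_keys_iff)
  qed
  finally show "leading_term lt (dehom n F) = dehom n ?G" .
qed

text \<open>
  The homogenized generators give a finitely generated ideal that is graded by the total degree. Its
  iterated leading forms dehomogenize to the leading terms: homogenizations of elements of \<open>I\<close> lie in this
  ideal up to powers of the new variable, and these powers disappear in the dehomogenization.
\<close>

theorem leading_ideal_fg:
  fixes I :: "'a mpoly set"
  assumes lt: "rational_monomial_order n lt" and I: "finitely_generated_ideal (poly_ring n) I"
  shows "finitely_generated_ideal (poly_ring n) (leading_ideal n lt I)"
proof -
  have mo: "monomial_order n lt" using lt by (simp add: rational_monomial_order_def)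
  obtain ws where ws: "\<And>\<alpha> \<beta>. \<alpha> \<in> monoms (Suc n) \<Longrightarrow> \<beta> \<in> monoms (Suc n) \<Longrightarrow>
      wt (Suc n) total \<alpha> = wt (Suc n) total \<beta> \<Longrightarrow> lexlt (Suc n) ws \<alpha> \<beta> \<longleftrightarrow> lt (cut n \<alpha>) (cut n \<beta>)"
    by (rule rational_order_weights[OF lt]) (rule that)
  obtain S where S: "finite S" "S \<subseteq> poly_ring n" "I = ideal_generated (poly_ring n) S"
    using I by (auto simp: finitely_generated_ideal_def)
  have IP: "I \<subseteq> poly_ring n" using S ideal_generated_is_ideal[OF unital_poly_ring] is_idealD(1) by blast
  define e where "e = (\<lambda>h::'a mpoly. Max (wt n total ` keys h))"
  have e: "wt n total \<alpha> \<le> e h" if "\<alpha> \<in> keys h" for h \<alpha>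
    unfolding e_def using that by (intro Max_ge) auto
  have lift_hom: "\<forall>\<kappa>\<in>keys (lift n total d f). grade (Suc n) [total] \<kappa> = [d]"
    if f: "f \<in> poly_ring n" "\<And>\<alpha>. \<alpha> \<in> keys f \<Longrightarrow> wt n total \<alpha> \<le> d" for f :: "'a mpoly" and d
  proof
    fix \<kappa> assume k: "\<kappa> \<in> keys (lift n total d f)"
    obtain \<alpha> where a: "\<alpha> \<in> keys f" "\<kappa> = \<alpha> + Poly_Mapping.single n (d - wt n total \<alpha>)"
      using k keys_lin_single[of "\<lambda>\<alpha>. \<alpha> + Poly_Mapping.single n (d - wt n total \<alpha>)" f] unfolding lift_def by blast
    have "lookup \<alpha> n = 0" using poly_ringD[OF f(1) a(1)] by (simp add: monoms_iff)
    then show "grade (Suc n) [total] \<kappa> = [d]"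
      using f(2)[OF a(1)] unfolding a(2) by (simp add: grade_def wt_Suc wt_add lookup_add)
  qed
  define H where "H = (\<lambda>h. lift n total (e h) h) ` S"
  define J where "J = ideal_generated (poly_ring (Suc n)) H"
  have HP: "H \<subseteq> poly_ring (Suc n)" using S(2) lift_P unfolding H_def by blast
  have JI: "is_ideal (poly_ring (Suc n)) J" unfolding J_def by (rule ideal_generated_is_ideal[OF unital_poly_ring HP])
  have Jfg: "finitely_generated_ideal (poly_ring (Suc n)) J"
    unfolding finitely_generated_ideal_def J_def using S(1) HP by (auto simp: H_def)
  have tot: "total \<in> set [total]" by simp
  interpret gp: graded_polynomials V "Suc n" "grade (Suc n) [total]" "(<)"
    by (rule graded_polynomials_grade[OF tot])
  have Hhom: "gp.homog h" if h: "h \<in> H" for h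
  proof -
    obtain s where "s \<in> S" "h = lift n total (e s) s" using h by (auto simp: H_def)
    then have "\<forall>\<kappa>\<in>keys h. grade (Suc n) [total] \<kappa> = [e s]" using lift_hom[of s "e s"] S(2) e by blast
    then have "gp.hom [e s] h" using HP h poly_ringD[of h "Suc n"] unfolding gp.hom_def gp.fiber_def by blast
    then show ?thesis unfolding gp.homog_def by blast
  qed
  have Jgr: "graded_ideal (Suc n) [total] J"
    unfolding graded_ideal_def using JI gp.component_mem[OF Hhom] unfolding J_def by blast
  let ?A = "{lead_forms_iter (Suc n) ws f | f. f \<in> J \<and> f \<noteq> 0 \<and> homogeneous (Suc n) [total] f}"
  have Afg: "finitely_generated_ideal (poly_ring (Suc n)) (ideal_generated (poly_ring (Suc n)) ?A)"
    by (rule lead_forms_iter_fg[OF tot Jgr Jfg])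
  have AP: "?A \<subseteq> poly_ring (Suc n)"
  proof
    fix x assume "x \<in> ?A"
    then obtain f where f: "x = lead_forms_iter (Suc n) ws f" "f \<in> J" "f \<noteq> 0" by blast
    then have "keys x \<subseteq> keys f" using lead_forms_iter_max(2)[OF f(3)] by blast
    then show "x \<in> poly_ring (Suc n)" using f(2) is_idealD(1)[OF JI] by (auto simp: poly_ring_def)
  qed
  have image: "dehom n ` ideal_generated (poly_ring (Suc n)) X = ideal_generated (poly_ring n) (dehom n ` X)"
    if "X \<subseteq> poly_ring (Suc n)" for X :: "'a mpoly set"
    by (rule image_ideal_generated[OF unital_poly_ring unital_poly_ring that dehom_onto])
      (simp_all add: dehom_mult dehom_add)
  have "dehom n ` ?A = {leading_term lt f | f. f \<in> I \<and> f \<noteq> 0}"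
  proof (intro equalityI subsetI)
    fix x assume "x \<in> dehom n ` ?A"
    then obtain F where F: "x = dehom n (lead_forms_iter (Suc n) ws F)" "F \<in> J" "F \<noteq> 0"
      "homogeneous (Suc n) [total] F" by blast
    have "dehom n F \<in> I" using dehom_mem[OF S(2)] F(2) S(3) unfolding J_def H_def by blast
    then show "x \<in> {leading_term lt f | f. f \<in> I \<and> f \<noteq> 0}"
      using leading_term_dehom[OF mo ws F(3,4)] F(1) by force
  next
    fix x assume "x \<in> {leading_term lt f | f. f \<in> I \<and> f \<noteq> 0}"
    then obtain f where f: "x = leading_term lt f" "f \<in> I" "f \<noteq> 0" by blast
    obtain e0 where e0: "\<forall>e'\<ge>e0. lift n total e' f \<in> J"
      using lift_mem[OF S(2), of total e f] e f(2) S(3) unfolding J_def H_def by blast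
    define F where "F = lift n total (e0 + e f) f"
    have fP: "f \<in> poly_ring n" using f(2) IP by blast
    have dF: "dehom n F = f" unfolding F_def by (rule dehom_lift[OF fP])
    have F0: "F \<noteq> 0" using dF f(3) by (auto simp: dehom_def)
    have "\<forall>\<kappa>\<in>keys F. grade (Suc n) [total] \<kappa> = [e0 + e f]"
      unfolding F_def by (intro lift_hom[OF fP] trans_le_add2 e)
    then have Fh: "homogeneous (Suc n) [total] F"
      unfolding homogeneous_def F_def using lift_P[OF fP] by blast
    have "F \<in> J" unfolding F_def using e0 by simp
    then show "x \<in> dehom n ` ?A"
      using leading_term_dehom(2)[OF mo ws F0 Fh] dF f(1) F0 Fh by auto
  qed
  then have LI: "leading_ideal n lt I = dehom n ` ideal_generated (poly_ring (Suc n)) ?A"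
    unfolding leading_ideal_def image[OF AP] by simp
  obtain K where K: "finite K" "K \<subseteq> poly_ring (Suc n)"
    "ideal_generated (poly_ring (Suc n)) ?A = ideal_generated (poly_ring (Suc n)) K"
    using Afg by (auto simp: finitely_generated_ideal_def)
  have "leading_ideal n lt I = ideal_generated (poly_ring n) (dehom n ` K)"
    unfolding LI K(3) by (rule image[OF K(2)])
  moreover have "dehom n ` K \<subseteq> poly_ring n" using K(2) dehom_P by blast
  ultimately show ?thesis unfolding finitely_generated_ideal_def using K(1) by blast
qed

end

section \<open>The lexicographic order\<close>

lemma less_monom_iff: "\<alpha> < \<beta> \<longleftrightarrow> (\<exists>k. lookup \<alpha> k < lookup \<beta> k \<and> (\<forall>j<k. lookup \<alpha> j = lookup \<beta> j))"
  for \<alpha> \<beta> :: monom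
  by (simp add: less_poly_mapping.rep_eq less_fun_def)

lemma lex_order_iff_less: "\<beta> \<in> monoms n \<Longrightarrow> lex_order n \<alpha> \<beta> \<longleftrightarrow> \<alpha> < \<beta>"
  unfolding lex_order_def less_monom_iff monoms_iff
  by (metis leI not_less_zero)

lemma monom_zero_le: "(0::monom) \<le> \<delta>"
proof (rule ccontr)
  assume "\<not> 0 \<le> \<delta>"
  then have "\<delta> < 0" by simp
  then show False by (auto simp: less_monom_iff)
qed

lemma monomial_order_lex: "monomial_order n (lex_order n)"
proof -
  have "\<exists>\<alpha>\<in>S. \<forall>\<beta>\<in>S. \<alpha> = \<beta> \<or> lex_order n \<alpha> \<beta>" if S: "S \<subseteq> monoms n" "S \<noteq> {}" for S
  proof -
    obtain B where B: "finite B" "B \<subseteq> S" "\<forall>\<alpha>\<in>S. \<exists>\<beta>\<in>B. monom_dvd \<beta> \<alpha>" using dickson[OF S(1)] by blast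
    then have "B \<noteq> {}" using S(2) by blast
    then have m: "Min B \<in> B" using B(1) by simp
    have "Min B = \<beta> \<or> lex_order n (Min B) \<beta>" if b: "\<beta> \<in> S" for \<beta>
    proof -
      obtain \<gamma> where g: "\<gamma> \<in> B" "monom_dvd \<gamma> \<beta>" using B(3) b by blast
      have "Min B \<le> \<gamma>" using g(1) B(1) by simp
      also have "\<gamma> \<le> \<gamma> + (\<beta> - \<gamma>)" using add_left_mono[OF monom_zero_le, of \<gamma>] by simp
      also have "\<dots> = \<beta>" by (rule monom_dvd_diff[OF g(2)])
      finally show ?thesis using lex_order_iff_less[of \<beta> n "Min B"] b S(1) by auto
    qed
    then show ?thesis using m B(2) by blast
  qed
  then have well: "\<forall>S. S \<subseteq> monoms n \<and> S \<noteq> {} \<longrightarrow> (\<exists>\<alpha>\<in>S. \<forall>\<beta>\<in>S. \<alpha> = \<beta> \<or> lex_order n \<alpha> \<beta>)" by blast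
  have zero: "\<alpha> = 0 \<or> 0 < \<alpha>" for \<alpha> :: monom
    using monom_zero_le[of \<alpha>] by (auto simp: le_less)
  show ?thesis
    unfolding monomial_order_def
  proof (intro conjI)
    show "irreflp_on (monoms n) (lex_order n)" by (rule irreflp_onI) (simp add: lex_order_iff_less)
    show "transp_on (monoms n) (lex_order n)"
      by (rule transp_onI) (simp add: lex_order_iff_less less_trans)
    show "totalp_on (monoms n) (lex_order n)"
      by (rule totalp_onI) (simp add: lex_order_iff_less neq_iff)
    show "\<forall>\<alpha>\<in>monoms n. \<alpha> = 0 \<or> lex_order n 0 \<alpha>" using zero by (simp add: lex_order_iff_less)
    show "\<forall>\<alpha>\<in>monoms n. \<forall>\<beta>\<in>monoms n. \<forall>\<gamma>\<in>monoms n.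
        lex_order n \<alpha> \<beta> \<longrightarrow> lex_order n (\<alpha> + \<gamma>) (\<beta> + \<gamma>)"
      by (simp add: lex_order_iff_less add_strict_right_mono)
  qed (rule well)
qed

lemma rational_lex: "rational_monomial_order n (lex_order n)"
proof -
  let ?Q = "\<lambda>i j::nat. if i = j then 1 else (0::rat)"
  have row: "(\<Sum>j<n. of_rat (?Q i j) * real (lookup \<alpha> j)) = real (lookup \<alpha> i)" if "i < n" for i \<alpha>
  proof -
    have "(\<Sum>j<n. of_rat (?Q i j) * real (lookup \<alpha> j)) = (\<Sum>j<n. if j = i then real (lookup \<alpha> i) else 0)"
      by (rule sum.cong) auto
    then show ?thesis using that by simp
  qed
  have "lex_order n \<alpha> \<beta> \<longleftrightarrow> lex_less n (\<lambda>i. \<Sum>j<n. of_rat (?Q i j) * of_nat (lookup \<alpha> j))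
      (\<lambda>i. \<Sum>j<n. of_rat (?Q i j) * of_nat (lookup \<beta> j))" for \<alpha> \<beta>
  proof -
    have "(\<forall>j<i. lookup \<alpha> j = lookup \<beta> j) \<and> lookup \<alpha> i < lookup \<beta> i \<longleftrightarrow>
        (\<forall>j<i. (\<Sum>k<n. of_rat (?Q j k) * real (lookup \<beta> k)) - (\<Sum>k<n. of_rat (?Q j k) * real (lookup \<alpha> k)) = 0) \<and>
        (\<Sum>k<n. of_rat (?Q i k) * real (lookup \<beta> k)) - (\<Sum>k<n. of_rat (?Q i k) * real (lookup \<alpha> k)) > 0"
      if i: "i < n" for i
    proof -
      have "j < n" if "j < i" for j using that i by simp
      then show ?thesis using row row[OF i] by auto
    qed
    then show ?thesis unfolding lex_order_def lex_less_def by blast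
  qed
  then show ?thesis unfolding rational_monomial_order_def using monomial_order_lex
    by (intro conjI exI[of _ n] exI[of _ ?Q]) auto
qed

lemma leading_term_lex:
  assumes f: "f \<in> poly_ring n" "f \<noteq> 0"
  shows "leading_term (lex_order n) f = single (Max (keys f)) (lookup f (Max (keys f)))"
proof (rule leading_term_eq[OF monomial_order_lex f(1)])
  have ne: "keys f \<noteq> {}" using f(2) by simp
  then show m: "Max (keys f) \<in> keys f" by simp
  fix \<beta> assume "\<beta> \<in> keys f"
  then have "\<beta> \<le> Max (keys f)" by simp
  then show "\<beta> = Max (keys f) \<or> lex_order n \<beta> (Max (keys f))"
    using lex_order_iff_less poly_ringD[OF f(1) m] by auto
qed

section \<open>Groebner rings are coherent and archimedean\<close>

text \<open>Only generators whose monomial divides \<open>\<mu>\<close> contribute to the coefficient at \<open>\<mu>\<close>.\<close>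

lemma dvd_lookup_terms:
  fixes x :: "'a::{comm_ring, comm_monoid_mult} mpoly"
  assumes x: "x \<in> ideal_generated (poly_ring n) S" and S: "S \<subseteq> poly_ring n"
    and terms: "\<And>s. s \<in> S \<Longrightarrow> \<exists>\<alpha> c. s = single \<alpha> c"
    and d: "\<And>\<alpha> c. single \<alpha> c \<in> S \<Longrightarrow> monom_dvd \<alpha> \<mu> \<Longrightarrow> d dvd c"
  shows "d dvd lookup x \<mu>"
  using x S
proof (induction rule: ideal_generated_induct)
  case zero
  show ?case by (simp add: dvd_zero_ring)
next
  case (add x y)
  then show ?case by (simp add: lookup_add dvd_add_ring)
next
  case (single \<beta> b s)
  then obtain \<alpha> c where s: "s = Poly_Mapping.single \<alpha> c" using terms by blast
  show ?case
  proof (cases "\<beta> + \<alpha> = \<mu>")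
    case True
    then have "d dvd c" using d single(2) s monom_dvd_add(2) by blast
    then show ?thesis using True by (simp add: s mult_single lookup_single dvd_mult)
  next
    case False
    then show ?thesis by (simp add: s mult_single lookup_single when_def dvd_zero_ring)
  qed
qed

context valuation_ring_nontrivial
begin

text \<open>
  Only finitely many leading terms generate the leading ideal, and over a valuation ring finitely many
  coefficients have a common divisor among them. The case \<open>d = 0\<close> occurs if none of these terms divides
  \<open>\<mu>\<close>.
\<close>

lemma leading_coefficient_content:
  fixes I :: "'a mpoly set"
  assumes I: "is_ideal (poly_ring n) I"
    and fg: "finitely_generated_ideal (poly_ring n) (leading_ideal n (lex_order n) I)"
  obtains d where "d = 0 \<or> (\<exists>f\<in>I. f \<noteq> 0 \<and> monom_dvd (Max (keys f)) \<mu> \<and> d = lookup f (Max (keys f)))"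
    "\<And>f. f \<in> I \<Longrightarrow> f \<noteq> 0 \<Longrightarrow> Max (keys f) = \<mu> \<Longrightarrow> d dvd lookup f \<mu>"
proof -
  let ?S = "{leading_term (lex_order n) f | f. f \<in> I \<and> f \<noteq> 0}"
  have IP: "f \<in> poly_ring n" if "f \<in> I" for f using is_idealD(1)[OF I] that by blast
  have lt: "leading_term (lex_order n) f = single (Max (keys f)) (lookup f (Max (keys f)))"
    if "f \<in> I" "f \<noteq> 0" for f using leading_term_lex[OF IP[OF that(1)] that(2)] .
  have SP: "?S \<subseteq> poly_ring n"
  proof
    fix x assume "x \<in> ?S"
    then obtain f where f: "x = leading_term (lex_order n) f" "f \<in> I" "f \<noteq> 0" by blast
    have "keys f \<noteq> {}" using f(3) by simp
    then have "Max (keys f) \<in> keys f" by simp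
    then show "x \<in> poly_ring n" unfolding f(1) lt[OF f(2,3)]
      by (intro poly_ring_single poly_ringD[OF IP[OF f(2)]])
  qed
  obtain S0 where S0: "finite S0" "S0 \<subseteq> ?S" "ideal_generated (poly_ring n) S0 = ideal_generated (poly_ring n) ?S"
    using fg_ideal_finite_subset[OF unital_poly_ring SP] fg unfolding leading_ideal_def by blast
  define C where "C = {c. \<exists>\<alpha>. single \<alpha> c \<in> S0 \<and> monom_dvd \<alpha> \<mu> \<and> c \<noteq> 0}"
  have "C \<subseteq> (\<lambda>s. lookup s (Max (keys s))) ` S0"
  proof
    fix c assume "c \<in> C"
    then obtain \<alpha> where "single \<alpha> c \<in> S0" "c \<noteq> 0" by (auto simp: C_def)
    then show "c \<in> (\<lambda>s. lookup s (Max (keys s))) ` S0" by (intro image_eqI[of _ _ "single \<alpha> c"]) auto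
  qed
  then have "finite C" using S0(1) finite_surj by blast
  then obtain d where d: "d \<in> insert 0 C" "\<forall>x\<in>C. d dvd x" using finite_content by blast
  show thesis
  proof (rule that[of d])
    show "d = 0 \<or> (\<exists>f\<in>I. f \<noteq> 0 \<and> monom_dvd (Max (keys f)) \<mu> \<and> d = lookup f (Max (keys f)))"
    proof (cases "d = 0")
      case False
      then obtain \<alpha> where a: "single \<alpha> d \<in> S0" "monom_dvd \<alpha> \<mu>" using d(1) by (auto simp: C_def)
      then obtain f where f: "single \<alpha> d = leading_term (lex_order n) f" "f \<in> I" "f \<noteq> 0" using S0(2) by blast
      have eq: "single \<alpha> d = single (Max (keys f)) (lookup f (Max (keys f)))" using f(1) lt[OF f(2,3)] by simp
      then have "keys (single \<alpha> d) = keys (single (Max (keys f)) (lookup f (Max (keys f))))" by simp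
      then have "Max (keys f) = \<alpha>" using False by (auto split: if_splits)
      then have "lookup f (Max (keys f)) = d" using eq by (metis lookup_single_eq)
      then show ?thesis using f(2,3) a(2) \<open>Max (keys f) = \<alpha>\<close> by blast
    qed simp
    fix f assume f: "f \<in> I" "f \<noteq> 0" "Max (keys f) = \<mu>"
    have "single \<mu> (lookup f \<mu>) \<in> ideal_generated (poly_ring n) S0"
      unfolding S0(3) using lt[OF f(1,2)] f ideal_generated_superset[of ?S "poly_ring n"] by auto
    moreover have "S0 \<subseteq> poly_ring n" using S0(2) SP by blast
    moreover have "\<exists>\<alpha> c. s = single \<alpha> c" if "s \<in> S0" for s using that S0(2) lt by blast
    moreover have "d dvd c" if "single \<alpha> c \<in> S0" "monom_dvd \<alpha> \<mu>" for \<alpha> c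
      using that d(2) by (cases "c = 0") (auto simp: C_def dvd_zero_ring)
    ultimately have "d dvd lookup (single \<mu> (lookup f \<mu>)) \<mu>" by (rule dvd_lookup_terms)
    then show "d dvd lookup f \<mu>" by simp
  qed
qed

text \<open>
  For \<open>X\<close> larger than \<open>Y\<close>, a constant multiple \<open>x (a X + Y)\<close> has a leading term in \<open>Y\<close> exactly if \<open>x\<close>
  annihilates \<open>a\<close>, and then this term is \<open>x Y\<close>. So the coefficients of \<open>Y\<close> among the leading terms of the
  ideal generated by \<open>a X + Y\<close> form the annihilator of \<open>a\<close>.
\<close>

lemma groebner_annihilator:
  assumes gr: "groebner_ring V"
  shows "\<exists>e. \<forall>x. (a::'a) * x = 0 \<longleftrightarrow> e dvd x"
proof -
  let ?x = "Poly_Mapping.single 0 1 :: monom" and ?y = "Poly_Mapping.single (Suc 0) 1 :: monom"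
  define f0 where "f0 = single ?x a + single ?y (1::'a)"
  have m: "?x \<in> monoms 2" "?y \<in> monoms 2" by (auto simp: monoms_def)
  have fP: "{f0} \<subseteq> poly_ring 2" unfolding f0_def using m by (auto intro!: poly_ring_add poly_ring_single)
  define I where "I = ideal_generated (poly_ring 2) {f0}"
  have I: "is_ideal (poly_ring 2) I" unfolding I_def by (rule ideal_generated_is_ideal[OF unital_poly_ring fP])
  have "finitely_generated_ideal (poly_ring 2) I" unfolding I_def finitely_generated_ideal_def using fP by blast
  then have fg: "finitely_generated_ideal (poly_ring 2) (leading_ideal 2 (lex_order 2) I)"
    using gr unfolding groebner_ring_def by simp
  have inv: "lookup f 0 = 0 \<and> lookup f ?x = a * lookup f ?y" if "f \<in> I" for f
    using that fP unfolding I_def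
  proof (induction rule: ideal_generated_induct)
    case (add x y)
    then show ?case by (simp add: lookup_add distrib_left)
  next
    case (single \<beta> c s)
    have s: "Poly_Mapping.single \<beta> c * s = Poly_Mapping.single (\<beta> + ?x) (c * a) + Poly_Mapping.single (\<beta> + ?y) c"
      using single(2) by (simp add: f0_def distrib_left mult_single)
    have "\<beta> + ?x \<noteq> 0" "\<beta> + ?y \<noteq> 0" "\<beta> + ?x \<noteq> ?y" "\<beta> + ?y \<noteq> ?x"
      "\<beta> + ?x = ?x \<longleftrightarrow> \<beta> = 0" "\<beta> + ?y = ?y \<longleftrightarrow> \<beta> = 0"
      by (auto simp: poly_mapping_eq_iff fun_eq_iff lookup_add lookup_single when_def)
    then show ?case unfolding s by (auto simp: lookup_add lookup_single when_def mult.commute)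
  qed simp
  obtain d where d: "d = 0 \<or> (\<exists>f\<in>I. f \<noteq> 0 \<and> monom_dvd (Max (keys f)) ?y \<and> d = lookup f (Max (keys f)))"
    "\<And>f. f \<in> I \<Longrightarrow> f \<noteq> 0 \<Longrightarrow> Max (keys f) = ?y \<Longrightarrow> d dvd lookup f ?y"
    by (rule leading_coefficient_content[OF I fg, of ?y]) (rule that)
  have ad: "a * d = 0"
  proof (cases "d = 0")
    case False
    then obtain f where f: "f \<in> I" "f \<noteq> 0" "monom_dvd (Max (keys f)) ?y" "d = lookup f (Max (keys f))"
      using d(1) by blast
    have "keys f \<noteq> {}" using f(2) by simp
    then have mk: "Max (keys f) \<in> keys f" by simp
    have le: "lookup (Max (keys f)) i \<le> (if i = Suc 0 then 1 else 0)" for i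
      using f(3) by (auto simp: monom_dvd_def lookup_single when_def split: if_splits)
    have "Max (keys f) \<noteq> 0" using inv[OF f(1)] mk by (metis in_keys_iff)
    have My: "Max (keys f) = ?y"
    proof (rule ccontr)
      assume ne: "Max (keys f) \<noteq> ?y"
      have "Max (keys f) = 0"
      proof (rule poly_mapping_eqI)
        fix i
        have "lookup (Max (keys f)) (Suc 0) \<noteq> 1"
        proof
          assume l1: "lookup (Max (keys f)) (Suc 0) = 1"
          have "Max (keys f) = ?y"
          proof (rule poly_mapping_eqI)
            fix i show "lookup (Max (keys f)) i = lookup ?y i"
              using le[of i] l1 by (cases "i = Suc 0") (auto simp: lookup_single when_def)
          qed
          then show False using ne by blast
        qed
        then show "lookup (Max (keys f)) i = lookup 0 i" using le[of i] le[of "Suc 0"]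
          by (cases "i = Suc 0") auto
      qed
      then show False using \<open>Max (keys f) \<noteq> 0\<close> by blast
    qed
    have "?y < ?x" unfolding less_monom_iff by (intro exI[of _ 0]) (auto simp: lookup_single when_def)
    then have "?x \<notin> keys f" using My Max_ge[of "keys f" ?x] by fastforce
    then have "lookup f ?x = 0" by (simp add: in_keys_iff)
    then show ?thesis using inv[OF f(1)] f(4) My by simp
  qed simp
  have "a * x = 0 \<longleftrightarrow> d dvd x" for x
  proof
    assume ax: "a * x = 0"
    show "d dvd x"
    proof (cases "x = 0")
      case False
      have "single 0 x * f0 = single ?y x" using ax by (simp add: f0_def distrib_left mult_single mult.commute)
      moreover have "single 0 x * f0 \<in> I"
        using is_idealD(4)[OF I poly_ring_const] ideal_generated_superset[of "{f0}"] unfolding I_def by blast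
      ultimately have "single ?y x \<in> I" by simp
      then have "d dvd lookup (single ?y x) ?y"
      proof (rule d(2))
        show "single ?y x \<noteq> 0" using False by (metis lookup_single_eq lookup_zero)
        show "Max (keys (single ?y x)) = ?y" using False by simp
      qed
      then show ?thesis by simp
    qed (simp add: dvd_zero_ring)
  next
    assume "d dvd x"
    then obtain y where "x = d * y" by (rule dvdE)
    then show "a * x = 0" using ad by (simp flip: mult.assoc)
  qed
  then show ?thesis by blast
qed

text \<open>
  If no power of \<open>b\<close> is divisible by \<open>a\<close>, then \<open>a\<close> is divisible by all powers of \<open>b\<close>, and the ideal generated
  by \<open>1 + b X\<close> and \<open>a\<close> contains \<open>e\<close> whenever \<open>a = b\<^sup>k e\<close>. Its constants are the multiples of a single \<open>d\<close>.
  Substituting \<open>- 1 / b\<close> for \<open>X\<close> shows that \<open>a\<close> divides \<open>d b\<^sup>D\<close> for some \<open>D\<close>; as \<open>d\<close> divides the quotient of \<open>a\<close>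
  by \<open>b\<^bsup>D+1\<^esup>\<close>, the element \<open>a\<close> is a multiple of \<open>a b\<close>, hence zero.
\<close>

lemma groebner_archimedean:
  assumes gr: "groebner_ring V" and ab: "nonunit (a::'a)" "nonunit b" "a \<noteq> 0" "b \<noteq> 0"
  shows "\<exists>k\<ge>1. a dvd b ^ k"
proof (rule ccontr)
  assume "\<not> (\<exists>k\<ge>1. a dvd b ^ k)"
  then have b_dvd: "b ^ Suc k dvd a" for k using dvd_total[of a "b ^ Suc k"] by (metis One_nat_def Suc_le_mono le0)
  let ?x = "Poly_Mapping.single 0 1 :: monom"
  define f0 where "f0 = single 0 (1::'a) + single ?x b"
  have m: "?x \<in> monoms 1" by (auto simp: monoms_def)
  have fP: "{f0, single 0 a} \<subseteq> poly_ring 1"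
    unfolding f0_def using m by (auto intro!: poly_ring_add poly_ring_single)
  define I where "I = ideal_generated (poly_ring 1) {f0, single 0 a}"
  have I: "is_ideal (poly_ring 1) I" unfolding I_def by (rule ideal_generated_is_ideal[OF unital_poly_ring fP])
  have gens: "f0 \<in> I" "single 0 a \<in> I" using ideal_generated_superset[of "{f0, single 0 a}"] unfolding I_def by auto
  have "finitely_generated_ideal (poly_ring 1) I"
    unfolding I_def finitely_generated_ideal_def by (intro exI[of _ "{f0, single 0 a}"]) (use fP in simp)
  then have fg: "finitely_generated_ideal (poly_ring 1) (leading_ideal 1 (lex_order 1) I)"
    using gr unfolding groebner_ring_def by simp
  have cancel: "single 0 e \<in> I" if "single 0 (b ^ k * e) \<in> I" for e k
    using that
  proof (induction k)
    case (Suc k)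
    have "single 0 (b ^ k * e) * f0 - single ?x 1 * single 0 (b ^ Suc k * e) \<in> I"
      by (intro is_ideal_diff[OF unital_poly_ring I] is_idealD(4)[OF I] gens Suc.prems poly_ring_single m) simp
    moreover have "single 0 (b ^ k * e) * f0 - single ?x 1 * single 0 (b ^ Suc k * e) = single 0 (b ^ k * e)"
      by (simp add: f0_def distrib_left mult_single mult.commute mult.left_commute)
    ultimately show ?case using Suc.IH by simp
  qed simp
  \<comment> \<open>Evaluation at \<open>- 1 / b\<close> after multiplication with \<open>b\<^sup>D\<close>.\<close>
  define M where "M = (\<lambda>D (\<alpha>::monom). single 0 ((- 1) ^ lookup \<alpha> 0 * b ^ (D - lookup \<alpha> 0)) :: 'a mpoly)"
  have ev: "\<exists>D0. \<forall>D\<ge>D0. a dvd lookup (lin (M D) p) 0" if "p \<in> I" for p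
    using that fP unfolding I_def
  proof (induction rule: ideal_generated_induct)
    case zero
    show ?case by (simp add: dvd_zero_ring)
  next
    case (add x y)
    then obtain D E where "\<forall>D'\<ge>D. a dvd lookup (lin (M D') x) 0" "\<forall>D'\<ge>E. a dvd lookup (lin (M D') y) 0" by blast
    then show ?case by (intro exI[of _ "max D E"]) (simp add: lin_add lookup_add dvd_add_ring)
  next
    case (single \<beta> c s)
    have "a dvd lookup (lin (M D) (Poly_Mapping.single \<beta> c * s)) 0" if D: "D \<ge> Suc (lookup \<beta> 0)" for D
    proof (cases "s = f0")
      case True
      have pw: "b ^ (D - lookup \<beta> 0) = b * b ^ (D - Suc (lookup \<beta> 0))"
        using D by (metis Suc_diff_Suc Suc_le_eq power_Suc)
      have "Poly_Mapping.single \<beta> c * s = Poly_Mapping.single \<beta> c + Poly_Mapping.single (\<beta> + ?x) (c * b)"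
        by (simp add: True f0_def distrib_left mult_single)
      then have "lookup (lin (M D) (Poly_Mapping.single \<beta> c * s)) 0 =
          c * ((- 1) ^ lookup \<beta> 0 * b ^ (D - lookup \<beta> 0)) +
          c * b * ((- 1) ^ Suc (lookup \<beta> 0) * b ^ (D - Suc (lookup \<beta> 0)))"
        by (simp add: lin_add lookup_add M_def)
      also have "\<dots> = 0" unfolding pw by (simp add: mult.assoc mult.left_commute)
      finally show ?thesis by (simp add: dvd_zero_ring)
    next
      case False
      then have "s = Poly_Mapping.single 0 a" using single(2) by blast
      then show ?thesis by (simp add: mult_single M_def mult.assoc dvd_mult)
    qed
    then show ?case by blast
  qed
  obtain d where d: "d = 0 \<or> (\<exists>f\<in>I. f \<noteq> 0 \<and> monom_dvd (Max (keys f)) 0 \<and> d = lookup f (Max (keys f)))"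
    "\<And>f. f \<in> I \<Longrightarrow> f \<noteq> 0 \<Longrightarrow> Max (keys f) = 0 \<Longrightarrow> d dvd lookup f 0"
    by (rule leading_coefficient_content[OF I fg, of 0]) (rule that)
  have const: "d dvd e" if "single 0 e \<in> I" for e
  proof (cases "e = 0")
    case False
    have "d dvd lookup (single 0 e) (0::monom)"
    proof (rule d(2)[OF that])
      show "single 0 e \<noteq> 0" using False by (metis lookup_single_eq lookup_zero)
      show "Max (keys (single 0 e)) = 0" using False by simp
    qed
    then show ?thesis by simp
  qed (simp add: dvd_zero_ring)
  have "d \<noteq> 0" using const[OF gens(2)] ab(3) by (auto simp: dvd_def)
  then obtain f where f: "f \<in> I" "f \<noteq> 0" "monom_dvd (Max (keys f)) 0" "d = lookup f (Max (keys f))"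
    using d(1) by blast
  have M0: "Max (keys f) = 0" by (rule poly_mapping_eqI) (use f(3) in \<open>auto simp: monom_dvd_def\<close>)
  have "keys f \<subseteq> {0}"
  proof
    fix \<beta> assume "\<beta> \<in> keys f"
    then have "\<beta> \<le> 0" using Max_ge[of "keys f" \<beta>] M0 by simp
    then show "\<beta> \<in> {0}" using monom_zero_le[of \<beta>] by simp
  qed
  then have "f = single 0 d"
    using poly_sum_singles_superset[of "{0}" f] f(4) M0 by simp
  then have "single 0 d \<in> I" using f(1) by simp
  from ev[OF this] obtain D where "a dvd lookup (lin (M D) (single 0 d)) 0" by blast
  then have "a dvd d * b ^ D" by (simp add: M_def)
  then obtain w where w: "d * b ^ D = a * w" by (rule dvdE)
  obtain e where e: "a = b ^ Suc D * e" using b_dvd by (rule dvdE)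
  have "single 0 (b ^ Suc D * e) \<in> I" using gens(2) unfolding e .
  then have "single 0 e \<in> I" by (rule cancel)
  then have "d dvd e" by (rule const)
  then obtain u where u: "e = d * u" by (rule dvdE)
  have "a = (d * b ^ D) * (b * u)" using e u by (simp add: ac_simps)
  then have "a * (b * (u * w)) = a" unfolding w by (simp add: ac_simps)
  then show False using mult_nonunit_self[of a "b * (u * w)"] nonunit_mult[OF ab(2)] ab(3) by blast
qed

section \<open>Coherence and the archimedean property of valuation rings\<close>

lemma jacobson_radical_eq: "jacobson_radical = {x::'a. nonunit x}"
proof -
  let ?M = "{x::'a. nonunit x}"
  have I: "is_ideal UNIV ?M" unfolding is_ideal_def by (auto simp: nonunit_0 nonunit_add nonunit_mult2)
  have unit: "J = UNIV" if J: "is_ideal UNIV J" "\<not> nonunit x" "x \<in> J" for J and x :: 'a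
  proof -
    obtain i where i: "x * i = 1" using unit_inverse[OF J(2)] by blast
    have "y = (y * i) * x" for y using i by (metis mult.assoc mult.commute mult.right_neutral)
    then have "y \<in> J" for y using is_idealD(4)[OF J(1), of "y * i" x] J(3) by (metis UNIV_I)
    then show ?thesis by blast
  qed
  have "?M \<noteq> UNIV" using unit_1 by blast
  then have max: "maximal_ideal ?M" unfolding maximal_ideal_def using I unit by blast
  have "M = ?M" if "maximal_ideal M" for M
  proof -
    have "M \<subseteq> ?M" using that unit unfolding maximal_ideal_def by blast
    then show ?thesis using that I \<open>?M \<noteq> UNIV\<close> unfolding maximal_ideal_def by blast
  qed
  then have "{M. maximal_ideal M} = {?M}" using max by blast
  then show ?thesis by (simp add: jacobson_radical_def)
qed

text \<open>
  Finitely generated ideals are principal, so coherence means that annihilators of elements are finitely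
  generated, hence principal. A presentation of the ideal of \<open>a\<close> on other generators \<open>g\<^sub>i = y\<^sub>i a\<close> with
  \<open>a = \<Sum> x\<^sub>i g\<^sub>i\<close> is converted by applying the \<open>y\<^sub>i\<close> to the syzygies; the additional generator
  \<open>1 - \<Sum> x\<^sub>i y\<^sub>i\<close> of the annihilator measures the failure of the \<open>x\<^sub>i\<close> and \<open>y\<^sub>i\<close> to be inverse to each other.
\<close>

lemma coherent_iff_annihilator: "coherent_ring V \<longleftrightarrow> (\<forall>c::'a. \<exists>e. \<forall>x. c * x = 0 \<longleftrightarrow> e dvd x)"
proof
  assume coh: "coherent_ring V"
  show "\<forall>c::'a. \<exists>e. \<forall>x. c * x = 0 \<longleftrightarrow> e dvd x"
  proof
    fix a :: 'a
    have "finitely_generated_ideal UNIV (ideal_generated UNIV {a})"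
      unfolding finitely_generated_ideal_def by blast
    then obtain k and g :: "nat \<Rightarrow> 'a" and m and s where kg: "ideal_generated UNIV {a} = ideal_generated UNIV (g ` {..<k})"
      and syz: "syzygies k g = {\<lambda>i. \<Sum>j<m. d j * s j i | d :: nat \<Rightarrow> 'a. True}"
      using coh unfolding coherent_ring_def finitely_presented_ideal_def by blast
    have "a \<in> ideal_generated UNIV (g ` {..<k})" using kg ideal_generated_superset[of "{a}" UNIV] by blast
    then obtain x where x: "a = (\<Sum>i<k. x i * g i)"
      using ideal_generated_family[OF unital_UNIV, of "{..<k}" g a] by auto
    have "\<forall>i. \<exists>y. i < k \<longrightarrow> g i = y * a"
    proof
      fix i
      have "i < k \<Longrightarrow> g i \<in> ideal_generated UNIV {a}"
        using kg ideal_generated_superset[of "g ` {..<k}" UNIV] by blast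
      then show "\<exists>y. i < k \<longrightarrow> g i = y * a"
        using ideal_generated_family[OF unital_UNIV, of "{a}" "\<lambda>x. x" "g i"] by auto
    qed
    then obtain y where y: "\<And>i. i < k \<Longrightarrow> g i = y i * a" by metis
    define t where "t = (\<lambda>j. \<Sum>i<k. s j i * y i)"
    define u where "u = 1 - (\<Sum>i<k. x i * y i)"
    define A where "A = insert u (t ` {..<m})"
    have "finite A" by (simp add: A_def)
    from finite_content[OF this] obtain e where e: "e \<in> insert 0 A" "\<forall>x\<in>A. e dvd x" by blast
    have "a * t j = 0" if j: "j < m" for j
    proof -
      have "(\<lambda>i. \<Sum>j'<m. (if j' = j then 1 else 0) * s j' i) \<in> syzygies k g"
        unfolding syz by (intro CollectI exI[of _ "\<lambda>j'. if j' = j then 1 else 0"]) simp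
      moreover have "(\<Sum>j'<m. (if j' = j then 1 else 0) * s j' i) = s j i" for i
      proof -
        have "(\<Sum>j'<m. (if j' = j then 1 else 0) * s j' i) = (\<Sum>j'<m. if j' = j then s j i else 0)"
          by (rule sum.cong) auto
        then show ?thesis using j by simp
      qed
      ultimately have "(\<Sum>i<k. s j i * g i) = 0" by (simp add: syzygies_def)
      moreover have "a * t j = (\<Sum>i<k. s j i * g i)"
        unfolding t_def sum_distrib_left by (rule sum.cong) (auto simp: y mult.commute mult.left_commute)
      ultimately show ?thesis by simp
    qed
    moreover have "a * u = 0"
    proof -
      have "a * (\<Sum>i<k. x i * y i) = (\<Sum>i<k. x i * g i)"
        unfolding sum_distrib_left by (rule sum.cong) (auto simp: y mult.commute mult.left_commute)
      then show ?thesis by (simp add: u_def right_diff_distrib flip: x)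
    qed
    ultimately have ae: "a * e = 0" using e(1) by (auto simp: A_def)
    have "a * b = 0 \<longleftrightarrow> e dvd b" for b
    proof
      assume b: "a * b = 0"
      let ?c = "\<lambda>i. if i < k then b * x i else 0"
      have "(\<Sum>i<k. ?c i * g i) = b * a" unfolding x sum_distrib_left by (rule sum.cong) (auto simp: mult.assoc)
      then have "?c \<in> syzygies k g" using b by (simp add: syzygies_def mult.commute)
      then obtain d where "?c = (\<lambda>i. \<Sum>j<m. d j * s j i)" unfolding syz by blast
      then have d: "?c i = (\<Sum>j<m. d j * s j i)" for i by (rule fun_cong)
      have "b * (\<Sum>i<k. x i * y i) = (\<Sum>i<k. (\<Sum>j<m. d j * s j i) * y i)"
        unfolding sum_distrib_left by (rule sum.cong) (auto simp flip: d simp: mult.assoc)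
      also have "\<dots> = (\<Sum>j<m. d j * t j)"
        unfolding t_def sum_distrib_left sum_distrib_right mult.assoc by (rule sum.swap)
      finally have "b = (\<Sum>j<m. d j * t j) + b * u" by (simp add: u_def right_diff_distrib)
      moreover have "e dvd (\<Sum>j<m. d j * t j) + b * u"
        using e(2) by (intro dvd_add_ring dvd_sum_ring dvd_mult) (auto simp: A_def)
      ultimately show "e dvd b" by simp
    next
      assume "e dvd b"
      then obtain y where "b = e * y" by (rule dvdE)
      then show "a * b = 0" using ae by (simp flip: mult.assoc)
    qed
    then show "\<exists>e. \<forall>x. a * x = 0 \<longleftrightarrow> e dvd x" by blast
  qed
next
  assume ann: "\<forall>c::'a. \<exists>e. \<forall>x. c * x = 0 \<longleftrightarrow> e dvd x"
  show "coherent_ring V"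
    unfolding coherent_ring_def
  proof (intro allI impI)
    fix I :: "'a set" assume "finitely_generated_ideal UNIV I"
    then obtain S where S: "finite S" "I = ideal_generated UNIV S" by (auto simp: finitely_generated_ideal_def)
    obtain g where g: "g \<in> insert 0 S" "\<forall>x\<in>S. g dvd x" using finite_content[OF S(1)] by blast
    obtain e where e: "\<And>x. g * x = 0 \<longleftrightarrow> e dvd x" using ann by blast
    have idg: "is_ideal UNIV (ideal_generated UNIV T)" for T :: "'a set"
      by (rule ideal_generated_is_ideal[OF unital_UNIV]) simp
    have "S \<subseteq> ideal_generated UNIV {g}"
    proof
      fix x assume "x \<in> S"
      then obtain y where "x = y * g" using g(2) by (metis dvdE mult.commute)
      then show "x \<in> ideal_generated UNIV {g}"
        using is_idealD(4)[OF idg, of y g "{g}"] ideal_generated_superset[of "{g}" UNIV] by simp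
    qed
    moreover have "{g} \<subseteq> ideal_generated UNIV S"
      using g(1) is_idealD(2)[OF idg, of S] ideal_generated_superset[of S UNIV] by auto
    ultimately have "I = ideal_generated UNIV {g}"
      unfolding S(2) by (intro ideal_generated_eqI[OF unital_UNIV]) auto
    then have 1: "I = ideal_generated UNIV ((\<lambda>_. g) ` {..<Suc 0})" by (simp add: lessThan_Suc)
    let ?s = "\<lambda>(j::nat) (i::nat). if i = 0 then e else 0"
    have "syzygies (Suc 0) (\<lambda>_. g) = {\<lambda>i. \<Sum>j<Suc 0. d j * ?s j i | d :: nat \<Rightarrow> 'a. True}"
    proof (intro equalityI subsetI)
      fix c assume c: "c \<in> syzygies (Suc 0) (\<lambda>_. g)"
      then have "g * c 0 = 0" by (simp add: syzygies_def mult.commute)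
      then obtain x where x: "c 0 = e * x" using e by (meson dvdE)
      have "c = (\<lambda>i. \<Sum>j<Suc 0. x * ?s j i)"
      proof
        fix i show "c i = (\<Sum>j<Suc 0. x * ?s j i)"
          using c x by (cases "i = 0") (auto simp: syzygies_def mult.commute)
      qed
      then show "c \<in> {\<lambda>i. \<Sum>j<Suc 0. d j * ?s j i | d :: nat \<Rightarrow> 'a. True}"
        by (intro CollectI exI[of _ "\<lambda>_. x"]) simp
    next
      fix c assume "c \<in> {\<lambda>i. \<Sum>j<Suc 0. d j * ?s j i | d :: nat \<Rightarrow> 'a. True}"
      then obtain d :: "nat \<Rightarrow> 'a" where "c = (\<lambda>i. \<Sum>j<Suc 0. d j * ?s j i)" by blast
      moreover have "d 0 * e * g = 0" using e[of e] by (simp add: mult.assoc mult.commute[of e])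
      ultimately show "c \<in> syzygies (Suc 0) (\<lambda>_. g)" by (auto simp: syzygies_def)
    qed
    then show "finitely_presented_ideal I"
      unfolding finitely_presented_ideal_def
      by (intro exI[of _ "Suc 0"] exI[of _ "\<lambda>_. g"] conjI 1 exI[of _ ?s])
  qed
qed

lemma archimedean_iff:
  "archimedean V \<longleftrightarrow> (\<forall>a b::'a. nonunit a \<longrightarrow> nonunit b \<longrightarrow> a \<noteq> 0 \<longrightarrow> b \<noteq> 0 \<longrightarrow> (\<exists>k\<ge>1. a dvd b ^ k))"
  unfolding archimedean_def jacobson_radical_eq by blast

end

section \<open>The equivalence\<close>

text \<open>Over the zero ring every set that occurs has at most one element.\<close>

lemma zero_ring_all:
  assumes "(1::'a::{comm_ring, comm_monoid_mult}) = 0"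
  shows "finitely_generated_ideal A (ideal_generated A (S :: 'a mpoly set))"
    and "coherent_ring (V :: 'a itself)" and "archimedean (V :: 'a itself)"
proof -
  have z: "x = 0" for x :: 'a using assms mult_1[of x] by simp
  have zf: "f = 0" for f :: "'a mpoly" by (rule poly_mapping_eqI) (use z in simp)
  have "ideal_generated A S = ideal_generated A {}"
  proof -
    have "S \<subseteq> J" if "is_ideal A J" for J
      using is_idealD(2)[OF that] zf by (metis subsetI)
    then have "is_ideal A J \<and> S \<subseteq> J \<longleftrightarrow> is_ideal A J" for J by blast
    then show ?thesis by (simp add: ideal_generated_def)
  qed
  then show "finitely_generated_ideal A (ideal_generated A S)"
    unfolding finitely_generated_ideal_def by (intro exI[of _ "{}"]) simp
  have fp: "finitely_presented_ideal I" if "finitely_generated_ideal UNIV I" for I :: "'a set"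
  proof -
    have ieq: "ideal_generated UNIV T = {0::'a}" for T
      using ideal_generated_is_ideal[OF unital_UNIV, of T] is_idealD(2) z by blast
    have "syzygies 0 g = {\<lambda>i. \<Sum>j<0. d j * s j i | d :: nat \<Rightarrow> 'a. True}" for g :: "nat \<Rightarrow> 'a" and s
      unfolding syzygies_def using z by (auto simp: fun_eq_iff)
    then show ?thesis
      using that unfolding finitely_presented_ideal_def finitely_generated_ideal_def ieq by blast
  qed
  then show "coherent_ring V" by (simp add: coherent_ring_def)
  show "archimedean V" unfolding archimedean_def using z by blast
qed

theorem corollary4p2:
  fixes V :: "'a::{comm_ring, comm_monoid_mult} itself"
  assumes "valuation_ring V"
  shows "(groebner_ring V \<longleftrightarrow> coherent_ring V \<and> archimedean V) \<and>
    (coherent_ring V \<and> archimedean V \<longleftrightarrow>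
      (\<forall>n\<ge>1. \<forall>lt. rational_monomial_order n lt \<longrightarrow>
        (\<forall>I :: 'a mpoly set. finitely_generated_ideal (poly_ring n) I \<longrightarrow>
          finitely_generated_ideal (poly_ring n) (leading_ideal n lt I))))"
proof (cases "(1::'a) = 0")
  case True
  show ?thesis
    unfolding groebner_ring_def leading_ideal_def using zero_ring_all[OF True] by simp
next
  case False
  interpret valuation_ring_nontrivial V by unfold_locales (fact assms False)+
  have 23: "finitely_generated_ideal (poly_ring n) (leading_ideal n lt I)"
    if ca: "coherent_ring V" "archimedean V" and lt: "rational_monomial_order n lt"
      "finitely_generated_ideal (poly_ring n) I" for n lt and I :: "'a mpoly set"
  proof -
    interpret coherent_archimedean V
      by unfold_locales (use ca[unfolded coherent_iff_annihilator archimedean_iff] in blast)+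
    show ?thesis by (rule leading_ideal_fg[OF lt])
  qed
  have 31: "groebner_ring V" if "\<forall>n\<ge>1. \<forall>lt. rational_monomial_order n lt \<longrightarrow>
        (\<forall>I :: 'a mpoly set. finitely_generated_ideal (poly_ring n) I \<longrightarrow>
          finitely_generated_ideal (poly_ring n) (leading_ideal n lt I))"
    unfolding groebner_ring_def using that rational_lex by blast
  have 12: "coherent_ring V \<and> archimedean V" if "groebner_ring V"
    unfolding coherent_iff_annihilator archimedean_iff
    using groebner_annihilator[OF that] groebner_archimedean[OF that] by blast
  from 12 23 31 show ?thesis by blast
qed

end
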